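(* Let $B$ be a normal local ring with maximal ideal $\mathfrak{m}_B$ and residue field $k_B := B/\mathfrak{m}_B$. Let $p$ be a prime number and let $G$ be a cyclic group of order $p$ of local automorphisms of $B$. Let $I_G$ be the augmentation ideal and let $A := B^G$ be the ring of $G$-invariants of $B$. Consider the following conditions: (a) $I_G = B\cdot I(B)$ is a principal ideal of $B$. (b) $B$ is a monogenous $A$-algebra. (c) $B$ is a free $A$-module. Then (a) and (b) are equivalent, and (b) implies (c). Assume, in addition, that $B$ is regular, and consider the following conditions: (d) $A$ is regular. (e) $G$ acts as a pseudo-reflection. Then (c) implies (d). Moreover, if in addition the canonical map $k_A \to k_B$ is an isomorphism, then (a) is equivalent to (e).
   Context: A normal local ring is a local integral domain that is integrally closed in its field of fractions. A regular local ring is noetherian by definition. $G$ is a group of automorphisms of $B$, so it acts faithfully. Fix a generator $\sigma$ of $G$. The augmentation map is $I := \sigma - \mathrm{id} : B \to B$, $b \mapsto \sigma(b) - b$. The augmentation ideal is the $B$-ideal $I_G := (I(b) : b \in B) = B\cdot I(B)$ generated by the image of $I$; it does not depend on the choice of the generator $\sigma$. The $A$-algebra $B$ is monogenous if $B = A[y]$ for some $y \in B$. The ring $A = B^G$ is local with maximal ideal $\mathfrak{m}_A = A \cap \mathfrak{m}_B$, and $k_A := A/\mathfrak{m}_A$ is its residue field. For $B$ regular of dimension $d$, the action of $G$ on $B$ is called a pseudo-reflection if there exists a regular system of parameters $(y_1,\ldots,y_d)$ of $B$ (i.e. a system of $d = \dim B$ elements generating $\mathfrak{m}_B$) such that $y_2,\ldots,y_d$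 are invariant under $G$. *)

theory Defs
  imports "HOL-Algebra.Algebra" "HOL-Algebra.Ring_Divisibility" "HOL-Algebra.Elementary_Groups"
    "HOL-Library.Extended_Nat" "HOL-Computational_Algebra.Primes"
begin

section \<open>Fraction fields and normal domains\<close>

definition frac_class :: "('a, 'm) ring_scheme \<Rightarrow> 'a \<Rightarrow> 'a \<Rightarrow> ('a \<times> 'a) set" where
  "frac_class R a b =
     {(c, d). c \<in> carrier R \<and> d \<in> carrier R - {\<zero>\<^bsub>R\<^esub>} \<and> a \<otimes>\<^bsub>R\<^esub> d = c \<otimes>\<^bsub>R\<^esub> b}"

text \<open>
  The operations are computed on all pairs of representatives at once; over a domain the union
  collapses to a single class (lemmas \<open>frac_field_mult\<close> and \<open>frac_field_add\<close> below).
\<close>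

definition frac_field :: "('a, 'm) ring_scheme \<Rightarrow> ('a \<times> 'a) set ring" where
  "frac_field R =
     \<lparr>carrier = {frac_class R a b | a b. a \<in> carrier R \<and> b \<in> carrier R - {\<zero>\<^bsub>R\<^esub>}},
      monoid.mult = (\<lambda>U V. \<Union>(a, b)\<in>U. \<Union>(c, d)\<in>V. frac_class R (a \<otimes>\<^bsub>R\<^esub> c) (b \<otimes>\<^bsub>R\<^esub> d)),
      one = frac_class R \<one>\<^bsub>R\<^esub> \<one>\<^bsub>R\<^esub>,
      ring.zero = frac_class R \<zero>\<^bsub>R\<^esub> \<one>\<^bsub>R\<^esub>,
      ring.add = (\<lambda>U V. \<Union>(a, b)\<in>U. \<Union>(c, d)\<in>V.
               frac_class R (a \<otimes>\<^bsub>R\<^esub> d \<oplus>\<^bsub>R\<^esub> c \<otimes>\<^bsub>R\<^esub> b) (b \<otimes>\<^bsub>R\<^esub> d))\<rparr>"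

definition frac_embed :: "('a, 'm) ring_scheme \<Rightarrow> 'a \<Rightarrow> ('a \<times> 'a) set" where
  "frac_embed R a = frac_class R a \<one>\<^bsub>R\<^esub>"

definition integral_over :: "('a, 'm) ring_scheme \<Rightarrow> 'a set \<Rightarrow> 'a \<Rightarrow> bool" where
  "integral_over K S x \<longleftrightarrow>
     (\<exists>p \<in> carrier (univ_poly K S). p \<noteq> [] \<and> lead_coeff p = \<one>\<^bsub>K\<^esub> \<and> ring.eval K p x = \<zero>\<^bsub>K\<^esub>)"

definition normal_domain :: "('a, 'm) ring_scheme \<Rightarrow> bool" where
  "normal_domain R \<longleftrightarrow> domain R \<and>
     (\<forall>x \<in> carrier (frac_field R).
        integral_over (frac_field R) (frac_embed R ` carrier R) x \<longrightarrow> x \<in> frac_embed R ` carrier R)"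

lemma UN_pairs_const:
  assumes "(a, b) \<in> U" "(c, d) \<in> V"
    and "\<And>x y u v. \<lbrakk>(x, y) \<in> U; (u, v) \<in> V\<rbrakk> \<Longrightarrow> F x y u v = C"
  shows "(\<Union>(x, y)\<in>U. \<Union>(u, v)\<in>V. F x y u v) = C"
proof
  show "(\<Union>(x, y)\<in>U. \<Union>(u, v)\<in>V. F x y u v) \<subseteq> C" using assms(3) by auto
  have "F a b c d = C" using assms by simp
  thus "C \<subseteq> (\<Union>(x, y)\<in>U. \<Union>(u, v)\<in>V. F x y u v)" using assms(1,2) by blast
qed

context domain begin

lemma frac_class_eq_iff:
  assumes "a \<in> carrier R" "b \<in> carrier R - {\<zero>}" "c \<in> carrier R" "d \<in> carrier R - {\<zero>}"
  shows "frac_class R a b = frac_class R c d \<longleftrightarrow> a \<otimes> d = c \<otimes> b"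
proof
  assume "frac_class R a b = frac_class R c d"
  moreover have "(a, b) \<in> frac_class R a b"
    using assms by (auto simp: frac_class_def)
  ultimately have "(a, b) \<in> frac_class R c d" by simp
  thus "a \<otimes> d = c \<otimes> b" using assms by (auto simp: frac_class_def)
next
  assume eq: "a \<otimes> d = c \<otimes> b"
  have "a \<otimes> y = x \<otimes> b \<longleftrightarrow> c \<otimes> y = x \<otimes> d" if x: "x \<in> carrier R" and y: "y \<in> carrier R" for x y
  proof -
    have "a \<otimes> y = x \<otimes> b \<longleftrightarrow> d \<otimes> (a \<otimes> y) = d \<otimes> (x \<otimes> b)"
      using assms x y by (simp add: m_lcancel)
    also have "d \<otimes> (a \<otimes> y) = b \<otimes> (c \<otimes> y)"
    proof -
      have "d \<otimes> (a \<otimes> y) = (a \<otimes> d) \<otimes> y" using assms y by (simp add: m_ac)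
      also have "\<dots> = b \<otimes> (c \<otimes> y)" unfolding eq using assms y by (simp add: m_ac)
      finally show ?thesis .
    qed
    also have "d \<otimes> (x \<otimes> b) = b \<otimes> (x \<otimes> d)" using assms x by (simp add: m_ac)
    also have "b \<otimes> (c \<otimes> y) = b \<otimes> (x \<otimes> d) \<longleftrightarrow> c \<otimes> y = x \<otimes> d"
      using assms x y by (simp add: m_lcancel)
    finally show ?thesis .
  qed
  thus "frac_class R a b = frac_class R c d" by (auto simp: frac_class_def)
qed

lemma frac_classD:
  assumes "(x, y) \<in> frac_class R a b"
  shows "x \<in> carrier R" "y \<in> carrier R" "y \<noteq> \<zero>" "a \<otimes> y = x \<otimes> b"
  using assms by (auto simp: frac_class_def)

lemma frac_field_mult:
  assumes "a \<in> carrier R" "b \<in> carrier R - {\<zero>}" "c \<in> carrier R" "d \<in> carrier R - {\<zero>}"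
  shows "frac_class R a b \<otimes>\<^bsub>frac_field R\<^esub> frac_class R c d = frac_class R (a \<otimes> c) (b \<otimes> d)"
proof -
  have bd: "b \<otimes> d \<in> carrier R - {\<zero>}" using assms integral by blast
  have *: "frac_class R (x \<otimes> u) (y \<otimes> v) = frac_class R (a \<otimes> c) (b \<otimes> d)"
    if "(x, y) \<in> frac_class R a b" "(u, v) \<in> frac_class R c d" for x y u v
  proof -
    note h = frac_classD[OF that(1)] frac_classD[OF that(2)]
    have yv: "y \<otimes> v \<in> carrier R - {\<zero>}" using h integral by blast
    have "(a \<otimes> c) \<otimes> (y \<otimes> v) = (a \<otimes> y) \<otimes> (c \<otimes> v)" using assms h(1-3,5-7) by (simp add: m_ac)
    also have "\<dots> = (x \<otimes> u) \<otimes> (b \<otimes> d)" unfolding h(4,8) using assms h(1-3,5-7) by (simp add: m_ac)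
    finally have "frac_class R (a \<otimes> c) (b \<otimes> d) = frac_class R (x \<otimes> u) (y \<otimes> v)"
      using assms h yv bd by (subst frac_class_eq_iff) auto
    thus ?thesis by simp
  qed
  have ab: "(a, b) \<in> frac_class R a b" and cd: "(c, d) \<in> frac_class R c d"
    using assms by (auto simp: frac_class_def)
  show ?thesis unfolding frac_field_def by (simp, rule UN_pairs_const[OF ab cd *])
qed

lemma frac_field_add:
  assumes "a \<in> carrier R" "b \<in> carrier R - {\<zero>}" "c \<in> carrier R" "d \<in> carrier R - {\<zero>}"
  shows "frac_class R a b \<oplus>\<^bsub>frac_field R\<^esub> frac_class R c d =
    frac_class R (a \<otimes> d \<oplus> c \<otimes> b) (b \<otimes> d)"
proof -
  have bd: "b \<otimes> d \<in> carrier R - {\<zero>}" using assms integral by blast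
  have *: "frac_class R (x \<otimes> v \<oplus> u \<otimes> y) (y \<otimes> v) = frac_class R (a \<otimes> d \<oplus> c \<otimes> b) (b \<otimes> d)"
    if "(x, y) \<in> frac_class R a b" "(u, v) \<in> frac_class R c d" for x y u v
  proof -
    note h = frac_classD[OF that(1)] frac_classD[OF that(2)]
    have yv: "y \<otimes> v \<in> carrier R - {\<zero>}" using h integral by blast
    have "(a \<otimes> d \<oplus> c \<otimes> b) \<otimes> (y \<otimes> v) = (a \<otimes> y) \<otimes> (d \<otimes> v) \<oplus> (c \<otimes> v) \<otimes> (b \<otimes> y)"
      using assms h(1-3,5-7) by (simp add: m_ac l_distr r_distr)
    also have "\<dots> = (x \<otimes> v \<oplus> u \<otimes> y) \<otimes> (b \<otimes> d)"
      unfolding h(4,8) using assms h(1-3,5-7) by (simp add: m_ac l_distr r_distr)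
    finally have "frac_class R (a \<otimes> d \<oplus> c \<otimes> b) (b \<otimes> d) = frac_class R (x \<otimes> v \<oplus> u \<otimes> y) (y \<otimes> v)"
      using assms h yv bd by (subst frac_class_eq_iff) auto
    thus ?thesis by simp
  qed
  have ab: "(a, b) \<in> frac_class R a b" and cd: "(c, d) \<in> frac_class R c d"
    using assms by (auto simp: frac_class_def)
  show ?thesis unfolding frac_field_def by (simp, rule UN_pairs_const[OF ab cd *])
qed

lemma frac_class_in_carrier:
  assumes "a \<in> carrier R" "b \<in> carrier R - {\<zero>}"
  shows "frac_class R a b \<in> carrier (frac_field R)"
  using assms by (auto simp: frac_field_def)

lemma frac_field_cases:
  assumes "U \<in> carrier (frac_field R)"
  obtains a b where "a \<in> carrier R" "b \<in> carrier R" "b \<noteq> \<zero>" "U = frac_class R a b"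
  using assms by (auto simp: frac_field_def)

lemma frac_field_one: "\<one>\<^bsub>frac_field R\<^esub> = frac_class R \<one> \<one>"
  and frac_field_zero: "\<zero>\<^bsub>frac_field R\<^esub> = frac_class R \<zero> \<one>"
  by (simp_all add: frac_field_def)

lemma nonzero_mult: "\<lbrakk>a \<in> carrier R; b \<in> carrier R; a \<noteq> \<zero>; b \<noteq> \<zero>\<rbrakk> \<Longrightarrow> a \<otimes> b \<noteq> \<zero>"
  using integral by blast

lemmas frac_simps = frac_field_one frac_field_zero frac_field_mult frac_field_add
  frac_class_eq_iff frac_class_in_carrier nonzero_mult

lemma field_frac_field: "field (frac_field R)"
proof -
  have "cring (frac_field R)"
  proof (rule cringI)
    show "abelian_group (frac_field R)"
    proof (rule abelian_groupI)
      fix U V assume "U \<in> carrier (frac_field R)" "V \<in> carrier (frac_field R)"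
      thus "U \<oplus>\<^bsub>frac_field R\<^esub> V \<in> carrier (frac_field R)"
        by (elim frac_field_cases) (simp add: frac_simps)
    next
      show "\<zero>\<^bsub>frac_field R\<^esub> \<in> carrier (frac_field R)" by (simp add: frac_simps)
    next
      fix U V W
      assume "U \<in> carrier (frac_field R)" "V \<in> carrier (frac_field R)" "W \<in> carrier (frac_field R)"
      thus "U \<oplus>\<^bsub>frac_field R\<^esub> V \<oplus>\<^bsub>frac_field R\<^esub> W = U \<oplus>\<^bsub>frac_field R\<^esub> (V \<oplus>\<^bsub>frac_field R\<^esub> W)"
        by (elim frac_field_cases) (simp add: frac_simps l_distr r_distr m_ac a_ac)
    next
      fix U V assume "U \<in> carrier (frac_field R)" "V \<in> carrier (frac_field R)"
      thus "U \<oplus>\<^bsub>frac_field R\<^esub> V = V \<oplus>\<^bsub>frac_field R\<^esub> U"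
        by (elim frac_field_cases) (simp add: frac_simps m_ac a_ac)
    next
      fix U assume "U \<in> carrier (frac_field R)"
      thus "\<zero>\<^bsub>frac_field R\<^esub> \<oplus>\<^bsub>frac_field R\<^esub> U = U"
        by (elim frac_field_cases) (simp add: frac_simps)
    next
      fix U assume "U \<in> carrier (frac_field R)"
      then obtain a b where h: "a \<in> carrier R" "b \<in> carrier R" "b \<noteq> \<zero>" "U = frac_class R a b"
        by (rule frac_field_cases)
      have "\<ominus> a \<otimes> b \<oplus> a \<otimes> b = \<zero>" using h by (simp add: l_minus l_neg)
      hence "frac_class R (\<ominus> a) b \<oplus>\<^bsub>frac_field R\<^esub> U = \<zero>\<^bsub>frac_field R\<^esub>"
        using h by (simp add: frac_simps)
      thus "\<exists>V\<in>carrier (frac_field R). V \<oplus>\<^bsub>frac_field R\<^esub> U = \<zero>\<^bsub>frac_field R\<^esub>"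
        using h by (intro bexI[of _ "frac_class R (\<ominus> a) b"]) (simp_all add: frac_simps)
    qed
    show "comm_monoid (frac_field R)"
    proof (rule comm_monoidI)
      fix U V assume "U \<in> carrier (frac_field R)" "V \<in> carrier (frac_field R)"
      thus "U \<otimes>\<^bsub>frac_field R\<^esub> V \<in> carrier (frac_field R)"
        by (elim frac_field_cases) (simp add: frac_simps)
    next
      show "\<one>\<^bsub>frac_field R\<^esub> \<in> carrier (frac_field R)" by (simp add: frac_simps)
    next
      fix U V W
      assume "U \<in> carrier (frac_field R)" "V \<in> carrier (frac_field R)" "W \<in> carrier (frac_field R)"
      thus "U \<otimes>\<^bsub>frac_field R\<^esub> V \<otimes>\<^bsub>frac_field R\<^esub> W = U \<otimes>\<^bsub>frac_field R\<^esub> (V \<otimes>\<^bsub>frac_field R\<^esub> W)"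
        by (elim frac_field_cases) (simp add: frac_simps m_ac)
    next
      fix U assume "U \<in> carrier (frac_field R)"
      thus "\<one>\<^bsub>frac_field R\<^esub> \<otimes>\<^bsub>frac_field R\<^esub> U = U"
        by (elim frac_field_cases) (simp add: frac_simps)
    next
      fix U V assume "U \<in> carrier (frac_field R)" "V \<in> carrier (frac_field R)"
      thus "U \<otimes>\<^bsub>frac_field R\<^esub> V = V \<otimes>\<^bsub>frac_field R\<^esub> U"
        by (elim frac_field_cases) (simp add: frac_simps m_ac)
    qed
    fix U V W
    assume "U \<in> carrier (frac_field R)" "V \<in> carrier (frac_field R)" "W \<in> carrier (frac_field R)"
    thus "(U \<oplus>\<^bsub>frac_field R\<^esub> V) \<otimes>\<^bsub>frac_field R\<^esub> W =
      U \<otimes>\<^bsub>frac_field R\<^esub> W \<oplus>\<^bsub>frac_field R\<^esub> V \<otimes>\<^bsub>frac_field R\<^esub> W"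
      by (elim frac_field_cases) (simp add: frac_simps l_distr r_distr m_ac a_ac)
  qed
  thus ?thesis
  proof (rule cring.cring_fieldI2)
    show "\<zero>\<^bsub>frac_field R\<^esub> \<noteq> \<one>\<^bsub>frac_field R\<^esub>" by (simp add: frac_simps)
  next
    fix U assume U: "U \<in> carrier (frac_field R)" "U \<noteq> \<zero>\<^bsub>frac_field R\<^esub>"
    then obtain a b where h: "a \<in> carrier R" "b \<in> carrier R" "b \<noteq> \<zero>" "U = frac_class R a b"
      by (elim frac_field_cases)
    with U have "a \<noteq> \<zero>" by (auto simp: frac_simps)
    with h show "\<exists>V\<in>carrier (frac_field R). U \<otimes>\<^bsub>frac_field R\<^esub> V = \<one>\<^bsub>frac_field R\<^esub>"
      by (intro bexI[of _ "frac_class R b a"]) (simp_all add: frac_simps m_ac)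
  qed
qed

lemma frac_embed_hom: "frac_embed R \<in> ring_hom R (frac_field R)"
  by (rule ring_hom_memI) (simp_all add: frac_embed_def frac_simps)

lemma inj_on_frac_embed: "inj_on (frac_embed R) (carrier R)"
  by (rule inj_onI) (simp add: frac_embed_def frac_simps)

end


section \<open>Local rings and regularity\<close>

locale local_ring = cring +
  assumes unique_maximal: "\<exists>!M. maximalideal M R"

definition max_ideal :: "('a, 'm) ring_scheme \<Rightarrow> 'a set" where
  "max_ideal R = (THE M. maximalideal M R)"

definition residue_field :: "('a, 'm) ring_scheme \<Rightarrow> 'a set ring" where
  "residue_field R = R Quot max_ideal R"

text \<open>
  For a local inclusion of \<open>R\<close> into \<open>S\<close>, the map sending the class of \<open>a\<close> modulo the maximal ideal
  of \<open>R\<close> to its class modulo the maximal ideal of \<open>S\<close>. A residue class \<open>U\<close> is the set of its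
  representatives, all of which have the same class over \<open>S\<close>.
\<close>

definition residue_map :: "('a, 'm) ring_scheme \<Rightarrow> 'a set \<Rightarrow> 'a set" where
  "residue_map S U = (\<Union>a\<in>U. max_ideal S +>\<^bsub>S\<^esub> a)"

definition krull_dim :: "('a, 'm) ring_scheme \<Rightarrow> enat" where
  "krull_dim R = Sup {enat n | n.
     \<exists>P. (\<forall>i\<le>n. primeideal (P i) R) \<and> (\<forall>i<n. P i \<subset> P (Suc i))}"

definition regular_system_of_parameters :: "('a, 'm) ring_scheme \<Rightarrow> 'a list \<Rightarrow> bool" where
  "regular_system_of_parameters R ys \<longleftrightarrow>
     set ys \<subseteq> carrier R \<and> enat (length ys) = krull_dim R \<and> Idl\<^bsub>R\<^esub> (set ys) = max_ideal R"

definition regular_local_ring :: "('a, 'm) ring_scheme \<Rightarrow> bool" where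
  "regular_local_ring R \<longleftrightarrow>
     local_ring R \<and> noetherian_ring R \<and> (\<exists>ys. regular_system_of_parameters R ys)"


section \<open>Free modules and monogenous algebras\<close>

definition module_basis :: "('a, 'm) ring_scheme \<Rightarrow> ('a, 'b, 'n) module_scheme \<Rightarrow> 'b set \<Rightarrow> bool" where
  "module_basis R M S \<longleftrightarrow> S \<subseteq> carrier M \<and>
     (\<forall>x \<in> carrier M. \<exists>!c. c \<in> S \<rightarrow>\<^sub>E carrier R \<and> finite {s \<in> S. c s \<noteq> \<zero>\<^bsub>R\<^esub>} \<and>
        x = (\<Oplus>\<^bsub>M\<^esub>s\<in>{s \<in> S. c s \<noteq> \<zero>\<^bsub>R\<^esub>}. c s \<odot>\<^bsub>M\<^esub> s))"

definition free_module :: "('a, 'm) ring_scheme \<Rightarrow> ('a, 'b, 'n) module_scheme \<Rightarrow> bool" where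
  "free_module R M \<longleftrightarrow> module R M \<and> (\<exists>S. module_basis R M S)"

text \<open>\<open>B\<close> acted on by its own multiplication; as the scalars are not recorded in the record, it serves as
  a module over every subring.\<close>

definition mult_module :: "('a, 'm) ring_scheme \<Rightarrow> ('a, 'a) module" where
  "mult_module B = \<lparr>carrier = carrier B, monoid.mult = (\<otimes>\<^bsub>B\<^esub>), one = \<one>\<^bsub>B\<^esub>, ring.zero = \<zero>\<^bsub>B\<^esub>,
     ring.add = (\<oplus>\<^bsub>B\<^esub>), smult = (\<otimes>\<^bsub>B\<^esub>)\<rparr>"

lemma module_mult_module:
  assumes "cring B" and "subring A B"
  shows "module (B\<lparr>carrier := A\<rparr>) (mult_module B)"
proof -
  interpret B: cring B by fact
  interpret A: cring "B\<lparr>carrier := A\<rparr>"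
    using B.subcring_iff[OF subringE(1)[OF assms(2)]] B.subcringI'[OF assms(2)] by blast
  have A: "a \<in> A \<Longrightarrow> a \<in> carrier B" for a using subringE(1)[OF assms(2)] by blast
  show ?thesis
  proof (rule moduleI)
    show "abelian_group (mult_module B)"
    proof (rule abelian_groupI)
      fix x assume "x \<in> carrier (mult_module B)"
      thus "\<exists>y\<in>carrier (mult_module B). y \<oplus>\<^bsub>mult_module B\<^esub> x = \<zero>\<^bsub>mult_module B\<^esub>"
        by (intro bexI[of _ "\<ominus>\<^bsub>B\<^esub> x"]) (simp_all add: mult_module_def B.l_neg)
    qed (simp_all add: mult_module_def B.a_ac)
  qed (simp_all add: mult_module_def A.is_cring A B.l_distr B.r_distr B.m_assoc)
qed

text \<open>The carrier of \<open>A[y]\<close> is the library's \<open>simple_extension\<close>.\<close>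

definition monogenous :: "('a, 'm) ring_scheme \<Rightarrow> 'a set \<Rightarrow> bool" where
  "monogenous B A \<longleftrightarrow> (\<exists>y \<in> carrier B. carrier B = ring.simple_extension B A y)"


section \<open>Groups of local automorphisms\<close>

text \<open>
  As everywhere in \<open>HOL-Algebra.Bij\<close>, self-maps of the carrier are taken to be extensional, so
  that a group of automorphisms is a subgroup of \<open>BijGroup (carrier B)\<close>.
\<close>

definition local_auto :: "('a, 'm) ring_scheme \<Rightarrow> ('a \<Rightarrow> 'a) set" where
  "local_auto B = {f \<in> ring_iso B B \<inter> extensional (carrier B). f ` max_ideal B \<subseteq> max_ideal B}"

definition invariants :: "('a, 'm) ring_scheme \<Rightarrow> ('a \<Rightarrow> 'a) set \<Rightarrow> 'a set" where
  "invariants B G = {b \<in> carrier B. \<forall>g\<in>G. g b = b}"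

abbreviation invariant_ring :: "('a, 'm) ring_scheme \<Rightarrow> ('a \<Rightarrow> 'a) set \<Rightarrow> ('a, 'm) ring_scheme" where
  "invariant_ring B G \<equiv> B\<lparr>carrier := invariants B G\<rparr>"

definition augmentation :: "('a, 'm) ring_scheme \<Rightarrow> ('a \<Rightarrow> 'a) \<Rightarrow> 'a \<Rightarrow> 'a" where
  "augmentation B \<sigma> b = \<sigma> b \<ominus>\<^bsub>B\<^esub> b"

definition augmentation_ideal :: "('a, 'm) ring_scheme \<Rightarrow> ('a \<Rightarrow> 'a) \<Rightarrow> 'a set" where
  "augmentation_ideal B \<sigma> = Idl\<^bsub>B\<^esub> (augmentation B \<sigma> ` carrier B)"

definition pseudo_reflection :: "('a, 'm) ring_scheme \<Rightarrow> ('a \<Rightarrow> 'a) set \<Rightarrow> bool" where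
  "pseudo_reflection B G \<longleftrightarrow>
     (\<exists>ys. regular_system_of_parameters B ys \<and> set (tl ys) \<subseteq> invariants B G)"

lemma subring_invariants:
  assumes "ring B" and G: "G \<subseteq> local_auto B"
  shows "subring (invariants B G) B"
proof -
  interpret ring B by fact
  have hom: "g \<in> ring_hom B B" if "g \<in> G" for g
    using that G by (auto simp: local_auto_def ring_iso_def)
  have fix_inv: "g h = h" if "h \<in> invariants B G" "g \<in> G" for g h
    using that by (simp add: invariants_def)
  have in_inv: "h \<in> invariants B G" if "h \<in> carrier B" "\<And>g. g \<in> G \<Longrightarrow> g h = h" for h
    using that by (simp add: invariants_def)
  have inv_in: "h \<in> carrier B" if "h \<in> invariants B G" for h
    using that by (simp add: invariants_def)
  show ?thesis
  proof (rule subringI)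
    show "invariants B G \<subseteq> carrier B" using inv_in by blast
  next
    show "\<one>\<^bsub>B\<^esub> \<in> invariants B G" using ring_hom_one[OF hom] by (intro in_inv) auto
  next
    fix h k assume hk: "h \<in> invariants B G" "k \<in> invariants B G"
    show "h \<otimes>\<^bsub>B\<^esub> k \<in> invariants B G"
      using hk by (intro in_inv) (simp_all add: ring_hom_mult[OF hom] inv_in fix_inv)
    show "h \<oplus>\<^bsub>B\<^esub> k \<in> invariants B G"
      using hk by (intro in_inv) (simp_all add: ring_hom_add[OF hom] inv_in fix_inv)
  next
    fix h assume h: "h \<in> invariants B G"
    show "\<ominus>\<^bsub>B\<^esub> h \<in> invariants B G"
    proof (rule in_inv)
      fix g assume g: "g \<in> G"
      interpret ring_hom_ring B B g
        using hom[OF g] by (intro ring_hom_ringI2 assms)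
      show "g (\<ominus>\<^bsub>B\<^esub> h) = \<ominus>\<^bsub>B\<^esub> h" using fix_inv[OF h g] inv_in[OF h] by simp
    qed (simp add: inv_in[OF h])
  qed
qed

end

theory Submission
  imports Defs
begin

text \<open>
  Write \<open>\<delta> = \<sigma> - id\<close>, \<open>\<mm>\<close> for the maximal ideal of \<open>B\<close> and \<open>A\<close> for the ring of invariants.

  The equivalence of (a) and (b). If \<open>B = A[y]\<close>, then the \<open>b\<close> with \<open>\<delta> b \<in> (\<delta> y)\<close> form a subring containing
  \<open>A\<close> and \<open>y\<close>, so \<open>I\<^sub>G = (\<delta> y)\<close>. Conversely, if \<open>I\<^sub>G\<close> is principal, then, \<open>B\<close> being local, it is generated by some
  \<open>\<delta> y\<close>. For \<open>0 < k < p\<close> the difference \<open>\<sigma>\<^sup>k y - y\<close> generates \<open>I\<^sub>G\<close> as well (\<open>power_differences_generate\<close>), so all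
  divisions occurring in the interpolation of the values \<open>\<sigma>\<^sup>j f\<close> at the nodes \<open>\<sigma>\<^sup>j y\<close>, \<open>0 \<le> j < p\<close>, can be carried out in \<open>B\<close>
  (\<open>interpolation\<close>). Since \<open>\<sigma>\<close> permutes the nodes, the interpolating polynomial has coefficients in \<open>A\<close>, and its
  value at \<open>y\<close> is \<open>f\<close>. Hence \<open>1, y, \<dots>, y\<^sup>p\<^sup>-\<^sup>1\<close> is a basis of \<open>B\<close> over \<open>A\<close> (\<open>power_basis\<close>), which gives (b) and (c).

  Let \<open>B\<close> be regular of dimension \<open>d\<close> and free over \<open>A\<close>. Then \<open>A\<close> is noetherian, as its ideals are contracted from \<open>B\<close>.
  Take a minimal free resolution \<open>F\<close> of the residue field of \<open>A\<close>. It stays exact over \<open>B\<close>. A regular system of parameters of \<open>B\<close>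
  is a regular sequence, so reducing modulo its members one after the other preserves exactness in all degrees above the
  number of members used; modulo all of them the boundary maps vanish, whence \<open>F\<^bsub>d + 1\<^esub> = 0\<close>
  (\<open>minimal_exact_complex_bounded\<close>). On the other hand Serre's embedding of the Koszul complex into \<open>F\<close> shows that
  \<open>F\<^sub>i \<noteq> 0\<close> for every \<open>i\<close> up to the minimal number \<open>r\<close> of generators of \<open>\<mm>\<^sub>A\<close> (\<open>T_nonempty\<close>). Hence \<open>r \<le> d\<close>. Chains of
  primes of \<open>B\<close> contract to strict chains in \<open>A\<close>, by a norm argument and prime avoidance, and by Krull's height theorem
  chains in \<open>A\<close> have length at most \<open>r\<close>. So \<open>d \<le> dim A \<le> r \<le> d\<close>, and \<open>A\<close> is regular.

  Finally suppose that every element of \<open>B\<close> is congruent modulo \<open>\<mm>\<close> to an element of \<open>A\<close>. If \<open>y\<^sub>1, \<dots>, y\<^sub>d\<close> are parameters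
  and \<open>y\<^sub>2, \<dots>, y\<^sub>d\<close> are invariant, then \<open>I\<^sub>G = (\<delta> y\<^sub>1) + \<mm> I\<^sub>G\<close>, so \<open>I\<^sub>G\<close> is principal by Nakayama. Conversely, if \<open>B = A[y]\<close>,
  where \<open>y \<in> \<mm>\<close> without loss of generality, then \<open>y\<close> and \<open>\<mm>\<^sub>A\<close> generate \<open>\<mm>\<close>, and a regular system of parameters can be
  exchanged for one consisting of \<open>y\<close> and of invariants.
\<close>

section \<open>Ideals of commutative rings\<close>

context cring begin

lemma ideal_axioms_mem:
  assumes "ideal J R"
  shows ideal_mem_carrier: "a \<in> J \<Longrightarrow> a \<in> carrier R"
    and ideal_zero: "\<zero> \<in> J"
    and ideal_add: "\<lbrakk>a \<in> J; b \<in> J\<rbrakk> \<Longrightarrow> a \<oplus> b \<in> J"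
    and ideal_uminus: "a \<in> J \<Longrightarrow> \<ominus> a \<in> J"
    and ideal_diff: "\<lbrakk>a \<in> J; b \<in> J\<rbrakk> \<Longrightarrow> a \<ominus> b \<in> J"
    and ideal_lmult: "\<lbrakk>r \<in> carrier R; a \<in> J\<rbrakk> \<Longrightarrow> r \<otimes> a \<in> J"
    and ideal_rmult: "\<lbrakk>r \<in> carrier R; a \<in> J\<rbrakk> \<Longrightarrow> a \<otimes> r \<in> J"
proof -
  interpret ideal J R by fact
  show "a \<in> J \<Longrightarrow> a \<in> carrier R" "\<zero> \<in> J" "\<lbrakk>a \<in> J; b \<in> J\<rbrakk> \<Longrightarrow> a \<oplus> b \<in> J"
    "a \<in> J \<Longrightarrow> \<ominus> a \<in> J" "\<lbrakk>a \<in> J; b \<in> J\<rbrakk> \<Longrightarrow> a \<ominus> b \<in> J"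
    "\<lbrakk>r \<in> carrier R; a \<in> J\<rbrakk> \<Longrightarrow> r \<otimes> a \<in> J" "\<lbrakk>r \<in> carrier R; a \<in> J\<rbrakk> \<Longrightarrow> a \<otimes> r \<in> J"
    by (auto simp: I_l_closed I_r_closed a_minus_def)
qed

lemma cring_idealI:
  assumes "J \<subseteq> carrier R" "\<zero> \<in> J" "\<And>a b. \<lbrakk>a \<in> J; b \<in> J\<rbrakk> \<Longrightarrow> a \<oplus> b \<in> J"
    "\<And>r a. \<lbrakk>r \<in> carrier R; a \<in> J\<rbrakk> \<Longrightarrow> r \<otimes> a \<in> J"
  shows "ideal J R"
proof (rule idealI)
  show "subgroup J (add_monoid R)"
  proof (rule add.subgroupI)
    fix a assume a: "a \<in> J"
    have "\<ominus> \<one> \<otimes> a = \<ominus> a" using a assms(1) by (simp add: l_minus subset_eq)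
    thus "\<ominus> a \<in> J" using assms(4)[OF _ a, of "\<ominus> \<one>"] by simp
  qed (use assms in auto)
  show "a \<otimes> r \<in> J" if "a \<in> J" "r \<in> carrier R" for a r
    using assms(4)[OF that(2,1)] that assms(1) by (simp add: m_comm subset_eq)
qed (use assms ring_axioms in auto)

lemma ideal_diff_cancel:
  assumes "ideal J R" "a \<ominus> b \<in> J" "b \<in> J" "a \<in> carrier R"
  shows "a \<in> J"
proof -
  have b: "b \<in> carrier R" using assms(1,3) ideal_mem_carrier by blast
  have "(a \<ominus> b) \<oplus> b = a" using b assms(4) by algebra
  thus ?thesis using ideal_add[OF assms(1,2,3)] by simp
qed

lemma ideal_add_cancel:
  assumes "ideal J R" "a \<oplus> b \<in> J" "b \<in> J" "a \<in> carrier R"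
  shows "a \<in> J"
proof -
  have b: "b \<in> carrier R" using assms(1,3) ideal_mem_carrier by blast
  have "(a \<oplus> b) \<ominus> b = a" using b assms(4) by algebra
  thus ?thesis using ideal_diff[OF assms(1,2,3)] by simp
qed

lemma Idl_insert:
  assumes J: "ideal J R" and x: "x \<in> carrier R"
  shows "Idl (insert x J) = {j \<oplus> r \<otimes> x | j r. j \<in> J \<and> r \<in> carrier R}" (is "_ = ?K")
proof
  note J_simps = ideal_axioms_mem[OF J]
  have K: "ideal ?K R"
  proof (rule cring_idealI)
    show "?K \<subseteq> carrier R" using x J_simps(1) by auto
    have "\<zero> = \<zero> \<oplus> \<zero> \<otimes> x" using x by simp
    thus "\<zero> \<in> ?K" using J_simps(2) by blast
  next
    fix a b assume "a \<in> ?K" "b \<in> ?K"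
    then obtain j r j' r' where h: "j \<in> J" "j' \<in> J" "r \<in> carrier R" "r' \<in> carrier R"
      "a = j \<oplus> r \<otimes> x" "b = j' \<oplus> r' \<otimes> x" by blast
    have "a \<oplus> b = (j \<oplus> j') \<oplus> (r \<oplus> r') \<otimes> x"
      unfolding h using h(1,2)[THEN J_simps(1)] h(3,4) x by algebra
    thus "a \<oplus> b \<in> ?K" using h J_simps(3) by blast
  next
    fix s a assume s: "s \<in> carrier R" and "a \<in> ?K"
    then obtain j r where h: "j \<in> J" "r \<in> carrier R" "a = j \<oplus> r \<otimes> x" by blast
    have "s \<otimes> a = s \<otimes> j \<oplus> (s \<otimes> r) \<otimes> x"
      unfolding h using h(1)[THEN J_simps(1)] h(2) x s by algebra
    thus "s \<otimes> a \<in> ?K" using h J_simps(6) s by blast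
  qed
  have "x = \<zero> \<oplus> \<one> \<otimes> x" using x by simp
  hence "x \<in> ?K" using J_simps(2) by blast
  moreover have "j \<in> ?K" if "j \<in> J" for j
  proof -
    have "j = j \<oplus> \<zero> \<otimes> x" using x that J_simps(1) by simp
    thus ?thesis using that by blast
  qed
  ultimately show "Idl (insert x J) \<subseteq> ?K" using K by (intro genideal_minimal) auto
  have I: "ideal (Idl (insert x J)) R" "insert x J \<subseteq> Idl (insert x J)"
    using x J_simps(1) genideal_ideal[of "insert x J"] genideal_self[of "insert x J"] by auto
  show "?K \<subseteq> Idl (insert x J)"
    using I(2) x by (auto intro!: ideal_add[OF I(1)] ideal_lmult[OF I(1)])
qed

lemma Idl_insert_ideal:
  assumes "ideal J R" "x \<in> carrier R"
  shows "ideal (Idl (insert x J)) R" "J \<subseteq> Idl (insert x J)" "x \<in> Idl (insert x J)"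
  using genideal_ideal[of "insert x J"] genideal_self[of "insert x J"] assms ideal_mem_carrier[OF assms(1)]
  by auto

lemma Idl_Un_Idl:
  assumes "S \<subseteq> carrier R" "T \<subseteq> carrier R"
  shows "Idl (S \<union> Idl T) = Idl (S \<union> T)"
proof
  have T: "ideal (Idl T) R" "T \<subseteq> Idl T" using assms genideal_ideal genideal_self by auto
  have ST: "ideal (Idl (S \<union> T)) R" "S \<union> T \<subseteq> Idl (S \<union> T)"
    using assms genideal_ideal genideal_self by (meson Un_least)+
  have "Idl T \<subseteq> Idl (S \<union> T)" using ST by (intro genideal_minimal) auto
  thus "Idl (S \<union> Idl T) \<subseteq> Idl (S \<union> T)" using ST by (intro genideal_minimal) auto
  show "Idl (S \<union> T) \<subseteq> Idl (S \<union> Idl T)"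
    using T assms ideal_mem_carrier[OF T(1)] by (intro subset_Idl_subset) auto
qed

lemma Idl_insert_Idl:
  assumes "S \<subseteq> carrier R" "x \<in> carrier R"
  shows "Idl (insert x (Idl S)) = Idl (insert x S)"
  using Idl_Un_Idl[of "{x}" S] assms by simp

lemma Idl_ideal_eq: "ideal J R \<Longrightarrow> Idl J = J"
  using genideal_minimal[of J J] genideal_self[of J] ideal_mem_carrier by blast

lemma ideal_quotient_ideal:
  assumes J: "ideal J R" and z: "z \<in> carrier R"
  shows "ideal {a \<in> carrier R. a \<otimes> z \<in> J} R"
proof (rule cring_idealI)
  fix r a assume "r \<in> carrier R" "a \<in> {a \<in> carrier R. a \<otimes> z \<in> J}"
  thus "r \<otimes> a \<in> {a \<in> carrier R. a \<otimes> z \<in> J}"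
    using ideal_lmult[OF J, of r "a \<otimes> z"] z by (simp add: m_assoc)
qed (use z ideal_zero[OF J] ideal_add[OF J] in \<open>auto simp: l_distr\<close>)

lemma prime_pow_mem:
  assumes "primeideal P R" "y \<in> carrier R" "y [^] (n::nat) \<in> P"
  shows "y \<in> P"
proof -
  interpret P: primeideal P R by fact
  show ?thesis using assms(3)
  proof (induction n)
    case 0
    hence "P = carrier R" using P.one_imp_carrier by simp
    thus ?case using P.I_notcarr by simp
  next
    case (Suc n)
    hence "y [^] n \<in> P \<or> y \<in> P" using P.I_prime[of "y [^] n" y] assms(2) by simp
    thus ?case using Suc.IH by blast
  qed
qed

lemma prime_one_notin: "primeideal P R \<Longrightarrow> \<one> \<notin> P"
  using ideal.one_imp_carrier[of P R] primeideal.I_notcarr[of P R] primeideal.axioms(1) by blast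

text \<open>The preimage of \<open>J R\<^sub>P\<close> in \<open>R\<close>. Saturated ideals stand for the ideals of the local ring \<open>R\<^sub>P\<close>, which therefore
  need not be constructed.\<close>

definition saturation :: "'a set \<Rightarrow> 'a set \<Rightarrow> 'a set" where
  "saturation P J = {a \<in> carrier R. \<exists>s \<in> carrier R - P. s \<otimes> a \<in> J}"

definition saturated :: "'a set \<Rightarrow> 'a set \<Rightarrow> bool" where
  "saturated P J \<longleftrightarrow> (\<forall>s \<in> carrier R - P. \<forall>a \<in> carrier R. s \<otimes> a \<in> J \<longrightarrow> a \<in> J)"

lemma saturatedD: "\<lbrakk>saturated P J; s \<in> carrier R; s \<notin> P; a \<in> carrier R; s \<otimes> a \<in> J\<rbrakk> \<Longrightarrow> a \<in> J"
  unfolding saturated_def by blast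

lemma saturated_mono: "saturated P J \<Longrightarrow> P \<subseteq> Q \<Longrightarrow> saturated Q J"
  unfolding saturated_def by blast

lemma saturation_saturated:
  assumes P: "primeideal P R"
  shows "saturated P (saturation P J)"
  unfolding saturated_def
proof (intro ballI impI)
  interpret P: primeideal P R by fact
  fix s a assume s: "s \<in> carrier R - P" and a: "a \<in> carrier R" and "s \<otimes> a \<in> saturation P J"
  then obtain t where t: "t \<in> carrier R - P" "t \<otimes> (s \<otimes> a) \<in> J" unfolding saturation_def by blast
  have "t \<otimes> s \<notin> P" using P.I_prime[of t s] s t by blast
  moreover have "(t \<otimes> s) \<otimes> a \<in> J" using s t a by (simp add: m_assoc)
  ultimately show "a \<in> saturation P J" unfolding saturation_def using s t a by blast
qed

lemma saturation_ideal:
  assumes P: "primeideal P R" and J: "ideal J R"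
  shows "ideal (saturation P J) R"
proof (rule cring_idealI)
  interpret P: primeideal P R by fact
  show "saturation P J \<subseteq> carrier R" unfolding saturation_def by blast
  show "\<zero> \<in> saturation P J"
    unfolding saturation_def using prime_one_notin[OF P] ideal_zero[OF J] by force
  show "a \<oplus> b \<in> saturation P J" if ab: "a \<in> saturation P J" "b \<in> saturation P J" for a b
  proof -
    from ab obtain s t where h: "s \<in> carrier R - P" "t \<in> carrier R - P" "s \<otimes> a \<in> J" "t \<otimes> b \<in> J"
      "a \<in> carrier R" "b \<in> carrier R" unfolding saturation_def by blast
    have "s \<otimes> t \<notin> P" using P.I_prime[of s t] h by blast
    moreover have st: "s \<in> carrier R" "t \<in> carrier R" using h by auto
    hence "(s \<otimes> t) \<otimes> (a \<oplus> b) = t \<otimes> (s \<otimes> a) \<oplus> s \<otimes> (t \<otimes> b)" using h(5,6) by algebra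
    hence "(s \<otimes> t) \<otimes> (a \<oplus> b) \<in> J" using h ideal_add[OF J] ideal_lmult[OF J] by simp
    ultimately show ?thesis unfolding saturation_def using h by blast
  qed
  show "r \<otimes> a \<in> saturation P J" if r: "r \<in> carrier R" and a: "a \<in> saturation P J" for r a
  proof -
    from a obtain s where h: "s \<in> carrier R - P" "s \<otimes> a \<in> J" "a \<in> carrier R"
      unfolding saturation_def by blast
    have "s \<in> carrier R" using h by auto
    hence "s \<otimes> (r \<otimes> a) = r \<otimes> (s \<otimes> a)" using h(3) r by algebra
    hence "s \<otimes> (r \<otimes> a) \<in> J" using h r ideal_lmult[OF J] by simp
    thus ?thesis unfolding saturation_def using h r by blast
  qed
qed

lemma saturation_superset:
  assumes "primeideal P R" "ideal J R"
  shows "J \<subseteq> saturation P J"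
proof
  fix a assume a: "a \<in> J"
  hence "\<one> \<in> carrier R - P" "\<one> \<otimes> a \<in> J" "a \<in> carrier R"
    using prime_one_notin[OF assms(1)] ideal_mem_carrier[OF assms(2)] by auto
  thus "a \<in> saturation P J" unfolding saturation_def by blast
qed

lemma saturation_mono: "I \<subseteq> J \<Longrightarrow> saturation P I \<subseteq> saturation P J"
  unfolding saturation_def by blast

text \<open>Zorn's lemma applied downwards, as the intersection of a chain of primes is prime.\<close>

lemma exists_minimal_prime_between:
  assumes J: "ideal J R" and P: "primeideal P R" "J \<subseteq> P"
  obtains Q where "primeideal Q R" "J \<subseteq> Q" "Q \<subseteq> P"
    "\<And>Q'. \<lbrakk>primeideal Q' R; J \<subseteq> Q'; Q' \<subseteq> Q\<rbrakk> \<Longrightarrow> Q' = Q"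
proof -
  define S where "S = {uminus Q | Q. primeideal Q R \<and> J \<subseteq> Q \<and> Q \<subseteq> P}"
  have "\<exists>M\<in>S. \<forall>U\<in>S. M \<subseteq> U \<longrightarrow> U = M"
  proof (rule subset_Zorn)
    fix C assume C: "subset.chain S C"
    show "\<exists>V\<in>S. \<forall>U\<in>C. U \<subseteq> V"
    proof (cases "C = {}")
      case True
      thus ?thesis using P unfolding S_def by blast
    next
      case False
      define D where "D = uminus ` C"
      have D: "primeideal Q R" "J \<subseteq> Q" "Q \<subseteq> P" if "Q \<in> D" for Q
        using C that unfolding D_def S_def pred_on.chain_def by auto
      have D_chain: "Q \<subseteq> Q' \<or> Q' \<subseteq> Q" if "Q \<in> D" "Q' \<in> D" for Q Q'
        using C that unfolding D_def pred_on.chain_def by auto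
      have D_ne: "D \<noteq> {}" using False unfolding D_def by simp
      have "primeideal (\<Inter>D) R"
      proof (rule primeidealI)
        show "ideal (\<Inter>D) R" using D(1) D_ne primeideal.axioms(1) by (intro i_Intersect) auto
        show "carrier R \<noteq> \<Inter>D" using D(1) D_ne prime_one_notin by blast
        fix a b assume ab: "a \<in> carrier R" "b \<in> carrier R" "a \<otimes> b \<in> \<Inter>D"
        show "a \<in> \<Inter>D \<or> b \<in> \<Inter>D"
        proof (rule ccontr)
          assume "\<not> ?thesis"
          then obtain Q Q' where Q: "Q \<in> D" "Q' \<in> D" "a \<notin> Q" "b \<notin> Q'" by blast
          with D_chain obtain Q'' where "Q'' \<in> D" "a \<notin> Q''" "b \<notin> Q''" by blast
          thus False using primeideal.I_prime[OF D(1), of Q'' a b] ab by blast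
        qed
      qed (rule cring_axioms)
      moreover have "J \<subseteq> \<Inter>D" using D(2) by (rule Inter_greatest)
      moreover have "\<Inter>D \<subseteq> P" using D(3) D_ne by (rule Inf_less_eq)
      ultimately have "- \<Inter>D \<in> S" unfolding S_def by (intro CollectI exI[of _ "\<Inter>D"] conjI refl)
      moreover have "U \<subseteq> - \<Inter>D" if "U \<in> C" for U using that unfolding D_def by blast
      ultimately show ?thesis by blast
    qed
  qed
  then obtain M where M: "M \<in> S" "\<And>U. U \<in> S \<Longrightarrow> M \<subseteq> U \<Longrightarrow> U = M" by blast
  then obtain Q where Q: "M = - Q" "primeideal Q R" "J \<subseteq> Q" "Q \<subseteq> P" unfolding S_def by blast
  have "Q' = Q" if "primeideal Q' R" "J \<subseteq> Q'" "Q' \<subseteq> Q" for Q'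
  proof -
    have "- Q' \<in> S" unfolding S_def using that Q by blast
    thus ?thesis using M(2)[of "- Q'"] that(3) Q(1) by auto
  qed
  thus ?thesis using that Q by blast
qed

end

section \<open>Noetherian rings\<close>

locale noetherian_cring = noetherian_ring + cring

context noetherian_cring begin

lemma exists_maximal_ideal_in:
  assumes "S \<noteq> {}" "\<And>I. I \<in> S \<Longrightarrow> ideal I R"
  obtains M where "M \<in> S" "\<And>I. \<lbrakk>I \<in> S; M \<subseteq> I\<rbrakk> \<Longrightarrow> I = M"
proof -
  have "\<exists>M\<in>S. \<forall>U\<in>S. M \<subseteq> U \<longrightarrow> U = M"
  proof (rule subset_Zorn)
    fix C assume C: "subset.chain S C"
    show "\<exists>V\<in>S. \<forall>U\<in>C. U \<subseteq> V"
    proof (cases "C = {}")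
      case True
      thus ?thesis using assms(1) by blast
    next
      case False
      have "subset.chain {I. ideal I R} C" using C assms(2) unfolding pred_on.chain_def by blast
      hence "\<Union>C \<in> C" using ideal_chain_is_trivial False by blast
      moreover have "C \<subseteq> S" using C unfolding pred_on.chain_def by blast
      ultimately have "\<Union>C \<in> S" by (rule rev_subsetD)
      thus ?thesis by (rule bexI[rotated]) auto
    qed
  qed
  thus ?thesis using that by blast
qed

lemma noetherian_induct [consumes 1, case_names step]:
  assumes "ideal J R"
    and "\<And>J. \<lbrakk>ideal J R; \<And>I. \<lbrakk>ideal I R; J \<subset> I\<rbrakk> \<Longrightarrow> Q I\<rbrakk> \<Longrightarrow> Q J"
  shows "Q J"
proof (rule ccontr)
  assume "\<not> Q J"
  hence "{I. ideal I R \<and> \<not> Q I} \<noteq> {}" using assms(1) by blast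
  then obtain M where M: "M \<in> {I. ideal I R \<and> \<not> Q I}"
    "\<And>I. \<lbrakk>I \<in> {I. ideal I R \<and> \<not> Q I}; M \<subseteq> I\<rbrakk> \<Longrightarrow> I = M"
    by (rule exists_maximal_ideal_in) auto
  have "Q M"
  proof (rule assms(2))
    show "Q I" if "ideal I R" "M \<subset> I" for I using M(2)[of I] that by blast
  qed (use M(1) in blast)
  thus False using M(1) by blast
qed

text \<open>Nakayama's lemma over the local ring \<open>R\<^sub>P\<close>. A generator \<open>a\<close> with \<open>t a = m + p a\<close>, where \<open>t \<notin> P\<close> and \<open>p \<in> P\<close>, is
  eliminated by means of \<open>t - p \<notin> P\<close>; the generators are treated one at a time.\<close>

lemma nakayama:
  assumes P: "primeideal P R" and I: "ideal I R" and K: "ideal K R" "saturated P K"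
    and IPK: "\<And>a. a \<in> I \<Longrightarrow> \<exists>t \<in> carrier R - P. t \<otimes> a \<in> Idl (K \<union> {p \<otimes> f | p f. p \<in> P \<and> f \<in> I})"
  shows "I \<subseteq> K"
proof -
  interpret P: primeideal P R by fact
  \<comment> \<open>the ideal \<open>K + P F\<close>\<close>
  define N where "N F = Idl (K \<union> {p \<otimes> f | p f. p \<in> P \<and> f \<in> F})" for F
  have gens: "K \<union> {p \<otimes> f | p f. p \<in> P \<and> f \<in> F} \<subseteq> carrier R" if "F \<subseteq> carrier R" for F
    using that ideal_mem_carrier[OF K(1)] P.Icarr by blast
  have N: "ideal (N F) R" "K \<subseteq> N F" "\<And>p f. \<lbrakk>p \<in> P; f \<in> F\<rbrakk> \<Longrightarrow> p \<otimes> f \<in> N F" if "F \<subseteq> carrier R" for F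
    unfolding N_def using genideal_ideal[OF gens[OF that]] genideal_self[OF gens[OF that]] by blast+
  have N_min: "N F \<subseteq> L" if "ideal L R" "K \<subseteq> L" "\<And>p f. \<lbrakk>p \<in> P; f \<in> F\<rbrakk> \<Longrightarrow> p \<otimes> f \<in> L" for F L
    unfolding N_def using that by (intro genideal_minimal) auto
  have N_insert: "\<exists>m \<in> N F. \<exists>p \<in> P. n = m \<oplus> p \<otimes> a"
    if F: "F \<subseteq> carrier R" and a: "a \<in> carrier R" and n: "n \<in> N (insert a F)" for F a n
  proof -
    let ?L = "{m \<oplus> p \<otimes> a | m p. m \<in> N F \<and> p \<in> P}"
    note NF = ideal_axioms_mem[OF N(1)[OF F]]
    have "ideal ?L R"
    proof (rule cring_idealI)
      show "?L \<subseteq> carrier R" using a NF(1) P.Icarr by auto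
      have "\<zero> = \<zero> \<oplus> \<zero> \<otimes> a" using a by simp
      thus "\<zero> \<in> ?L" using NF(2) P.zero_closed by blast
    next
      fix u v assume "u \<in> ?L" "v \<in> ?L"
      then obtain m p m' p' where h: "m \<in> N F" "m' \<in> N F" "p \<in> P" "p' \<in> P"
        "u = m \<oplus> p \<otimes> a" "v = m' \<oplus> p' \<otimes> a" by blast
      have "u \<oplus> v = (m \<oplus> m') \<oplus> (p \<oplus> p') \<otimes> a"
        unfolding h using h(1,2)[THEN NF(1)] h(3,4)[THEN P.Icarr] a by algebra
      thus "u \<oplus> v \<in> ?L" using h NF(3) P.a_closed by blast
    next
      fix r u assume r: "r \<in> carrier R" and "u \<in> ?L"
      then obtain m p where h: "m \<in> N F" "p \<in> P" "u = m \<oplus> p \<otimes> a" by blast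
      have "r \<otimes> u = r \<otimes> m \<oplus> (r \<otimes> p) \<otimes> a"
        unfolding h using h(1)[THEN NF(1)] h(2)[THEN P.Icarr] a r by algebra
      thus "r \<otimes> u \<in> ?L" using h NF(6) P.I_l_closed r by blast
    qed
    moreover have NL: "N F \<subseteq> ?L"
    proof
      fix m assume m: "m \<in> N F"
      have "m = m \<oplus> \<zero> \<otimes> a" using NF(1)[OF m] a by simp
      thus "m \<in> ?L" using m P.zero_closed by blast
    qed
    moreover have "p \<otimes> f \<in> ?L" if p: "p \<in> P" and f: "f \<in> insert a F" for p f
    proof (cases "f = a")
      case True
      have "p \<otimes> a = \<zero> \<oplus> p \<otimes> a" using p P.Icarr a by simp
      thus ?thesis unfolding True using p NF(2) by blast
    next
      case False
      thus ?thesis using NL N(3)[OF F p] f by blast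
    qed
    ultimately have "N (insert a F) \<subseteq> ?L" using N(2)[OF F] by (intro N_min) auto
    thus ?thesis using n by blast
  qed
  have main: "F \<subseteq> K" if "finite F" "F \<subseteq> carrier R" "\<And>a. a \<in> F \<Longrightarrow> \<exists>t \<in> carrier R - P. t \<otimes> a \<in> N F" for F
    using that
  proof (induction F rule: finite_induct)
    case (insert a F)
    hence F: "F \<subseteq> carrier R" and a: "a \<in> carrier R" by auto
    note NF = ideal_axioms_mem[OF N(1)[OF F]]
    obtain t where t: "t \<in> carrier R - P" "t \<otimes> a \<in> N (insert a F)" using insert.prems(2) by blast
    then obtain m p where mp: "m \<in> N F" "p \<in> P" "t \<otimes> a = m \<oplus> p \<otimes> a"
      using N_insert[OF F a] by blast
    define u where "u = t \<ominus> p"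
    have u: "u \<in> carrier R" "u \<notin> P"
      unfolding u_def using t mp(2) P.Icarr ideal_diff_cancel[OF P.is_ideal, of t p] by auto
    have tc: "t \<in> carrier R" using t by blast
    have "u \<otimes> a = t \<otimes> a \<ominus> p \<otimes> a" unfolding u_def using tc mp(2)[THEN P.Icarr] a by algebra
    also have "\<dots> = m" unfolding mp(3) using NF(1)[OF mp(1)] mp(2)[THEN P.Icarr] a by algebra
    finally have ua: "u \<otimes> a \<in> N F" using mp(1) by simp
    have "F \<subseteq> K"
    proof (rule insert.IH[OF F])
      fix f assume f: "f \<in> F"
      hence fc: "f \<in> carrier R" using F by blast
      obtain s where s: "s \<in> carrier R - P" "s \<otimes> f \<in> N (insert a F)" using insert.prems(2) f by blast
      then obtain n q where nq: "n \<in> N F" "q \<in> P" "s \<otimes> f = n \<oplus> q \<otimes> a"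
        using N_insert[OF F a] by blast
      have "(u \<otimes> s) \<otimes> f = u \<otimes> (s \<otimes> f)" using u s fc by (simp add: m_assoc)
      also have "\<dots> = u \<otimes> n \<oplus> q \<otimes> (u \<otimes> a)"
        unfolding nq(3) using u NF(1)[OF nq(1)] nq(2)[THEN P.Icarr] a by algebra
      also have "\<dots> \<in> N F" using nq(1,2) ua u(1) P.Icarr NF(3,6) by simp
      finally have "(u \<otimes> s) \<otimes> f \<in> N F" .
      moreover have "u \<otimes> s \<in> carrier R - P" using u s P.I_prime[of u s] by blast
      ultimately show "\<exists>t\<in>carrier R - P. t \<otimes> f \<in> N F" by blast
    qed
    moreover from this have "N F \<subseteq> K"
      using ideal_lmult[OF K(1)] P.Icarr by (intro N_min[OF K(1)]) auto
    hence "a \<in> K" using saturatedD[OF K(2) u a] ua by blast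
    ultimately show ?case by simp
  qed simp
  obtain F where F: "F \<subseteq> carrier R" "finite F" "I = Idl F" using finetely_gen[OF I] by blast
  have FI: "F \<subseteq> I" using F genideal_self by simp
  have "N I \<subseteq> N F"
  proof (rule N_min[OF N(1,2)[OF F(1)]])
    fix p f assume p: "p \<in> P" and f: "f \<in> I"
    have "F \<subseteq> {f \<in> carrier R. f \<otimes> p \<in> N F}"
      using F(1) N(3)[OF F(1) p] p P.Icarr by (auto simp: m_comm subset_eq)
    hence "I \<subseteq> {f \<in> carrier R. f \<otimes> p \<in> N F}"
      unfolding F(3) using p P.Icarr by (intro genideal_minimal ideal_quotient_ideal N(1)[OF F(1)]) auto
    thus "p \<otimes> f \<in> N F" using f p P.Icarr by (auto simp: m_comm subset_eq)
  qed
  hence "F \<subseteq> K" using IPK FI unfolding N_def[symmetric] by (intro main F) blast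
  thus ?thesis unfolding F(3) by (rule genideal_minimal[OF K(1)])
qed

end

section \<open>Krull's principal ideal theorem and the length of chains of primes\<close>

context noetherian_cring begin

text \<open>The ring \<open>R\<^sub>P / J R\<^sub>P\<close> is Artinian if \<open>P\<close> is minimal over \<open>J\<close>. By noetherian induction the claim holds for all larger
  ideals. Choose \<open>z \<notin> J\<close> such that \<open>{a. a z \<in> J}\<close> is as large as possible. This ideal is prime, hence equal to \<open>P\<close>, so
  there is nothing between \<open>J\<close> and \<open>J + (z)\<close> at \<open>P\<close>. A member of the chain is therefore determined by whether
  it contains \<open>z\<close> and by its sum with \<open>(z)\<close>.\<close>

lemma saturated_chain_stabilises:
  assumes P: "primeideal P R" and J: "ideal J R"
  shows "\<lbrakk>saturated P J; \<And>Q. \<lbrakk>primeideal Q R; J \<subseteq> Q; Q \<subseteq> P\<rbrakk> \<Longrightarrow> Q = P;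
          \<And>n. ideal (f n) R; \<And>n. saturated P (f n); \<And>n. J \<subseteq> f n; antimono f\<rbrakk>
         \<Longrightarrow> \<exists>n. \<forall>k\<ge>n. f k = f (n::nat)"
  using J
proof (induction J arbitrary: f rule: noetherian_induct)
  case (step J)
  interpret P: primeideal P R by fact
  note J = step.hyps and satJ = step.prems(1) and minP = step.prems(2)
    and f = step.prems(3) and satf = step.prems(4) and Jf = step.prems(5)
  have f_anti: "f n \<subseteq> f m" if "m \<le> n" for m n using antimonoD[OF step.prems(6) that] .
  show ?case
  proof (cases "\<one> \<in> J")
    case True
    hence "f n = carrier R" for n using ideal.one_imp_carrier[OF f] Jf by blast
    thus ?thesis by simp
  next
    case False
    define C where "C z = {a \<in> carrier R. a \<otimes> z \<in> J}" for z
    have C: "ideal (C z) R" if "z \<in> carrier R" for z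
      unfolding C_def by (rule ideal_quotient_ideal[OF J that])
    have "C \<one> \<in> C ` (carrier R - J)" using False by blast
    hence "C ` (carrier R - J) \<noteq> {}" by blast
    then obtain M where M: "M \<in> C ` (carrier R - J)" "\<And>I. \<lbrakk>I \<in> C ` (carrier R - J); M \<subseteq> I\<rbrakk> \<Longrightarrow> I = M"
      by (rule exists_maximal_ideal_in) (use C in blast)+
    then obtain z where z: "z \<in> carrier R" "z \<notin> J" "M = C z" by blast
    have "primeideal (C z) R"
    proof (rule primeidealI[OF C[OF z(1)] cring_axioms])
      have "\<one> \<notin> C z" using z unfolding C_def by simp
      thus "carrier R \<noteq> C z" by blast
      fix a b assume ab: "a \<in> carrier R" "b \<in> carrier R" "a \<otimes> b \<in> C z"
      show "a \<in> C z \<or> b \<in> C z"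
      proof (cases "b \<in> C z")
        case False
        hence bz: "b \<otimes> z \<in> carrier R - J" using ab(2) z(1) unfolding C_def by auto
        have "C z \<subseteq> C (b \<otimes> z)"
        proof
          fix c assume c: "c \<in> C z"
          hence cc: "c \<in> carrier R" unfolding C_def by blast
          have "c \<otimes> (b \<otimes> z) = b \<otimes> (c \<otimes> z)" using cc ab(2) z(1) by algebra
          thus "c \<in> C (b \<otimes> z)" using c ideal_lmult[OF J ab(2)] cc unfolding C_def by auto
        qed
        hence "C (b \<otimes> z) = C z" using M(2)[of "C (b \<otimes> z)"] bz z(3) by blast
        moreover have "a \<otimes> (b \<otimes> z) \<in> J" using ab z(1) unfolding C_def by (auto simp: m_assoc)
        ultimately show ?thesis using ab(1) unfolding C_def by blast
      qed blast
    qed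
    moreover have "J \<subseteq> C z"
      unfolding C_def using ideal_mem_carrier[OF J] ideal_rmult[OF J z(1)] by blast
    moreover have "C z \<subseteq> P"
      unfolding C_def using saturatedD[OF satJ _ _ z(1)] z(2) by blast
    ultimately have Cz: "C z = P" by (rule minP)
    define g where "g I = saturation P (Idl (insert z I))" for I
    have g: "ideal (g I) R" "saturated P (g I)" "I \<subseteq> g I" "z \<in> g I" if "ideal I R" for I
      unfolding g_def
      using saturation_ideal[OF P Idl_insert_ideal(1)[OF that z(1)]] saturation_saturated[OF P]
        saturation_superset[OF P Idl_insert_ideal(1)[OF that z(1)]] Idl_insert_ideal[OF that z(1)] by blast+
    have g_mono: "g I \<subseteq> g I'" if "I \<subseteq> I'" "ideal I' R" for I I'
      unfolding g_def using that z(1) ideal_mem_carrier[OF that(2)]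
      by (intro saturation_mono subset_Idl_subset) auto
    have "\<exists>n. \<forall>k\<ge>n. g (f k) = g (f n)"
    proof (rule step.IH[of "g J"])
      show "J \<subset> g J" using g[OF J] z(2) by blast
      show "Q = P" if "primeideal Q R" "g J \<subseteq> Q" "Q \<subseteq> P" for Q
        using minP[OF that(1) _ that(3)] that(2) g(3)[OF J] by blast
      show "antimono (\<lambda>n. g (f n))" by (rule antimonoI) (intro g_mono f_anti f)
    qed (use g J f g_mono Jf in auto)
    then obtain n1 where n1: "\<And>k. k \<ge> n1 \<Longrightarrow> g (f k) = g (f n1)" by blast
    \<comment> \<open>from some index on, membership of \<open>z\<close> does not change, the chain being decreasing\<close>
    have "\<exists>n2. \<forall>k\<ge>n2. z \<in> f n2 \<longrightarrow> z \<in> f k"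
      by (cases "\<forall>k. z \<in> f k") blast+
    then obtain n2 where n2: "\<And>k. \<lbrakk>k \<ge> n2; z \<in> f n2\<rbrakk> \<Longrightarrow> z \<in> f k" by blast
    define n where "n = max n1 n2"
    have "f n \<subseteq> f k" if k: "k \<ge> n" for k
    proof
      fix a assume a: "a \<in> f n"
      note fn = ideal_axioms_mem[OF f[of n]] and fk = ideal_axioms_mem[OF f[of k]]
      have "g (f k) = g (f n)" using n1[of k] n1[of n] k unfolding n_def by simp
      hence "a \<in> g (f k)" using a g(3)[OF f] by blast
      then obtain s where s: "s \<in> carrier R" "s \<notin> P" "s \<otimes> a \<in> Idl (insert z (f k))"
        unfolding g_def saturation_def by blast
      then obtain b r where br: "b \<in> f k" "r \<in> carrier R" "s \<otimes> a = b \<oplus> r \<otimes> z"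
        unfolding Idl_insert[OF f z(1)] by blast
      have "r \<otimes> z \<in> f k"
      proof (cases "r \<in> P")
        case True
        thus ?thesis using Jf unfolding Cz[symmetric] C_def by blast
      next
        case False
        have "r \<otimes> z = s \<otimes> a \<ominus> b"
          unfolding br(3) using fk(1)[OF br(1)] br(2) z(1) by algebra
        also have "\<dots> \<in> f n" using fn(5,6) a s(1) br(1) f_anti[OF k] by blast
        finally have "z \<in> f n" using saturatedD[OF satf br(2) False z(1)] by blast
        hence "z \<in> f n2" using f_anti[of n2 n] unfolding n_def by auto
        hence "z \<in> f k" using n2[of k] k unfolding n_def by simp
        thus ?thesis using fk(6) br(2) by blast
      qed
      hence "s \<otimes> a \<in> f k" using br fk(3) by simp
      thus "a \<in> f k" using saturatedD[OF satf s(1,2)] fn(1)[OF a] by blast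
    qed
    hence "f k = f n" if "k \<ge> n" for k using that f_anti by blast
    thus ?thesis by blast
  qed
qed

text \<open>Let \<open>y\<close> lie in \<open>P1\<close> but not in \<open>P0\<close>, and let \<open>Y k\<close> be the preimage of the ideal generated by \<open>P0\<close> and \<open>y\<^sup>k\<close> in the
  localisation at \<open>P1\<close>. Modulo \<open>P0 + (x)\<close> the localisation at \<open>P2\<close> is Artinian, so locally at \<open>P2\<close> one has
  \<open>Y n \<subseteq> Y (n + 1) + (x)\<close> for some \<open>n\<close>. As \<open>x \<notin> P1\<close>, the factor of \<open>x\<close> lies in \<open>Y n\<close>, and Nakayama yields
  \<open>Y n \<subseteq> Y (n + 1)\<close>. Thus \<open>y\<^sup>n\<close> is a multiple of \<open>y\<^sup>n\<^sup>+\<^sup>1\<close> at \<open>P1\<close> modulo \<open>P0\<close>, which is absurd in a domain, since \<open>y \<in> P1\<close>.\<close>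

lemma krull_principal_ideal:
  assumes P0: "primeideal P0 R" and P1: "primeideal P1 R" and P2: "primeideal P2 R"
    and incl: "P0 \<subset> P1" "P1 \<subseteq> P2" and x: "x \<in> P2" "x \<notin> P1"
    and minimal: "\<And>Q. \<lbrakk>primeideal Q R; P0 \<subseteq> Q; x \<in> Q; Q \<subseteq> P2\<rbrakk> \<Longrightarrow> Q = P2"
  shows False
proof -
  interpret P0: primeideal P0 R by fact
  interpret P1: primeideal P1 R by fact
  interpret P2: primeideal P2 R by fact
  have xc: "x \<in> carrier R" using x by simp
  obtain y where y: "y \<in> P1" "y \<notin> P0" using incl by blast
  hence yc: "y \<in> carrier R" by simp
  define Y where "Y k = saturation P1 (Idl (insert (y [^] k) P0))" for k :: nat
  define f where "f k = saturation P2 (Idl (insert x (Y k)))" for k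
  define J where "J = saturation P2 (Idl (insert x P0))"
  have P0i: "ideal (Idl (insert a P0)) R" "P0 \<subseteq> Idl (insert a P0)" "a \<in> Idl (insert a P0)"
    if "a \<in> carrier R" for a using Idl_insert_ideal[OF P0.is_ideal that] .
  have Y: "ideal (Y k) R" "saturated P1 (Y k)" "P0 \<subseteq> Y k" "y [^] k \<in> Y k" for k
    unfolding Y_def using P0i[of "y [^] k"] yc saturation_ideal[OF P1] saturation_saturated[OF P1]
      saturation_superset[OF P1, of "Idl (insert (y [^] k) P0)"] by auto
  have Y_Suc: "Y (Suc k) \<subseteq> Y k" for k
  proof -
    have "y [^] Suc k \<in> Idl (insert (y [^] k) P0)"
      using ideal_rmult[OF P0i(1) yc P0i(3), of "y [^] k"] yc by simp
    hence "Idl (insert (y [^] Suc k) P0) \<subseteq> Idl (insert (y [^] k) P0)"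
      using P0i[of "y [^] k"] yc by (intro genideal_minimal) auto
    thus ?thesis unfolding Y_def by (rule saturation_mono)
  qed
  have f: "ideal (f k) R" "saturated P2 (f k)" "Y k \<subseteq> f k" for k
    unfolding f_def using Idl_insert_ideal[OF Y(1) xc] saturation_ideal[OF P2] saturation_saturated[OF P2]
      saturation_superset[OF P2 Idl_insert_ideal(1)[OF Y(1) xc]] by (blast+)
  have mono: "saturation P2 (Idl (insert x A)) \<subseteq> saturation P2 (Idl (insert x B))"
    if "A \<subseteq> B" "ideal B R" for A B
    using that xc ideal_mem_carrier[OF that(2)] by (intro saturation_mono subset_Idl_subset) auto
  have "\<exists>n. \<forall>k\<ge>n. f k = f n"
  proof (rule saturated_chain_stabilises[OF P2])
    show "ideal J R" "saturated P2 J"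
      unfolding J_def using P0i(1)[OF xc] saturation_ideal[OF P2] saturation_saturated[OF P2] by auto
    show "Q = P2" if "primeideal Q R" "J \<subseteq> Q" "Q \<subseteq> P2" for Q
    proof (rule minimal[OF that(1) _ _ that(3)])
      show "P0 \<subseteq> Q" "x \<in> Q"
        using that(2) P0i[OF xc] saturation_superset[OF P2 P0i(1)[OF xc]] unfolding J_def by auto
    qed
    show "ideal (f n) R" "saturated P2 (f n)" for n by (rule f)+
    show "J \<subseteq> f n" for n unfolding J_def f_def by (rule mono[OF Y(3,1)])
    have "f (Suc n) \<subseteq> f n" for n unfolding f_def by (rule mono[OF Y_Suc Y(1)])
    thus "antimono f" by (rule antimono_iff_le_Suc[THEN iffD2, rule_format])
  qed
  then obtain n where n: "f (Suc n) = f n" using le_SucI[of _ _] by (metis le_refl)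
  have "Y n \<subseteq> Y (Suc n)"
  proof (rule nakayama[OF P2 Y(1) Y(1) saturated_mono[OF Y(2) incl(2)]])
    fix a assume a: "a \<in> Y n"
    let ?N = "Y (Suc n) \<union> {p \<otimes> f | p f. p \<in> P2 \<and> f \<in> Y n}"
    have gens: "?N \<subseteq> carrier R" using ideal_mem_carrier[OF Y(1)] P2.Icarr by auto
    have "a \<in> f (Suc n)" using a f(3) n by blast
    then obtain t where t: "t \<in> carrier R - P2" "t \<otimes> a \<in> Idl (insert x (Y (Suc n)))"
      unfolding f_def saturation_def by blast
    then obtain b r where br: "b \<in> Y (Suc n)" "r \<in> carrier R" "t \<otimes> a = b \<oplus> r \<otimes> x"
      unfolding Idl_insert[OF Y(1) xc] by blast
    have bc: "b \<in> carrier R" using br(1) ideal_mem_carrier[OF Y(1)] by blast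
    have "x \<otimes> r = t \<otimes> a \<ominus> b" unfolding br(3) using bc br(2) xc by algebra
    also have "\<dots> \<in> Y n"
      using ideal_diff[OF Y(1)] ideal_lmult[OF Y(1)] t(1) a br(1) Y_Suc by blast
    finally have "r \<in> Y n" using saturatedD[OF Y(2) xc x(2) br(2)] by blast
    hence "x \<otimes> r \<in> Idl ?N" using x(1) genideal_self[OF gens] by blast
    moreover have "b \<in> Idl ?N" using br(1) genideal_self[OF gens] by blast
    ultimately have "t \<otimes> a \<in> Idl ?N"
      unfolding br(3) using ideal_add[OF genideal_ideal[OF gens]] br(2) xc by (simp add: m_comm)
    thus "\<exists>t\<in>carrier R - P2. t \<otimes> a \<in> Idl ?N" using t(1) by blast
  qed
  hence "y [^] n \<in> Y (Suc n)" using Y(4) by blast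
  then obtain s where s: "s \<in> carrier R" "s \<notin> P1" "s \<otimes> y [^] n \<in> Idl (insert (y [^] Suc n) P0)"
    unfolding Y_def saturation_def by blast
  have "y [^] Suc n \<in> carrier R" using yc by simp
  then obtain b r where br: "b \<in> P0" "r \<in> carrier R" "s \<otimes> y [^] n = b \<oplus> r \<otimes> y [^] Suc n"
    using s(3) unfolding Idl_insert[OF P0.is_ideal \<open>y [^] Suc n \<in> carrier R\<close>] by blast
  have ync: "y [^] n \<in> carrier R" using yc by simp
  have "(s \<ominus> r \<otimes> y) \<otimes> y [^] n = s \<otimes> y [^] n \<ominus> r \<otimes> (y [^] n \<otimes> y)"
    using s(1) br(2) yc ync by algebra
  also have "\<dots> = b" unfolding br(3) nat_pow_Suc using br(2) P0.Icarr[OF br(1)] yc ync by algebra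
  finally have "(s \<ominus> r \<otimes> y) \<otimes> y [^] n \<in> P0" using br(1) by simp
  moreover have "y [^] n \<notin> P0" using prime_pow_mem[OF P0 yc] y(2) by blast
  ultimately have "s \<ominus> r \<otimes> y \<in> P0" using P0.I_prime[of "s \<ominus> r \<otimes> y" "y [^] n"] s(1) br(2) yc by simp
  hence "s \<ominus> r \<otimes> y \<in> P1" using incl by blast
  hence "s \<in> P1" using ideal_diff_cancel[OF P1.is_ideal _ P1.I_l_closed[OF y(1) br(2)] s(1)] by blast
  thus False using s(2) by blast
qed

text \<open>A prime \<open>Q\<close> minimal over \<open>P0 + (x)\<close> cannot be \<open>P2\<close>: the principal ideal theorem leaves no room for \<open>P1\<close> then.\<close>

lemma prime_between_through:
  assumes P0: "primeideal P0 R" and P1: "primeideal P1 R" and P2: "primeideal P2 R"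
    and incl: "P0 \<subset> P1" "P1 \<subset> P2" and x: "x \<in> P2"
  obtains Q where "primeideal Q R" "P0 \<subset> Q" "Q \<subset> P2" "x \<in> Q"
proof (cases "x \<in> P1")
  case True
  thus ?thesis using that P1 incl by blast
next
  case False
  have xc: "x \<in> carrier R" using x P2 ideal_mem_carrier primeideal.axioms(1) by blast
  note I = Idl_insert_ideal[OF primeideal.axioms(1)[OF P0] xc]
  have "Idl (insert x P0) \<subseteq> P2" using P2 x incl by (intro genideal_minimal primeideal.axioms(1)) auto
  then obtain Q where Q: "primeideal Q R" "Idl (insert x P0) \<subseteq> Q" "Q \<subseteq> P2"
    "\<And>Q'. \<lbrakk>primeideal Q' R; Idl (insert x P0) \<subseteq> Q'; Q' \<subseteq> Q\<rbrakk> \<Longrightarrow> Q' = Q"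
    using exists_minimal_prime_between[OF I(1) P2] by blast
  have "Q \<noteq> P2"
  proof
    assume QP: "Q = P2"
    show False
    proof (rule krull_principal_ideal[OF P0 P1 P2 incl(1) _ x False])
      fix Q' assume Q': "primeideal Q' R" "P0 \<subseteq> Q'" "x \<in> Q'" "Q' \<subseteq> P2"
      have "Idl (insert x P0) \<subseteq> Q'"
        using Q' by (intro genideal_minimal primeideal.axioms(1)) auto
      thus "Q' = P2" using Q(4)[OF Q'(1)] Q'(4) QP by blast
    qed (use incl in blast)
  qed
  moreover have "P0 \<subset> Q" using I Q(2) False x incl by blast
  ultimately show ?thesis using that Q(1,2,3) I(3) by blast
qed

end

text \<open>The chains whose supremum is \<open>krull_dim\<close>; the length counts inclusions, not primes.\<close>

definition prime_chain :: "('a, 'm) ring_scheme \<Rightarrow> nat \<Rightarrow> (nat \<Rightarrow> 'a set) \<Rightarrow> bool" where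
  "prime_chain R n P \<longleftrightarrow> (\<forall>i\<le>n. primeideal (P i) R) \<and> (\<forall>i<n. P i \<subset> P (Suc i))"

lemma prime_chainD:
  assumes "prime_chain R n P"
  shows "i \<le> n \<Longrightarrow> primeideal (P i) R" "i < n \<Longrightarrow> P i \<subset> P (Suc i)"
  using assms unfolding prime_chain_def by auto

lemma prime_chain_mono:
  assumes "prime_chain R n P" "i \<le> j" "j \<le> n"
  shows "P i \<subseteq> P j"
  using assms(2,3)
proof (induction j rule: dec_induct)
  case (step j)
  thus ?case using prime_chainD(2)[OF assms(1), of j] by auto
qed simp

context noetherian_cring begin

text \<open>The element \<open>x\<close> of the top member is pushed down through the chain, one prime at a time.\<close>

lemma prime_chain_through:
  assumes "prime_chain R (Suc n) P" "x \<in> P (Suc n)"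
  obtains Q where "prime_chain R n Q" "Q n = P (Suc n)" "P 0 \<subset> Q 0" "x \<in> Q 0"
proof -
  have "\<exists>Q. prime_chain R n Q \<and> Q n = P (Suc n) \<and> P 0 \<subset> Q 0 \<and> x \<in> Q 0"
    using assms
  proof (induction n arbitrary: P)
    case 0
    thus ?case
      by (intro exI[of _ "\<lambda>_. P 1"]) (auto simp: prime_chain_def)
  next
    case (Suc n)
    note P = prime_chainD[OF Suc.prems(1)]
    obtain Q where Q: "primeideal Q R" "P n \<subset> Q" "Q \<subset> P (Suc (Suc n))" "x \<in> Q"
      using prime_between_through[OF P(1)[of n] P(1)[of "Suc n"] P(1)[of "Suc (Suc n)"] P(2)[of n] P(2)[of "Suc n"]]
        Suc.prems(2) by auto
    let ?P = "P(Suc n := Q)"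
    have "prime_chain R (Suc n) ?P" unfolding prime_chain_def
      using P Q(1,2) by (auto simp: less_Suc_eq le_Suc_eq)
    moreover have "x \<in> ?P (Suc n)" using Q by simp
    ultimately obtain Q' where Q': "prime_chain R n Q'" "Q' n = ?P (Suc n)" "?P 0 \<subset> Q' 0" "x \<in> Q' 0"
      using Suc.IH[of ?P] by blast
    let ?Q = "Q'(Suc n := P (Suc (Suc n)))"
    have "prime_chain R (Suc n) ?Q" unfolding prime_chain_def
      using prime_chainD[OF Q'(1)] Q'(2) Q(3) P(1)[of "Suc (Suc n)"] by (auto simp: less_Suc_eq le_Suc_eq)
    thus ?case using Q'(3,4) by (intro exI[of _ ?Q]) (auto simp del: fun_upd_apply, auto)
  qed
  thus ?thesis using that by blast
qed

text \<open>Krull's height theorem: each generator can be moved into the whole chain at the cost of its first member.\<close>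

lemma prime_chain_length_le_generators:
  assumes "ideal J R" "set ys \<subseteq> carrier R" "prime_chain R n P" "J \<subseteq> P 0" "Idl (J \<union> set ys) = M"
    "primeideal M R" "P n \<subseteq> M"
  shows "n \<le> length ys"
  using assms
proof (induction ys arbitrary: J n P)
  case Nil
  hence "M = J" by (simp add: Idl_ideal_eq)
  hence "P 0 = P n" using Nil prime_chain_mono[OF Nil.prems(3), of 0 n] by auto
  thus ?case using prime_chain_mono[OF Nil.prems(3), of 1 n] prime_chainD(2)[OF Nil.prems(3), of 0]
    by (cases n) auto
next
  case (Cons y ys)
  note prems = Cons.prems
  show ?case
  proof (cases n)
    case (Suc m)
    have gens: "J \<union> set (y # ys) \<subseteq> carrier R" using prems(2) ideal_mem_carrier[OF prems(1)] by auto
    have yc: "y \<in> carrier R" and yM: "y \<in> M" using prems(2,5) genideal_self[OF gens] by auto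
    \<comment> \<open>with \<open>M\<close> as its top member, the chain can be led through the generator \<open>y \<in> M\<close>\<close>
    let ?P = "P(n := M)"
    have "prime_chain R n ?P"
      unfolding prime_chain_def using prime_chainD[OF prems(3)] prems(6,7)
      by (auto simp: Suc le_Suc_eq less_Suc_eq)
    then obtain Q where Q: "prime_chain R m Q" "Q m = M" "P 0 \<subset> Q 0" "y \<in> Q 0"
      using prime_chain_through[of m ?P y] yM unfolding Suc by auto
    have "m \<le> length ys"
    proof (rule Cons.IH[OF _ _ Q(1)])
      show "ideal (Idl (insert y J)) R" by (rule Idl_insert_ideal[OF prems(1) yc])
      show "Idl (insert y J) \<subseteq> Q 0"
        using Q(3,4) prems(4) prime_chainD(1)[OF Q(1), of 0]
        by (intro genideal_minimal) (auto simp: primeideal.axioms(1))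
      have "Idl (Idl (insert y J) \<union> set ys) = Idl (set ys \<union> insert y J)"
        using Idl_Un_Idl[of "set ys" "insert y J"] gens by (simp add: Un_commute)
      also have "\<dots> = M" using prems(5) by (simp add: Un_commute insert_commute)
      finally show "Idl (Idl (insert y J) \<union> set ys) = M" .
    qed (use prems Q(2) in auto)
    thus ?thesis using Suc by simp
  qed simp
qed

text \<open>This provides the finiteness of the set of minimal primes over \<open>J\<close>, all of which belong to the finite set. The proof
  is by noetherian induction: as long as \<open>J\<close> is not prime, a prime above \<open>J \<ni> a b\<close> contains \<open>J + (a)\<close> or \<open>J + (b)\<close>.\<close>

lemma finitely_many_primes_cover:
  assumes "ideal J R"
  shows "\<exists>F. finite F \<and> (\<forall>Q. primeideal Q R \<longrightarrow> J \<subseteq> Q \<longrightarrow> (\<exists>P\<in>F. primeideal P R \<and> J \<subseteq> P \<and> P \<subseteq> Q))"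
  using assms
proof (induction J rule: noetherian_induct)
  case (step J)
  show ?case
  proof (cases "primeideal J R \<or> \<one> \<in> J")
    case True
    thus ?thesis using prime_one_notin by (intro exI[of _ "{J}"]) blast
  next
    case False
    then obtain a b where ab: "a \<in> carrier R" "b \<in> carrier R" "a \<otimes> b \<in> J" "a \<notin> J" "b \<notin> J"
      using primeidealI[OF step.hyps cring_axioms] by auto
    note a = Idl_insert_ideal[OF step.hyps ab(1)] and b = Idl_insert_ideal[OF step.hyps ab(2)]
    obtain F where F: "finite F" "\<And>Q. \<lbrakk>primeideal Q R; Idl (insert a J) \<subseteq> Q\<rbrakk> \<Longrightarrow>
        \<exists>P\<in>F. primeideal P R \<and> Idl (insert a J) \<subseteq> P \<and> P \<subseteq> Q"
      using step.IH[OF a(1)] a(2,3) ab(4) by blast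
    obtain F' where F': "finite F'" "\<And>Q. \<lbrakk>primeideal Q R; Idl (insert b J) \<subseteq> Q\<rbrakk> \<Longrightarrow>
        \<exists>P\<in>F'. primeideal P R \<and> Idl (insert b J) \<subseteq> P \<and> P \<subseteq> Q"
      using step.IH[OF b(1)] b(2,3) ab(5) by blast
    have "\<exists>P\<in>F \<union> F'. primeideal P R \<and> J \<subseteq> P \<and> P \<subseteq> Q" if Q: "primeideal Q R" "J \<subseteq> Q" for Q
    proof -
      have "a \<in> Q \<or> b \<in> Q" using primeideal.I_prime[OF Q(1) ab(1,2)] ab(3) Q(2) by blast
      thus ?thesis
      proof
        assume "a \<in> Q"
        hence "Idl (insert a J) \<subseteq> Q" using Q by (intro genideal_minimal primeideal.axioms(1)) auto
        from F(2)[OF Q(1) this] a(2) show ?thesis by blast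
      next
        assume "b \<in> Q"
        hence "Idl (insert b J) \<subseteq> Q" using Q by (intro genideal_minimal primeideal.axioms(1)) auto
        from F'(2)[OF Q(1) this] b(2) show ?thesis by blast
      qed
    qed
    thus ?thesis using F(1) F'(1) by (intro exI[of _ "F \<union> F'"]) blast
  qed
qed

end

section \<open>Local rings\<close>

context cring begin

lemma proper_ideal_in_maximal:
  assumes J: "ideal J R" and one: "\<one> \<notin> J"
  obtains M where "maximalideal M R" "J \<subseteq> M"
proof -
  define S where "S = {I. ideal I R \<and> J \<subseteq> I \<and> \<one> \<notin> I}"
  have "\<exists>M\<in>S. \<forall>I\<in>S. M \<subseteq> I \<longrightarrow> I = M"
  proof (rule subset_Zorn)
    fix C assume C: "subset.chain S C"
    show "\<exists>U\<in>S. \<forall>I\<in>C. I \<subseteq> U"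
    proof (cases "C = {}")
      case True
      thus ?thesis using J one unfolding S_def by blast
    next
      case False
      have CS: "C \<subseteq> S" using C unfolding pred_on.chain_def by blast
      have "subset.chain {I. ideal I R} C" using C unfolding pred_on.chain_def S_def by blast
      hence "ideal (\<Union>C) R" using chain_Union_is_ideal[of C] False by simp
      moreover have "J \<subseteq> \<Union>C" using CS False unfolding S_def by auto
      moreover have "\<one> \<notin> \<Union>C" using CS unfolding S_def by auto
      ultimately have "\<Union>C \<in> S" unfolding S_def by simp
      thus ?thesis by (rule bexI[rotated]) auto
    qed
  qed
  then obtain M where MS: "M \<in> S" and M_max: "\<forall>I\<in>S. M \<subseteq> I \<longrightarrow> I = M" by (rule bexE)
  hence M: "ideal M R" "J \<subseteq> M" "\<one> \<notin> M" unfolding S_def by simp_all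
  have "maximalideal M R"
  proof (rule maximalidealI[OF M(1)])
    show "carrier R \<noteq> M" using M(3) by blast
    fix I assume I: "ideal I R" "M \<subseteq> I" "I \<subseteq> carrier R"
    show "I = M \<or> I = carrier R"
    proof (cases "\<one> \<in> I")
      case True
      thus ?thesis using ideal.one_imp_carrier[OF I(1)] by blast
    next
      case False
      hence "I \<in> S" using I(1,2) M(2) unfolding S_def by simp
      thus ?thesis using M_max I(2) by simp
    qed
  qed
  thus ?thesis using that M(2) by blast
qed

lemma local_ring_by_units:
  assumes M: "ideal M R" "\<one> \<notin> M" and units: "\<And>a. \<lbrakk>a \<in> carrier R; a \<notin> M\<rbrakk> \<Longrightarrow> a \<in> Units R"
  shows "local_ring R" "max_ideal R = M"
proof -
  have small: "I \<subseteq> M" if "ideal I R" "\<one> \<notin> I" for I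
  proof
    fix a assume a: "a \<in> I"
    hence ac: "a \<in> carrier R" using ideal_mem_carrier[OF that(1)] by blast
    show "a \<in> M"
    proof (rule ccontr)
      assume "a \<notin> M"
      hence "a \<in> Units R" using units ac by blast
      hence "inv a \<otimes> a = \<one>" "inv a \<in> carrier R" by auto
      thus False using ideal_lmult[OF that(1) _ a, of "inv a"] that(2) by simp
    qed
  qed
  have max: "maximalideal M R"
  proof (rule maximalidealI[OF M(1)])
    show "carrier R \<noteq> M" using M(2) by blast
    fix I assume I: "ideal I R" "M \<subseteq> I" "I \<subseteq> carrier R"
    show "I = M \<or> I = carrier R"
      using small[OF I(1)] I(2) ideal.one_imp_carrier[OF I(1)] by blast
  qed
  have uniq: "I = M" if "maximalideal I R" for I
  proof -
    interpret I: maximalideal I R by fact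
    have "\<one> \<notin> I" using I.one_imp_carrier I.I_notcarr by blast
    hence "I \<subseteq> M" by (rule small[OF I.is_ideal])
    thus ?thesis
      using I.I_maximal[OF M(1)] ideal_mem_carrier[OF M(1)] M(2) by blast
  qed
  have "\<exists>!M. maximalideal M R" using max uniq by (rule ex1I)
  thus "local_ring R" by (intro local_ring.intro local_ring_axioms.intro cring_axioms)
  show "max_ideal R = M"
    unfolding max_ideal_def using max uniq by (rule the_equality)
qed

end

context local_ring begin

lemma max_ideal_maximal: "maximalideal (max_ideal R) R"
  unfolding max_ideal_def by (rule theI'[OF unique_maximal])

lemma max_ideal_prime: "primeideal (max_ideal R) R"
  by (rule maximalideal_prime[OF max_ideal_maximal])

lemma max_ideal_ideal: "ideal (max_ideal R) R"
  by (rule primeideal.axioms(1)[OF max_ideal_prime])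

lemmas mem_max_ideal_carrier = ideal_mem_carrier[OF max_ideal_ideal]

lemma one_notin_max_ideal: "\<one> \<notin> max_ideal R"
  by (rule prime_one_notin[OF max_ideal_prime])

lemma proper_ideal_le_max_ideal:
  assumes "ideal J R" "\<one> \<notin> J"
  shows "J \<subseteq> max_ideal R"
proof -
  obtain M where M: "maximalideal M R" "J \<subseteq> M" using proper_ideal_in_maximal[OF assms] .
  have "M = max_ideal R" unfolding max_ideal_def using the1_equality[OF unique_maximal M(1)] by simp
  thus ?thesis using M(2) by simp
qed

lemma prime_le_max_ideal: "primeideal P R \<Longrightarrow> P \<subseteq> max_ideal R"
  by (intro proper_ideal_le_max_ideal prime_one_notin primeideal.axioms(1))

lemma Units_iff_notin_max_ideal:
  assumes a: "a \<in> carrier R"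
  shows "a \<in> Units R \<longleftrightarrow> a \<notin> max_ideal R"
proof
  assume "a \<in> Units R"
  hence "inv a \<otimes> a = \<one>" "inv a \<in> carrier R" by auto
  thus "a \<notin> max_ideal R"
    using ideal_lmult[OF max_ideal_ideal, of "inv a" a] one_notin_max_ideal by auto
next
  assume "a \<notin> max_ideal R"
  hence "\<one> \<in> PIdl a"
    using proper_ideal_le_max_ideal[OF cgenideal_ideal[OF a]] cgenideal_self[OF a] by auto
  then obtain r where r: "r \<in> carrier R" "r \<otimes> a = \<one>" unfolding cgenideal_def by auto
  moreover have "a \<otimes> r = \<one>" using r a by (simp add: m_comm)
  ultimately show "a \<in> Units R" using a unfolding Units_def by blast
qed

lemma saturated_max_ideal:
  assumes J: "ideal J R"
  shows "saturated (max_ideal R) J"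
  unfolding saturated_def
proof (intro ballI impI)
  fix s a assume s: "s \<in> carrier R - max_ideal R" and a: "a \<in> carrier R" and sa: "s \<otimes> a \<in> J"
  have u: "s \<in> Units R" using s Units_iff_notin_max_ideal by blast
  hence "inv s \<otimes> (s \<otimes> a) = (inv s \<otimes> s) \<otimes> a" using a by (subst m_assoc) auto
  hence "inv s \<otimes> (s \<otimes> a) = a" using u a by simp
  thus "a \<in> J" using ideal_lmult[OF J _ sa, of "inv s"] u by simp
qed

lemma one_minus_max_ideal_notin:
  assumes "a \<in> max_ideal R"
  shows "\<one> \<ominus> a \<notin> max_ideal R"
  using ideal_diff_cancel[OF max_ideal_ideal _ assms one_closed] one_notin_max_ideal by blast

end

locale noetherian_local_ring = noetherian_cring + local_ring

context noetherian_local_ring begin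

lemma local_nakayama:
  assumes "ideal I R" "ideal K R"
    and "\<And>a. a \<in> I \<Longrightarrow> a \<in> Idl (K \<union> {p \<otimes> f | p f. p \<in> max_ideal R \<and> f \<in> I})"
  shows "I \<subseteq> K"
proof (rule nakayama[OF max_ideal_prime assms(1,2) saturated_max_ideal[OF assms(2)]])
  fix a assume a: "a \<in> I"
  hence "\<one> \<otimes> a \<in> Idl (K \<union> {p \<otimes> f | p f. p \<in> max_ideal R \<and> f \<in> I})"
    using assms(3) ideal_mem_carrier[OF assms(1)] by simp
  thus "\<exists>t\<in>carrier R - max_ideal R. t \<otimes> a \<in> Idl (K \<union> {p \<otimes> f | p f. p \<in> max_ideal R \<and> f \<in> I})"
    using one_notin_max_ideal by blast
qed

text \<open>Steinitz exchange: if no element of \<open>W\<close> involves the generator \<open>y\<close> with a unit coefficient,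
  then \<open>y\<close> is redundant by Nakayama, and any element of \<open>W\<close> can stand in its place.\<close>

lemma exchange_generators:
  assumes X: "W \<subseteq> carrier R" "Idl W = max_ideal R" "W \<noteq> {}"
    and "set xs \<union> set ys \<subseteq> carrier R" "Idl (set xs \<union> set ys) = max_ideal R"
  shows "\<exists>zs. length zs = length ys \<and> set zs \<subseteq> W \<and> Idl (set xs \<union> set zs) = max_ideal R"
  using assms(4,5)
proof (induction ys arbitrary: xs)
  case (Cons y ys)
  define L where "L = Idl (set xs \<union> set ys)"
  have gens: "set xs \<union> set ys \<subseteq> carrier R" and y: "y \<in> carrier R" using Cons.prems by auto
  have L: "ideal L R" unfolding L_def by (rule genideal_ideal[OF gens])
  have M: "Idl (insert y L) = max_ideal R"
    unfolding L_def Idl_insert_Idl[OF gens y] Cons.prems(2)[symmetric] by simp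
  have XM: "W \<subseteq> max_ideal R" using genideal_self[OF X(1)] X(2) by simp
  have "\<exists>x\<in>W. Idl (insert x L) = max_ideal R"
  proof (cases "\<exists>x\<in>W. \<exists>l\<in>L. \<exists>c\<in>Units R. x = l \<oplus> c \<otimes> y")
    case True
    then obtain x l c where h: "x \<in> W" "l \<in> L" "c \<in> Units R" "x = l \<oplus> c \<otimes> y" by blast
    have xc: "x \<in> carrier R" using h(1) X(1) by blast
    note I = Idl_insert_ideal[OF L xc]
    have lc: "l \<in> carrier R" and cc: "c \<in> carrier R" using h(2,3) ideal_mem_carrier[OF L] by auto
    have "x \<ominus> l = c \<otimes> y" unfolding h(4) using lc cc y by algebra
    hence "c \<otimes> y \<in> Idl (insert x L)" using ideal_diff[OF I(1) I(3)] h(2) I(2) by (metis subsetD)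
    moreover have "c \<notin> max_ideal R" using h(3) Units_iff_notin_max_ideal cc by blast
    ultimately have "y \<in> Idl (insert x L)"
      using saturatedD[OF saturated_max_ideal[OF I(1)] cc _ y] by blast
    hence "Idl (insert y L) \<subseteq> Idl (insert x L)" using I by (intro genideal_minimal) auto
    moreover have "Idl (insert x L) \<subseteq> max_ideal R"
      using XM h(1) Idl_insert_ideal[OF L y] M by (intro genideal_minimal max_ideal_ideal) auto
    ultimately show ?thesis using h(1) M by blast
  next
    case False
    have "max_ideal R \<subseteq> L"
    proof (rule local_nakayama[OF max_ideal_ideal L])
      let ?N = "L \<union> {p \<otimes> f | p f. p \<in> max_ideal R \<and> f \<in> max_ideal R}"
      have N: "?N \<subseteq> carrier R" using ideal_mem_carrier[OF L] mem_max_ideal_carrier by auto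
      have "W \<subseteq> Idl ?N"
      proof
        fix x assume x: "x \<in> W"
        then obtain l c where lc: "l \<in> L" "c \<in> carrier R" "x = l \<oplus> c \<otimes> y"
          using XM M unfolding Idl_insert[OF L y] by blast
        hence "c \<in> max_ideal R" using False x Units_iff_notin_max_ideal by blast
        moreover have "y \<in> max_ideal R" using Idl_insert_ideal(3)[OF L y] M by simp
        ultimately have "c \<otimes> y \<in> Idl ?N" "l \<in> Idl ?N" using lc(1) genideal_self[OF N] by blast+
        thus "x \<in> Idl ?N" unfolding lc(3) using ideal_add[OF genideal_ideal[OF N]] by blast
      qed
      hence "Idl W \<subseteq> Idl ?N" by (intro genideal_minimal genideal_ideal[OF N])
      thus "a \<in> Idl ?N" if "a \<in> max_ideal R" for a using that X(2) by blast
    qed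
    moreover have "L \<subseteq> max_ideal R" using Idl_insert_ideal(2)[OF L y] M by simp
    ultimately have LM: "L = max_ideal R" by blast
    obtain x where x: "x \<in> W" using X(3) by blast
    have "Idl (insert x L) = max_ideal R"
      using x XM LM by (simp add: insert_absorb subsetD Idl_ideal_eq[OF max_ideal_ideal])
    thus ?thesis using x by blast
  qed
  then obtain x where x: "x \<in> W" "Idl (insert x L) = max_ideal R" by blast
  have xc: "x \<in> carrier R" using x(1) X(1) by blast
  have "Idl (set (x # xs) \<union> set ys) = max_ideal R"
    using x(2) unfolding L_def Idl_insert_Idl[OF gens xc] by simp
  then obtain zs where zs: "length zs = length ys" "set zs \<subseteq> W" "Idl (set (x # xs) \<union> set zs) = max_ideal R"
    using Cons.IH[of "x # xs"] gens xc by auto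
  thus ?case using x(1) by (intro exI[of _ "x # zs"]) auto
qed auto

end

section \<open>Regular systems of parameters are regular sequences\<close>

lemma krull_dim_eq_Sup: "krull_dim R = Sup {enat n | n. \<exists>P. prime_chain R n P}"
  unfolding krull_dim_def prime_chain_def by simp

lemma prime_chain_le_krull_dim: "prime_chain R n P \<Longrightarrow> enat n \<le> krull_dim R"
  unfolding krull_dim_eq_Sup by (rule Sup_upper) blast

lemma prime_chain_truncate: "\<lbrakk>prime_chain R n P; m \<le> n\<rbrakk> \<Longrightarrow> prime_chain R m P"
  unfolding prime_chain_def by auto

text \<open>A finite supremum of natural numbers is a maximum; the chain of length zero consisting of the maximal ideal excludes
  the empty set.\<close>

lemma (in local_ring) krull_dim_attained:
  assumes d: "krull_dim R = enat d"
  obtains P where "prime_chain R d P"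
proof (rule ccontr)
  assume no: "\<not> thesis"
  have len: "n < d" if "prime_chain R n P" for n P
    using no that prime_chain_truncate[of R n P d] \<open>\<And>P. prime_chain R d P \<Longrightarrow> thesis\<close>
    by (meson not_le)
  have "prime_chain R 0 (\<lambda>_. max_ideal R)"
    unfolding prime_chain_def using max_ideal_prime by simp
  hence "0 < d" by (rule len)
  have "krull_dim R \<le> enat (d - 1)"
    unfolding krull_dim_eq_Sup using len by (intro Sup_least) force
  thus False using d \<open>0 < d\<close> by simp
qed

context noetherian_local_ring begin

lemma prime_chain_top_max_ideal:
  assumes "prime_chain R n P"
  shows "prime_chain R n (P(n := max_ideal R))" "i \<le> n \<Longrightarrow> P i \<subseteq> (P(n := max_ideal R)) i"
proof -
  have "P i \<subset> max_ideal R" if "i < n" for i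
    using prime_chainD(2)[OF assms that] prime_le_max_ideal[OF prime_chainD(1)[OF assms, of "Suc i"]] that
    by auto
  thus "prime_chain R n (P(n := max_ideal R))"
    using prime_chainD[OF assms] max_ideal_prime unfolding prime_chain_def by auto
  show "P i \<subseteq> (P(n := max_ideal R)) i" if "i \<le> n"
    using prime_le_max_ideal[OF prime_chainD(1)[OF assms that]] by auto
qed

text \<open>The dimension drops by at most one for each element that is divided out.\<close>

lemma prime_chain_over_generators:
  assumes "ideal J R" "set xs \<subseteq> max_ideal R" "prime_chain R (length xs + k) P" "J \<subseteq> P 0"
  shows "\<exists>Q. prime_chain R k Q \<and> Idl (J \<union> set xs) \<subseteq> Q 0"
  using assms
proof (induction xs arbitrary: J P)
  case Nil
  thus ?case using Idl_ideal_eq by auto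
next
  case (Cons x xs)
  let ?n = "Suc (length xs + k)"
  have xc: "x \<in> carrier R" using Cons.prems(2) mem_max_ideal_carrier by auto
  have P: "prime_chain R ?n P" using Cons.prems(3) by simp
  obtain Q where Q: "prime_chain R (length xs + k) Q" "P 0 \<subset> Q 0" "x \<in> Q 0"
  proof (rule prime_chain_through[OF prime_chain_top_max_ideal(1)[OF P]])
    show "x \<in> (P(?n := max_ideal R)) ?n" using Cons.prems(2) by simp
  qed simp
  have "Idl (insert x J) \<subseteq> Q 0"
    using Q(2,3) Cons.prems(4) primeideal.axioms(1)[OF prime_chainD(1)[OF Q(1), of 0]]
    by (intro genideal_minimal) auto
  then obtain Q' where Q': "prime_chain R k Q'" "Idl (Idl (insert x J) \<union> set xs) \<subseteq> Q' 0"
    using Cons.IH[OF Idl_insert_ideal(1)[OF Cons.prems(1) xc] _ Q(1)] Cons.prems(2) by auto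
  have "Idl (set xs \<union> Idl (insert x J)) = Idl (set xs \<union> insert x J)"
    using Cons.prems(2) mem_max_ideal_carrier xc ideal_mem_carrier[OF Cons.prems(1)]
    by (intro Idl_Un_Idl) auto
  thus ?case using Q' by (auto simp: Un_commute insert_commute)
qed

lemma Idl_add_element:
  assumes "S \<subseteq> carrier R" "x \<in> carrier R" "z \<in> S"
  shows "Idl (insert (x \<oplus> z) S) = Idl (insert x S)"
proof
  have z: "z \<in> carrier R" using assms by blast
  have A: "insert x S \<subseteq> carrier R" "insert (x \<oplus> z) S \<subseteq> carrier R" using assms z by auto
  note IA = genideal_ideal[OF A(1)] genideal_self[OF A(1)]
  note IB = genideal_ideal[OF A(2)] genideal_self[OF A(2)]
  have "x \<oplus> z \<in> Idl (insert x S)" using ideal_add[OF IA(1)] IA(2) assms(3) by blast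
  thus "Idl (insert (x \<oplus> z) S) \<subseteq> Idl (insert x S)" using IA by (intro genideal_minimal) auto
  have "x \<in> Idl (insert (x \<oplus> z) S)"
    using ideal_add_cancel[OF IB(1) _ _ assms(2)] IB(2) assms(3) by blast
  thus "Idl (insert x S) \<subseteq> Idl (insert (x \<oplus> z) S)" using IB by (intro genideal_minimal) auto
qed

text \<open>
  Suppose that \<open>J\<close> is not prime. Whenever \<open>x\<close> belongs to a system of \<open>length ys\<close> generators of the maximal ideal modulo \<open>J\<close>, then
  \<open>J + (x)\<close> is prime by induction, and it is a minimal prime over \<open>J\<close>: a prime \<open>P\<close> strictly below
  satisfies \<open>P = J + x P\<close>, hence \<open>P = J\<close> by Nakayama. A single generator would thus make the maximal ideal
  minimal over \<open>J\<close>, contrary to the chain. If \<open>y\<close> and \<open>z\<close> are two of the generators, the elements \<open>y + z\<^sup>k\<close> give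
  infinitely many such \<open>x\<close>, but there are only finitely many minimal primes. So two of the ideals \<open>J + (x)\<close> agree, and they
  contain both \<open>y\<close> and \<open>z\<close>. This saves one generator and contradicts the length of the chain.
\<close>

lemma prime_if_chain_length_eq_generators:
  assumes "ideal J R" "set ys \<subseteq> carrier R" "Idl (J \<union> set ys) = max_ideal R"
    "prime_chain R (length ys) P" "J \<subseteq> P 0"
  shows "primeideal J R"
  using assms
proof (induction "length ys" arbitrary: J ys P)
  case 0
  thus ?case using Idl_ideal_eq[OF 0(2)] max_ideal_prime by simp
next
  case (Suc k)
  note J = Suc.prems(1)
  let ?M = "max_ideal R"
  show ?case
  proof (rule ccontr)
    assume notprime: "\<not> primeideal J R"
    have minimal: "primeideal (Idl (insert x J)) R \<and>
        (\<forall>Q. primeideal Q R \<longrightarrow> J \<subseteq> Q \<longrightarrow> Q \<subseteq> Idl (insert x J) \<longrightarrow> Q = Idl (insert x J))"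
      if x: "x \<in> carrier R" and zs: "length zs = k" "set zs \<subseteq> carrier R" "Idl (J \<union> set (x # zs)) = ?M" for x zs
    proof
      note I = Idl_insert_ideal[OF J x]
      have gens: "J \<union> set (x # zs) \<subseteq> carrier R" using x zs ideal_mem_carrier[OF J] by auto
      have xM: "x \<in> ?M" using genideal_self[OF gens] zs(3) by auto
      obtain Q where Q: "prime_chain R k Q" "Idl (J \<union> set [x]) \<subseteq> Q 0"
        using prime_chain_over_generators[OF J, of "[x]" k P] xM Suc.prems(4,5) Suc.hyps(2) by auto
      have "Idl (set zs \<union> Idl (insert x J)) = Idl (set zs \<union> insert x J)"
        using gens by (intro Idl_Un_Idl) auto
      hence "Idl (Idl (insert x J) \<union> set zs) = ?M" using zs(3) by (simp add: Un_commute insert_commute)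
      thus "primeideal (Idl (insert x J)) R"
        using Suc.hyps(1)[of zs "Idl (insert x J)" Q] I(1) zs(1,2) Q by (simp add: Un_commute)
      show "\<forall>Q. primeideal Q R \<longrightarrow> J \<subseteq> Q \<longrightarrow> Q \<subseteq> Idl (insert x J) \<longrightarrow> Q = Idl (insert x J)"
      proof (intro allI impI)
        fix P assume P: "primeideal P R" "J \<subseteq> P" "P \<subseteq> Idl (insert x J)"
        note Pi = primeideal.axioms(1)[OF P(1)]
        show "P = Idl (insert x J)"
        proof (cases "x \<in> P")
          case True
          hence "Idl (insert x J) \<subseteq> P" using P(2) by (intro genideal_minimal Pi) auto
          thus ?thesis using P(3) by blast
        next
          case False
          have "P \<subseteq> J"
          proof (rule local_nakayama[OF Pi J])
            fix a assume a: "a \<in> P"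
            let ?N = "J \<union> {p \<otimes> f | p f. p \<in> ?M \<and> f \<in> P}"
            have N: "?N \<subseteq> carrier R"
              using ideal_mem_carrier[OF J] ideal_mem_carrier[OF Pi] mem_max_ideal_carrier by auto
            obtain j r where jr: "j \<in> J" "r \<in> carrier R" "a = j \<oplus> r \<otimes> x"
              using a P(3) unfolding Idl_insert[OF J x] by blast
            have jc: "j \<in> carrier R" using jr(1) ideal_mem_carrier[OF J] by blast
            have "r \<otimes> x = a \<ominus> j" unfolding jr(3) using jc jr(2) x by algebra
            also have "\<dots> \<in> P" using ideal_diff[OF Pi a] jr(1) P(2) by blast
            finally have "r \<in> P" using primeideal.I_prime[OF P(1) jr(2) x] False by blast
            hence "x \<otimes> r \<in> Idl ?N" using xM genideal_self[OF N] by blast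
            moreover have "j \<in> Idl ?N" using jr(1) genideal_self[OF N] by blast
            ultimately show "a \<in> Idl ?N"
              unfolding jr(3) using ideal_add[OF genideal_ideal[OF N]] jr(2) x by (simp add: m_comm)
          qed
          hence "P = J" using P(2) by blast
          thus ?thesis using notprime P(1) by blast
        qed
      qed
    qed
    have chain: "prime_chain R (Suc k) P" using Suc.prems(4) Suc.hyps(2) by simp
    obtain y ys' where ys: "ys = y # ys'" "length ys' = k" using Suc.hyps(2) by (cases ys) auto
    have yc: "y \<in> carrier R" "set ys' \<subseteq> carrier R" using Suc.prems(2) ys by auto
    show False
    proof (cases ys')
      case Nil
      hence k: "k = 0" using ys(2) by simp
      have M: "Idl (insert y J) = ?M" using Suc.prems(3) ys Nil by simp
      have "P 0 = ?M"
        using minimal[of y "[]"] yc k Suc.prems(3,5) ys Nil prime_chainD(1)[OF chain, of 0]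
          prime_le_max_ideal[OF prime_chainD(1)[OF chain, of 0]] M by auto
      thus False
        using prime_chainD(2)[OF chain, of 0] k prime_le_max_ideal[OF prime_chainD(1)[OF chain, of 1]] by auto
    next
      case (Cons z zs)
      have zc: "z \<in> carrier R" "set zs \<subseteq> carrier R" using yc Cons by auto
      have carrJ: "J \<subseteq> carrier R" using ideal_mem_carrier[OF J] by blast
      have gens: "J \<union> set ys \<subseteq> carrier R" using carrJ Suc.prems(2) by auto
      have zM: "z \<in> ?M" and yM: "y \<in> ?M" and zsM: "set zs \<subseteq> ?M" and JM: "J \<subseteq> ?M"
        using genideal_self[OF gens] Suc.prems(3) ys(1) Cons by auto
      define x where "x n = y \<oplus> z [^] Suc n" for n
      have xc: "x n \<in> carrier R" for n unfolding x_def using yc zc by simp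
      have gen: "Idl (J \<union> set (x n # ys')) = ?M" for n
      proof -
        let ?S = "Idl (J \<union> set ys')"
        have S: "J \<union> set ys' \<subseteq> carrier R" using gens ys by auto
        note IS = genideal_ideal[OF S] genideal_self[OF S]
        have "z \<in> ?S" using IS(2) Cons by auto
        hence zS: "z [^] Suc n \<in> ?S" using ideal_lmult[OF IS(1)] zc by simp
        have "Idl (J \<union> set (x n # ys')) = Idl (insert (x n) ?S)"
          using Idl_insert_Idl[OF S xc] by simp
        also have "\<dots> = Idl (insert y ?S)"
          unfolding x_def using Idl_add_element[of ?S y "z [^] Suc n"] ideal_mem_carrier[OF IS(1)] yc zS by blast
        also have "\<dots> = ?M" using Idl_insert_Idl[OF S yc(1)] Suc.prems(3) ys by simp
        finally show ?thesis .
      qed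
      define I where "I n = Idl (insert (x n) J)" for n
      have I: "primeideal (I n) R" "J \<subseteq> I n" "x n \<in> I n"
        "\<And>Q. \<lbrakk>primeideal Q R; J \<subseteq> Q; Q \<subseteq> I n\<rbrakk> \<Longrightarrow> Q = I n" for n
        using minimal[OF xc ys(2) yc(2) gen, of n] Idl_insert_ideal[OF J xc, of n] unfolding I_def by auto
      obtain F where F: "finite F" "\<And>Q. \<lbrakk>primeideal Q R; J \<subseteq> Q\<rbrakk> \<Longrightarrow> \<exists>P\<in>F. primeideal P R \<and> J \<subseteq> P \<and> P \<subseteq> Q"
        using finitely_many_primes_cover[OF J] by blast
      have "I n \<in> F" for n using F(2)[OF I(1,2)] I(4) by metis
      hence "finite (range I)" using F(1) by (meson finite_subset image_subsetI)
      hence "\<not> inj I" using range_inj_infinite by blast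
      then obtain m n where "m \<noteq> n" "I m = I n" unfolding inj_def by blast
      then obtain m n where mn: "m < n" "I m = I n" by (metis nat_neq_iff)
      interpret I: primeideal "I n" R by (rule I(1))
      define e where "e = z [^] (n - m)"
      have eM: "e \<in> ?M"
      proof -
        obtain i where "n - m = Suc i" using mn(1) by (metis Suc_diff_Suc)
        thus ?thesis unfolding e_def using ideal_lmult[OF max_ideal_ideal _ zM] zc by simp
      qed
      define w where "w = z [^] Suc m"
      have wc: "w \<in> carrier R" and ec: "e \<in> carrier R" unfolding w_def e_def using zc by simp_all
      have we: "z [^] Suc n = w \<otimes> e"
        unfolding w_def e_def using zc mn(1) by (subst nat_pow_mult) auto
      have "x m \<ominus> x n = w \<otimes> (\<one> \<ominus> e)"
        unfolding x_def we w_def[symmetric] using yc wc ec by algebra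
      moreover have "x m \<ominus> x n \<in> I n" using ideal_diff[OF I.is_ideal] I(3)[of m] I(3)[of n] mn(2) by simp
      ultimately have "w \<in> I n \<or> \<one> \<ominus> e \<in> I n" using I.I_prime[OF wc, of "\<one> \<ominus> e"] ec by auto
      moreover have "\<one> \<ominus> e \<notin> I n"
        using one_minus_max_ideal_notin[OF eM] prime_le_max_ideal[OF I(1)] by blast
      ultimately have "w \<in> I n" by blast
      hence zI: "z \<in> I n" unfolding w_def by (rule prime_pow_mem[OF I(1) zc(1)])
      have "z [^] Suc n \<in> I n" using ideal_lmult[OF I.is_ideal _ zI] zc by simp
      hence yI: "y \<in> I n" using ideal_add_cancel[OF I.is_ideal _ _ yc(1)] I(3)[of n] unfolding x_def by blast
      let ?T = "J \<union> set (x n # zs)"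
      have T: "?T \<subseteq> carrier R" using carrJ xc zc by auto
      have "I n \<subseteq> Idl ?T" unfolding I_def using T by (intro subset_Idl_subset) auto
      hence "J \<union> set ys \<subseteq> Idl ?T" using yI zI genideal_self[OF T] ys Cons by auto
      hence "?M \<subseteq> Idl ?T"
        unfolding Suc.prems(3)[symmetric] by (intro genideal_minimal genideal_ideal[OF T])
      moreover have "Idl ?T \<subseteq> ?M"
        using JM zsM I(3)[of n] prime_le_max_ideal[OF I(1)] by (intro genideal_minimal max_ideal_ideal) auto
      ultimately have TM: "Idl ?T = ?M" by blast
      have "Suc k \<le> length (x n # zs)"
        using T by (intro prime_chain_length_le_generators[OF J _ chain Suc.prems(5) TM max_ideal_prime]
            prime_le_max_ideal[OF prime_chainD(1)[OF chain]]) auto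
      thus False using ys(2) Cons by simp
    qed
  qed
qed

text \<open>The quotient by a part of a regular system of parameters is regular, hence a domain.\<close>

lemma regular_system_of_parameters_prime:
  assumes ys: "regular_system_of_parameters R ys" and i: "i \<le> length ys"
  shows "primeideal (Idl (set (take i ys))) R"
proof -
  have carr: "set ys \<subseteq> carrier R" and dim: "krull_dim R = enat (length ys)" and M: "Idl (set ys) = max_ideal R"
    using ys unfolding regular_system_of_parameters_def by auto
  obtain P where P: "prime_chain R (length ys) P" using krull_dim_attained[OF dim] .
  have len: "length ys = length (take i ys) + length (drop i ys)" by (simp flip: length_append)
  have ysM: "set ys \<subseteq> max_ideal R" using genideal_self[OF carr] M by simp
  have S: "set (take i ys) \<subseteq> carrier R" using carr set_take_subset by fast
  have "{\<zero>} \<subseteq> P 0" using ideal_zero[OF primeideal.axioms(1)[OF prime_chainD(1)[OF P, of 0]]] by simp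
  then obtain Q where Q: "prime_chain R (length (drop i ys)) Q" "Idl ({\<zero>} \<union> set (take i ys)) \<subseteq> Q 0"
    using prime_chain_over_generators[OF zeroideal, of "take i ys" "length (drop i ys)" P] P ysM
      set_take_subset[of i ys] unfolding len[symmetric] by auto
  note IS = genideal_ideal[OF S]
  have "Idl (set (take i ys)) \<subseteq> Idl ({\<zero>} \<union> set (take i ys))" using S by (intro subset_Idl_subset) auto
  hence Q0: "Idl (set (take i ys)) \<subseteq> Q 0" using Q(2) by blast
  have "Idl (set (drop i ys) \<union> Idl (set (take i ys))) = Idl (set (drop i ys) \<union> set (take i ys))"
    using carr S set_drop_subset[of i ys] by (intro Idl_Un_Idl) auto
  also have "set (drop i ys) \<union> set (take i ys) = set ys" by (metis Un_commute append_take_drop_id set_append)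
  finally have "Idl (Idl (set (take i ys)) \<union> set (drop i ys)) = max_ideal R" using M by (simp add: Un_commute)
  thus ?thesis
    using prime_if_chain_length_eq_generators[OF IS _ _ Q(1) Q0] carr set_drop_subset[of i ys] by blast
qed

end

section \<open>Linear combinations and finitely generated submodules of free modules\<close>

context cring begin

lemma finsum_swap:
  assumes "finite A" "finite C" "\<And>i j. \<lbrakk>i \<in> A; j \<in> C\<rbrakk> \<Longrightarrow> f i j \<in> carrier R"
  shows "(\<Oplus>i\<in>A. \<Oplus>j\<in>C. f i j) = (\<Oplus>j\<in>C. \<Oplus>i\<in>A. f i j)"
  using assms(1,3)
proof (induction A rule: finite_induct)
  case empty
  thus ?case by simp
next
  case (insert a A)
  have 1: "(\<lambda>j. f a j) \<in> C \<rightarrow> carrier R" using insert.prems by auto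
  have 2: "(\<lambda>j. \<Oplus>i\<in>A. f i j) \<in> C \<rightarrow> carrier R" using insert.prems by (auto intro!: finsum_closed)
  have 3: "(\<lambda>i. \<Oplus>j\<in>C. f i j) \<in> A \<rightarrow> carrier R" using insert.prems by (auto intro!: finsum_closed)
  have "(\<Oplus>i\<in>insert a A. \<Oplus>j\<in>C. f i j) = (\<Oplus>j\<in>C. f a j) \<oplus> (\<Oplus>j\<in>C. \<Oplus>i\<in>A. f i j)"
    using insert 1 3 by (simp add: finsum_closed)
  also have "\<dots> = (\<Oplus>j\<in>C. f a j \<oplus> (\<Oplus>i\<in>A. f i j))"
    by (rule finsum_addf[OF 1 2, symmetric])
  also have "\<dots> = (\<Oplus>j\<in>C. \<Oplus>i\<in>insert a A. f i j)"
    using insert by (intro finsum_cong') (auto intro!: finsum_closed)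
  finally show ?case .
qed

lemma finsum_mem_ideal:
  assumes "ideal J R" "\<And>i. i \<in> A \<Longrightarrow> f i \<in> J"
  shows "finsum R f A \<in> J"
proof (cases "finite A")
  case True
  thus ?thesis using assms(2)
  proof (induction A rule: finite_induct)
    case (insert a A)
    hence "f \<in> A \<rightarrow> carrier R" "f a \<in> carrier R" using ideal_mem_carrier[OF assms(1)] by auto
    thus ?case using insert ideal_add[OF assms(1)] by simp
  qed (simp add: ideal_zero[OF assms(1)])
qed (simp add: finsum_infinite ideal_zero[OF assms(1)])

lemma finsum_only:
  assumes "finite A" "a \<in> A" "f a \<in> carrier R" "\<And>i. \<lbrakk>i \<in> A; i \<noteq> a\<rbrakk> \<Longrightarrow> f i = \<zero>"
  shows "finsum R f A = f a"
proof -
  have "finsum R f A = finsum R f (insert a (A - {a}))" using assms(2) by (simp add: insert_absorb)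
  also have "\<dots> = f a \<oplus> finsum R f (A - {a})" using assms by (subst finsum_insert) auto
  also have "finsum R f (A - {a}) = \<zero>" using assms(4) by (intro finsum_0 add.finprod_one_eqI) auto
  finally show ?thesis using assms(3) by simp
qed

lemma finsum_filter:
  assumes "finite A" "\<And>x. x \<in> A \<Longrightarrow> Q x \<Longrightarrow> g x \<in> carrier R"
  shows "(\<Oplus>x\<in>A. if Q x then g x else \<zero>) = finsum R g {x \<in> A. Q x}"
  using assms
proof (induction A rule: finite_induct)
  case (insert a A)
  have "{x \<in> insert a A. Q x} = (if Q a then insert a {x \<in> A. Q x} else {x \<in> A. Q x})" by auto
  moreover have "(\<Oplus>x\<in>insert a A. if Q x then g x else \<zero>)
      = (if Q a then g a else \<zero>) \<oplus> (\<Oplus>x\<in>A. if Q x then g x else \<zero>)"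
    using insert by (intro finsum_insert) auto
  moreover have "finsum R g {x \<in> A. Q x} \<in> carrier R" using insert.prems by (intro finsum_closed) auto
  ultimately show ?case using insert by (auto simp: Pi_iff)
qed simp

lemma finsum_uminus:
  assumes "\<And>i. i \<in> A \<Longrightarrow> f i \<in> carrier R"
  shows "(\<Oplus>i\<in>A. \<ominus> f i) = \<ominus> finsum R f A"
proof (cases "finite A")
  case True
  thus ?thesis using assms
  proof (induction A rule: finite_induct)
    case (insert a A)
    hence "f \<in> A \<rightarrow> carrier R" "(\<lambda>i. \<ominus> f i) \<in> A \<rightarrow> carrier R" "f a \<in> carrier R" by auto
    thus ?case using insert by (simp add: minus_add finsum_closed)
  qed simp
qed (simp add: finsum_infinite)

text \<open>\<open>lincomb T c D\<close> is the image of the row vector \<open>c\<close>, indexed by \<open>T\<close>, under the matrix \<open>D\<close>.\<close>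

definition lincomb :: "'i set \<Rightarrow> ('i \<Rightarrow> 'a) \<Rightarrow> ('i \<Rightarrow> 'k \<Rightarrow> 'a) \<Rightarrow> 'k \<Rightarrow> 'a" where
  "lincomb T c D i = (\<Oplus>j\<in>T. c j \<otimes> D j i)"

lemma lincomb_closed [intro]:
  assumes "\<And>j. j \<in> T \<Longrightarrow> c j \<in> carrier R" "\<And>j. j \<in> T \<Longrightarrow> D j i \<in> carrier R"
  shows "lincomb T c D i \<in> carrier R"
  unfolding lincomb_def using assms by (auto intro!: finsum_closed)

lemma lincomb_cong:
  assumes "\<And>j. j \<in> T \<Longrightarrow> c j = c' j" "\<And>j. j \<in> T \<Longrightarrow> D j i = D' j i"
    "\<And>j. j \<in> T \<Longrightarrow> c' j \<in> carrier R" "\<And>j. j \<in> T \<Longrightarrow> D' j i \<in> carrier R"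
  shows "lincomb T c D i = lincomb T c' D' i"
  unfolding lincomb_def using assms by (intro finsum_cong') auto

lemma lincomb_mem_ideal:
  assumes "ideal J R" "\<And>j. j \<in> T \<Longrightarrow> c j \<in> J" "\<And>j. j \<in> T \<Longrightarrow> D j i \<in> carrier R"
  shows "lincomb T c D i \<in> J"
  unfolding lincomb_def using assms ideal_rmult[OF assms(1)] by (intro finsum_mem_ideal) auto

lemma lincomb_mem_ideal':
  assumes "ideal J R" "\<And>j. j \<in> T \<Longrightarrow> c j \<in> carrier R" "\<And>j. j \<in> T \<Longrightarrow> D j i \<in> J"
  shows "lincomb T c D i \<in> J"
  unfolding lincomb_def using assms ideal_lmult[OF assms(1)] by (intro finsum_mem_ideal) auto

lemma lincomb_add:
  assumes "\<And>j. j \<in> T \<Longrightarrow> a j \<in> carrier R" "\<And>j. j \<in> T \<Longrightarrow> b j \<in> carrier R"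
    "\<And>j. j \<in> T \<Longrightarrow> D j i \<in> carrier R"
  shows "lincomb T (\<lambda>j. a j \<oplus> b j) D i = lincomb T a D i \<oplus> lincomb T b D i"
proof -
  have "lincomb T (\<lambda>j. a j \<oplus> b j) D i = (\<Oplus>j\<in>T. a j \<otimes> D j i \<oplus> b j \<otimes> D j i)"
    unfolding lincomb_def using assms by (intro finsum_cong') (auto simp: l_distr)
  also have "\<dots> = lincomb T a D i \<oplus> lincomb T b D i"
    unfolding lincomb_def using assms by (intro finsum_addf) auto
  finally show ?thesis .
qed

lemma lincomb_smult:
  assumes "finite T" "r \<in> carrier R" "\<And>j. j \<in> T \<Longrightarrow> a j \<in> carrier R" "\<And>j. j \<in> T \<Longrightarrow> D j i \<in> carrier R"
  shows "lincomb T (\<lambda>j. r \<otimes> a j) D i = r \<otimes> lincomb T a D i"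
proof -
  have "lincomb T (\<lambda>j. r \<otimes> a j) D i = (\<Oplus>j\<in>T. r \<otimes> (a j \<otimes> D j i))"
    unfolding lincomb_def using assms by (intro finsum_cong') (auto simp: m_assoc)
  also have "\<dots> = r \<otimes> lincomb T a D i"
    unfolding lincomb_def using assms by (intro finsum_rdistr[symmetric]) auto
  finally show ?thesis .
qed

lemma lincomb_diff:
  assumes "finite T" "\<And>j. j \<in> T \<Longrightarrow> a j \<in> carrier R" "\<And>j. j \<in> T \<Longrightarrow> b j \<in> carrier R"
    "\<And>j. j \<in> T \<Longrightarrow> D j i \<in> carrier R"
  shows "lincomb T (\<lambda>j. a j \<ominus> b j) D i = lincomb T a D i \<ominus> lincomb T b D i"
proof -
  have "lincomb T (\<lambda>j. \<ominus> b j) D i = lincomb T (\<lambda>j. \<ominus> \<one> \<otimes> b j) D i"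
    using assms by (intro lincomb_cong) (auto simp: l_minus)
  also have "\<dots> = \<ominus> lincomb T b D i"
    using assms lincomb_closed[of T b D i] by (subst lincomb_smult) (auto simp: l_minus)
  finally show ?thesis
    unfolding a_minus_def using assms by (subst lincomb_add) auto
qed

lemma lincomb_finsum:
  assumes "finite T" "finite S" "\<And>j s. \<lbrakk>j \<in> T; s \<in> S\<rbrakk> \<Longrightarrow> a s j \<in> carrier R"
    "\<And>j. j \<in> T \<Longrightarrow> D j i \<in> carrier R"
  shows "lincomb T (\<lambda>j. \<Oplus>s\<in>S. a s j) D i = (\<Oplus>s\<in>S. lincomb T (a s) D i)"
proof -
  have "lincomb T (\<lambda>j. \<Oplus>s\<in>S. a s j) D i = (\<Oplus>j\<in>T. \<Oplus>s\<in>S. a s j \<otimes> D j i)"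
    unfolding lincomb_def using assms
    by (intro finsum_cong') (auto intro!: finsum_ldistr finsum_closed)
  also have "\<dots> = (\<Oplus>s\<in>S. lincomb T (a s) D i)"
    unfolding lincomb_def using assms by (intro finsum_swap) auto
  finally show ?thesis .
qed

lemma lincomb_unit:
  assumes "finite T" "j \<in> T" "\<And>l. l \<in> T \<Longrightarrow> D l i \<in> carrier R"
  shows "lincomb T (\<lambda>l. if l = j then \<one> else \<zero>) D i = D j i"
  unfolding lincomb_def using assms by (subst finsum_only[of T j]) auto

lemma Idl_finite:
  assumes "finite F" "F \<subseteq> carrier R"
  shows "Idl F = {\<Oplus>f\<in>F. c f \<otimes> f | c. c \<in> F \<rightarrow> carrier R}" (is "_ = ?K")
proof
  have K: "?K = {lincomb F c (\<lambda>f _. f) () | c. c \<in> F \<rightarrow> carrier R}" unfolding lincomb_def by simp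
  have F: "\<And>f. f \<in> F \<Longrightarrow> f \<in> carrier R" using assms by blast
  have "ideal ?K R" unfolding K
  proof (rule cring_idealI)
    let ?L = "\<lambda>c. lincomb F c (\<lambda>f _. f) ()"
    show "{?L c | c. c \<in> F \<rightarrow> carrier R} \<subseteq> carrier R" using F by auto
    have "?L (\<lambda>_. \<zero>) = \<zero>" unfolding lincomb_def using F by (intro add.finprod_one_eqI) auto
    thus "\<zero> \<in> {?L c | c. c \<in> F \<rightarrow> carrier R}"
      by (intro CollectI exI[of _ "\<lambda>_. \<zero>"]) auto
    show "a \<oplus> b \<in> {?L c | c. c \<in> F \<rightarrow> carrier R}"
      if "a \<in> {?L c | c. c \<in> F \<rightarrow> carrier R}" "b \<in> {?L c | c. c \<in> F \<rightarrow> carrier R}" for a b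
    proof -
      from that obtain c d where h: "c \<in> F \<rightarrow> carrier R" "d \<in> F \<rightarrow> carrier R" "a = ?L c" "b = ?L d" by blast
      have "a \<oplus> b = ?L (\<lambda>f. c f \<oplus> d f)" unfolding h using h(1,2) F by (subst lincomb_add) auto
      thus ?thesis using h(1,2) by (intro CollectI exI[of _ "\<lambda>f. c f \<oplus> d f"]) auto
    qed
    show "r \<otimes> a \<in> {?L c | c. c \<in> F \<rightarrow> carrier R}"
      if r: "r \<in> carrier R" and "a \<in> {?L c | c. c \<in> F \<rightarrow> carrier R}" for r a
    proof -
      from that obtain c where h: "c \<in> F \<rightarrow> carrier R" "a = ?L c" by blast
      have "r \<otimes> a = ?L (\<lambda>f. r \<otimes> c f)" unfolding h using h(1) F r assms(1) by (subst lincomb_smult) auto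
      thus ?thesis using h(1) r by (intro CollectI exI[of _ "\<lambda>f. r \<otimes> c f"]) auto
    qed
  qed
  moreover have "F \<subseteq> ?K"
  proof
    fix f assume f: "f \<in> F"
    have "lincomb F (\<lambda>l. if l = f then \<one> else \<zero>) (\<lambda>f _. f) () = f"
      using lincomb_unit[OF assms(1) f, of "\<lambda>f _. f"] F by simp
    thus "f \<in> ?K" unfolding K by (intro CollectI exI[of _ "\<lambda>l. if l = f then \<one> else \<zero>"]) auto
  qed
  ultimately show "Idl F \<subseteq> ?K" by (rule genideal_minimal)
  show "?K \<subseteq> Idl F"
    using genideal_self[OF assms(2)]
    by (auto intro!: finsum_mem_ideal ideal_lmult genideal_ideal assms(2))
qed

text \<open>Vectors are functions on the index set \<open>I\<close>. Their values elsewhere are irrelevant, which is what the last clause says.\<close>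

definition vec_submodule :: "'k set \<Rightarrow> ('k \<Rightarrow> 'a) set \<Rightarrow> bool" where
  "vec_submodule I N \<longleftrightarrow> N \<subseteq> I \<rightarrow> carrier R \<and> (\<lambda>_. \<zero>) \<in> N \<and>
     (\<forall>u\<in>N. \<forall>v\<in>N. (\<lambda>i. u i \<oplus> v i) \<in> N) \<and> (\<forall>r\<in>carrier R. \<forall>v\<in>N. (\<lambda>i. r \<otimes> v i) \<in> N) \<and>
     (\<forall>v\<in>N. \<forall>u. (\<forall>i\<in>I. u i = v i) \<longrightarrow> u \<in> N)"

lemma vec_submoduleD:
  assumes "vec_submodule I N"
  shows "v \<in> N \<Longrightarrow> i \<in> I \<Longrightarrow> v i \<in> carrier R" "(\<lambda>_. \<zero>) \<in> N"
    "\<lbrakk>u \<in> N; v \<in> N\<rbrakk> \<Longrightarrow> (\<lambda>i. u i \<oplus> v i) \<in> N" "\<lbrakk>r \<in> carrier R; v \<in> N\<rbrakk> \<Longrightarrow> (\<lambda>i. r \<otimes> v i) \<in> N"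
    "\<lbrakk>v \<in> N; \<And>i. i \<in> I \<Longrightarrow> u i = v i\<rbrakk> \<Longrightarrow> u \<in> N"
  using assms unfolding vec_submodule_def by auto

lemma lincomb_mem_vec_submodule:
  assumes N: "vec_submodule I N" and S: "finite S" "\<And>j. j \<in> S \<Longrightarrow> c j \<in> carrier R" "\<And>j. j \<in> S \<Longrightarrow> w j \<in> N"
  shows "(\<lambda>i. lincomb S c w i) \<in> N"
  using S
proof (induction S rule: finite_induct)
  case empty
  thus ?case using vec_submoduleD(2)[OF N] by (simp add: lincomb_def)
next
  case (insert s S)
  have "(\<lambda>i. c s \<otimes> w s i \<oplus> lincomb S c w i) \<in> N"
    using insert by (intro vec_submoduleD(3,4)[OF N]) auto
  thus ?case
  proof (rule vec_submoduleD(5)[OF N])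
    fix i assume i: "i \<in> I"
    hence "(\<lambda>j. c j \<otimes> w j i) \<in> S \<rightarrow> carrier R" "c s \<otimes> w s i \<in> carrier R"
      using insert.prems vec_submoduleD(1)[OF N _ i] by auto
    thus "lincomb (insert s S) c w i = c s \<otimes> w s i \<oplus> lincomb S c w i"
      unfolding lincomb_def using insert.hyps by simp
  qed
qed

definition spans :: "'i set \<Rightarrow> ('i \<Rightarrow> 'k \<Rightarrow> 'a) \<Rightarrow> 'k set \<Rightarrow> ('k \<Rightarrow> 'a) set \<Rightarrow> bool" where
  "spans T g I N \<longleftrightarrow> finite T \<and> (\<forall>j\<in>T. g j \<in> N) \<and>
     (\<forall>v\<in>N. \<exists>c\<in>T \<rightarrow> carrier R. \<forall>i\<in>I. v i = lincomb T c g i)"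

end

context noetherian_cring begin

text \<open>Induction on the set \<open>K\<close> of coordinates that may be nonzero: the coordinates at \<open>a \<in> K\<close> form an ideal, and lifts of
  its generators reduce the problem to the vectors that vanish at \<open>a\<close>.\<close>

lemma vec_submodule_supported_finitely_generated:
  assumes "finite K" "K \<subseteq> I" "vec_submodule I N" "\<And>v i. \<lbrakk>v \<in> N; i \<in> I - K\<rbrakk> \<Longrightarrow> v i = \<zero>"
  shows "\<exists>T g. spans (T :: nat set) g I N"
  using assms
proof (induction K arbitrary: N rule: finite_induct)
  case empty
  hence "spans {} g I N" for g :: "nat \<Rightarrow> _" by (auto simp: spans_def lincomb_def)
  thus ?case by blast
next
  case (insert a K)
  hence aI: "a \<in> I" by blast
  note N = vec_submoduleD[OF insert.prems(2)]
  define A where "A = (\<lambda>v. v a) ` N"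
  have "ideal A R"
  proof (rule cring_idealI)
    show "A \<subseteq> carrier R" unfolding A_def using N(1) aI by auto
    show "\<zero> \<in> A" unfolding A_def using N(2) by force
    show "u \<oplus> v \<in> A" if "u \<in> A" "v \<in> A" for u v
      using that N(3) unfolding A_def by (auto intro: rev_image_eqI)
    show "r \<otimes> v \<in> A" if "r \<in> carrier R" "v \<in> A" for r v
      using that N(4) unfolding A_def by (auto intro: rev_image_eqI)
  qed
  then obtain F where F: "F \<subseteq> carrier R" "finite F" "A = Idl F" using finetely_gen by blast
  define k where "k = card F"
  obtain h where h: "bij_betw h {..<k} F"
    using ex_bij_betw_nat_finite[OF F(2)] unfolding k_def atLeast0LessThan by blast
  have hF: "h j \<in> F" if "j < k" for j using h that unfolding bij_betw_def by auto
  have "\<exists>w. w \<in> N \<and> w a = h j" if "j < k" for j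
  proof -
    have "h j \<in> A" using hF[OF that] F genideal_self by blast
    thus ?thesis unfolding A_def by auto
  qed
  then obtain w where w: "\<And>j. j < k \<Longrightarrow> w j \<in> N" "\<And>j. j < k \<Longrightarrow> w j a = h j" by metis
  define N' where "N' = {v \<in> N. v a = \<zero>}"
  have "vec_submodule I N'"
    unfolding vec_submodule_def N'_def using N aI by auto
  moreover have "v i = \<zero>" if "v \<in> N'" "i \<in> I - K" for v i
    using that insert.prems(3)[of v i] unfolding N'_def by (cases "i = a") auto
  ultimately obtain T' :: "nat set" and g' where T': "spans T' g' I N'"
    using insert.IH[of N'] insert.prems(1) by blast
  have fT': "finite T'" and g': "\<And>j. j \<in> T' \<Longrightarrow> g' j \<in> N'" using T' unfolding spans_def by auto
  define T where "T = {..<k} \<union> (\<lambda>j. j + k) ` T'"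
  define g where "g j = (if j < k then w j else g' (j - k))" for j
  have gN: "g j \<in> N" if "j \<in> T" for j using that w(1) g' unfolding T_def g_def N'_def by auto
  have split: "lincomb T (\<lambda>j. if j < k then c j else c' (j - k)) g i = lincomb {..<k} c w i \<oplus> lincomb T' c' g' i"
    if c: "\<And>j. j < k \<Longrightarrow> c j \<in> carrier R" "\<And>j. j \<in> T' \<Longrightarrow> c' j \<in> carrier R" and i: "i \<in> I" for c c' i
  proof -
    let ?f = "\<lambda>j. (if j < k then c j else c' (j - k)) \<otimes> g j i"
    have wi: "\<And>j. j < k \<Longrightarrow> w j i \<in> carrier R" "\<And>j. j \<in> T' \<Longrightarrow> g' j i \<in> carrier R"
      using N(1) w(1) g' i unfolding N'_def by auto
    have "lincomb T (\<lambda>j. if j < k then c j else c' (j - k)) g i = finsum R ?f {..<k} \<oplus> finsum R ?f ((\<lambda>j. j + k) ` T')"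
      unfolding lincomb_def T_def using c wi fT' by (intro finsum_Un_disjoint) (auto simp: g_def)
    also have "finsum R ?f {..<k} = lincomb {..<k} c w i"
      unfolding lincomb_def using c wi by (intro finsum_cong') (auto simp: g_def)
    also have "finsum R ?f ((\<lambda>j. j + k) ` T') = (\<Oplus>j\<in>T'. ?f (j + k))"
      using c wi by (intro finsum_reindex) (auto simp: g_def inj_on_def)
    also have "\<dots> = lincomb T' c' g' i"
      unfolding lincomb_def using c wi by (intro finsum_cong') (auto simp: g_def)
    finally show ?thesis .
  qed
  have "\<exists>c\<in>T \<rightarrow> carrier R. \<forall>i\<in>I. v i = lincomb T c g i" if v: "v \<in> N" for v
  proof -
    have "v a \<in> Idl F" using v F(3) unfolding A_def by blast
    then obtain d where d: "d \<in> F \<rightarrow> carrier R" "v a = (\<Oplus>f\<in>F. d f \<otimes> f)" unfolding Idl_finite[OF F(2,1)] by blast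
    define c where "c j = d (h j)" for j
    have c: "c j \<in> carrier R" if "j < k" for j unfolding c_def using d(1) hF[OF that] by auto
    have "(\<Oplus>f\<in>F. d f \<otimes> f) = (\<Oplus>f\<in>h ` {..<k}. d f \<otimes> f)" using h by (simp add: bij_betw_def)
    also have "\<dots> = (\<Oplus>j\<in>{..<k}. d (h j) \<otimes> h j)"
      using h d(1) F(1) unfolding bij_betw_def by (intro finsum_reindex) auto
    also have "\<dots> = lincomb {..<k} c w a"
      unfolding lincomb_def c_def[symmetric] using c w(2) hF F(1) by (intro finsum_cong') (auto simp: subset_eq)
    finally have va: "v a = lincomb {..<k} c w a" using d(2) by simp
    have L: "(\<lambda>i. lincomb {..<k} c w i) \<in> N"
      using c w(1) by (intro lincomb_mem_vec_submodule[OF insert.prems(2)]) auto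
    define u where "u i = v i \<oplus> \<ominus> \<one> \<otimes> lincomb {..<k} c w i" for i
    have "u \<in> N" unfolding u_def using N(3)[OF v N(4)[OF _ L, of "\<ominus> \<one>"]] by simp
    moreover have "u a = \<zero>"
      unfolding u_def va[symmetric] using N(1)[OF v aI] by (simp add: l_minus r_neg)
    ultimately have "u \<in> N'" unfolding N'_def by simp
    then obtain c' where c': "c' \<in> T' \<rightarrow> carrier R" "\<And>i. i \<in> I \<Longrightarrow> u i = lincomb T' c' g' i"
      using T' unfolding spans_def by blast
    have "v i = lincomb {..<k} c w i \<oplus> u i" if i: "i \<in> I" for i
    proof -
      have "v i \<in> carrier R" "lincomb {..<k} c w i \<in> carrier R" using N(1)[OF v i] N(1)[OF L i] by auto
      thus ?thesis unfolding u_def by (simp add: l_minus) algebra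
    qed
    hence "v i = lincomb T (\<lambda>j. if j < k then c j else c' (j - k)) g i" if "i \<in> I" for i
      using that c c' by (subst split) auto
    moreover have "(\<lambda>j. if j < k then c j else c' (j - k)) \<in> T \<rightarrow> carrier R"
      using c c'(1) unfolding T_def by auto
    ultimately show ?thesis by blast
  qed
  hence "spans T g I N" unfolding spans_def using gN fT' by (auto simp: T_def)
  thus ?case by blast
qed

corollary vec_submodule_finitely_generated:
  "\<lbrakk>finite I; vec_submodule I N\<rbrakk> \<Longrightarrow> \<exists>T g. spans (T :: nat set) g I N"
  using vec_submodule_supported_finitely_generated[of I I N] by simp

end

section \<open>Minimal free resolutions of the residue field\<close>

text \<open>A free resolution \<open>\<dots> \<rightarrow> F\<^sub>2 \<rightarrow> F\<^sub>1 \<rightarrow> F\<^sub>0 = R\<close> of the residue field, with boundary maps that vanish modulo the maximal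
  ideal. The basis of \<open>F\<^sub>k\<close> is indexed by \<open>T k\<close>, and the boundary map \<open>F\<^bsub>k + 1\<^esub> \<rightarrow> F\<^sub>k\<close> multiplies row vectors by the matrix \<open>D k\<close>.
  Index sets instead of ranks allow a superfluous generator to be dropped without renumbering.\<close>

locale minimal_resolution = local_ring R for R :: "('a, 'm) ring_scheme" (structure) +
  fixes T :: "nat \<Rightarrow> nat set" and D :: "nat \<Rightarrow> nat \<Rightarrow> nat \<Rightarrow> 'a"
  assumes T_0: "T 0 = {0}" and finite_T: "finite (T k)"
    and D_max_ideal: "\<lbrakk>j \<in> T (Suc k); i \<in> T k\<rbrakk> \<Longrightarrow> D k j i \<in> max_ideal R"
    and complex: "\<lbrakk>l \<in> T (Suc (Suc k)); i \<in> T k\<rbrakk> \<Longrightarrow> lincomb (T (Suc k)) (D (Suc k) l) (D k) i = \<zero>"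
    and exact_0: "a \<in> max_ideal R \<Longrightarrow> \<exists>c \<in> T (Suc 0) \<rightarrow> carrier R. a = lincomb (T (Suc 0)) c (D 0) 0"
    and exact_Suc: "\<lbrakk>c \<in> T (Suc k) \<rightarrow> carrier R; \<And>i. i \<in> T k \<Longrightarrow> lincomb (T (Suc k)) c (D k) i = \<zero>\<rbrakk>
       \<Longrightarrow> \<exists>e \<in> T (Suc (Suc k)) \<rightarrow> carrier R. \<forall>j \<in> T (Suc k). c j = lincomb (T (Suc (Suc k))) e (D (Suc k)) j"

context noetherian_local_ring begin

definition minimal_spans :: "'i set \<Rightarrow> ('i \<Rightarrow> 'k \<Rightarrow> 'a) \<Rightarrow> 'k set \<Rightarrow> bool" where
  "minimal_spans T g I \<longleftrightarrow> (\<forall>c \<in> T \<rightarrow> carrier R.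
     (\<forall>i\<in>I. lincomb T c g i = \<zero>) \<longrightarrow> (\<forall>j\<in>T. c j \<in> max_ideal R))"

text \<open>In a relation among generators, a unit coefficient makes its generator superfluous.\<close>

lemma exists_minimal_spans:
  assumes I: "finite I" and N: "vec_submodule I N"
  obtains T :: "nat set" and g where "spans T g I N" "minimal_spans T g I"
proof -
  let ?P = "\<lambda>n. \<exists>(T :: nat set) g. spans T g I N \<and> card T = n"
  have "\<exists>n. ?P n" using vec_submodule_finitely_generated[OF assms] by blast
  hence "?P (LEAST n. ?P n)" by (rule LeastI_ex)
  then obtain T :: "nat set" and g where T: "spans T g I N" "card T = (LEAST n. ?P n)" by blast
  have fT: "finite T" and gN: "\<And>j. j \<in> T \<Longrightarrow> g j \<in> N" using T(1) unfolding spans_def by auto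
  have gc: "g j i \<in> carrier R" if "j \<in> T" "i \<in> I" for j i using vec_submoduleD(1)[OF N gN] that by blast
  have "minimal_spans T g I"
    unfolding minimal_spans_def
  proof (intro ballI impI)
    fix c j assume c: "c \<in> T \<rightarrow> carrier R" and rel: "\<forall>i\<in>I. lincomb T c g i = \<zero>" and j: "j \<in> T"
    show "c j \<in> max_ideal R"
    proof (rule ccontr)
      assume "c j \<notin> max_ideal R"
      hence u: "c j \<in> Units R" using c j Units_iff_notin_max_ideal by blast
      let ?T = "T - {j}"
      have "spans ?T g I N"
        unfolding spans_def
      proof (intro conjI ballI)
        fix v assume "v \<in> N"
        then obtain d where d: "d \<in> T \<rightarrow> carrier R" "\<And>i. i \<in> I \<Longrightarrow> v i = lincomb T d g i"
          using T(1) unfolding spans_def by blast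
        define r where "r = d j \<otimes> inv (c j)"
        have r: "r \<in> carrier R" unfolding r_def using d(1) u j by auto
        define e where "e l = d l \<ominus> r \<otimes> c l" for l
        have e: "e l \<in> carrier R" if "l \<in> T" for l unfolding e_def using d(1) c r that by auto
        have dj: "d j \<in> carrier R" and cj: "c j \<in> carrier R" using d(1) c j by auto
        have "r \<otimes> c j = d j" unfolding r_def using dj cj u m_assoc[of "d j" "inv (c j)" "c j"] by simp
        hence ej: "e j = \<zero>" unfolding e_def using dj by simp
        have "v i = lincomb ?T e g i" if i: "i \<in> I" for i
        proof -
          have "lincomb T d g i \<in> carrier R" using d(1) gc i by auto
          hence v: "lincomb T d g i \<ominus> \<zero> = v i" using d(2)[OF i] by (simp add: a_minus_def)
          have "lincomb T e g i = lincomb T d g i \<ominus> lincomb T (\<lambda>l. r \<otimes> c l) g i"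
            unfolding e_def using d(1) c r gc i fT by (intro lincomb_diff) auto
          also have "lincomb T (\<lambda>l. r \<otimes> c l) g i = r \<otimes> lincomb T c g i"
            using c r gc i fT by (intro lincomb_smult) auto
          also have "\<dots> = \<zero>" using rel i r by simp
          also note v
          finally have "v i = lincomb (insert j ?T) e g i" using j by (simp add: insert_absorb)
          also have "\<dots> = lincomb ?T e g i"
            unfolding lincomb_def using e ej gc i fT j by (subst finsum_insert) (auto intro!: finsum_closed)
          finally show ?thesis .
        qed
        hence "\<forall>i\<in>I. v i = lincomb ?T e g i" by (rule ballI)
        moreover have "e \<in> ?T \<rightarrow> carrier R" using e by auto
        ultimately show "\<exists>e\<in>?T \<rightarrow> carrier R. \<forall>i\<in>I. v i = lincomb ?T e g i" by (rule bexI)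
      next
        show "finite ?T" using fT by (rule finite_Diff)
        show "g l \<in> N" if "l \<in> ?T" for l using that gN by blast
      qed
      hence "?P (card ?T)" by (intro exI[of _ ?T] exI[of _ g] conjI refl)
      hence "card T \<le> card ?T" unfolding T(2) by (rule Least_le)
      moreover have "card ?T < card T" by (rule card_Diff1_less[OF fT j])
      ultimately show False by (rule leD[THEN notE])
    qed
  qed
  thus ?thesis using that T(1) by blast
qed

text \<open>Each step chooses minimal generators of the kernel of the preceding map. Minimality at one step says that the
  entries of the next matrix lie in the maximal ideal.\<close>

lemma exists_minimal_resolution:
  obtains T D where "minimal_resolution R T D"
proof -
  \<comment> \<open>a triple \<open>(I, T, g)\<close> consists of the index sets of \<open>F\<^sub>k\<close> and \<open>F\<^bsub>k + 1\<^esub>\<close> and of the matrix of the map between them\<close>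
  define P where "P x \<longleftrightarrow> (case x of (I, T, g) \<Rightarrow> finite I \<and> finite T \<and>
     (\<forall>j\<in>T. \<forall>i\<in>I. g j i \<in> max_ideal R) \<and> minimal_spans T g I)"
    for x :: "nat set \<times> nat set \<times> (nat \<Rightarrow> nat \<Rightarrow> 'a)"
  define K where "K I T g = {c \<in> T \<rightarrow> carrier R. \<forall>i\<in>I. lincomb T c g i = \<zero>}"
    for I T :: "nat set" and g :: "nat \<Rightarrow> nat \<Rightarrow> 'a"
  define Q where "Q x y \<longleftrightarrow> (case x of (I, T, g) \<Rightarrow> case y of (I', T', g') \<Rightarrow> I' = T \<and> spans T' g' T (K I T g))"
    for x y :: "nat set \<times> nat set \<times> (nat \<Rightarrow> nat \<Rightarrow> 'a)"
  define N0 where "N0 = {v :: nat \<Rightarrow> 'a. v 0 \<in> max_ideal R}"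
  have "vec_submodule {0} N0"
    unfolding vec_submodule_def N0_def
    using mem_max_ideal_carrier ideal_zero[OF max_ideal_ideal] ideal_add[OF max_ideal_ideal] ideal_lmult[OF max_ideal_ideal]
    by auto
  then obtain T0 :: "nat set" and g0 where 0: "spans T0 g0 {0} N0" "minimal_spans T0 g0 {0}"
    using exists_minimal_spans[of "{0::nat}" N0] by auto
  have "P ({0}, T0, g0)" unfolding P_def using 0 unfolding spans_def N0_def by auto
  have step: "\<exists>y. P y \<and> Q x y" if "P x" for x
  proof -
    obtain I T g where x: "x = (I, T, g)" by (cases x)
    have h: "finite I" "finite T" "\<And>j i. \<lbrakk>j \<in> T; i \<in> I\<rbrakk> \<Longrightarrow> g j i \<in> max_ideal R" "minimal_spans T g I"
      using that unfolding P_def x by auto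
    have gc: "\<And>j i. \<lbrakk>j \<in> T; i \<in> I\<rbrakk> \<Longrightarrow> g j i \<in> carrier R" using h(3) mem_max_ideal_carrier by blast
    have "vec_submodule T (K I T g)"
      unfolding vec_submodule_def
    proof (intro conjI ballI allI impI)
      show "(\<lambda>_. \<zero>) \<in> K I T g"
        unfolding K_def lincomb_def using gc by (auto intro!: add.finprod_one_eqI)
      show "(\<lambda>i. u i \<oplus> v i) \<in> K I T g" if "u \<in> K I T g" "v \<in> K I T g" for u v
        using that gc unfolding K_def by (auto simp: lincomb_add Pi_iff)
      show "(\<lambda>i. r \<otimes> v i) \<in> K I T g" if "r \<in> carrier R" "v \<in> K I T g" for r v
        using that gc h(2) unfolding K_def by (auto simp: lincomb_smult Pi_iff)
      show "u \<in> K I T g" if v: "v \<in> K I T g" and uv: "\<forall>i\<in>T. u i = v i" for u v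
      proof -
        have vc: "\<And>j. j \<in> T \<Longrightarrow> v j \<in> carrier R" using v unfolding K_def by auto
        have "lincomb T u g i = lincomb T v g i" if "i \<in> I" for i
          using uv vc gc that by (intro lincomb_cong) auto
        thus ?thesis using v vc uv unfolding K_def by auto
      qed
    qed (auto simp: K_def)
    then obtain T' :: "nat set" and g' where T': "spans T' g' T (K I T g)" "minimal_spans T' g' T"
      using exists_minimal_spans[OF h(2)] by blast
    have "g' j i \<in> max_ideal R" if "j \<in> T'" "i \<in> T" for j i
      using T'(1) that h(4) unfolding spans_def K_def minimal_spans_def by blast
    hence "P (T, T', g')" unfolding P_def using h(2) T' unfolding spans_def by auto
    moreover have "Q x (T, T', g')" unfolding Q_def x using T'(1) by simp
    ultimately show ?thesis by blast
  qed
  have "\<exists>f. f 0 = ({0}, T0, g0) \<and> (\<forall>n. P (f n) \<and> Q (f n) (f (Suc n)))"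
  proof -
    have "\<exists>f. (\<forall>n. P (f n) \<and> (n = 0 \<longrightarrow> f n = ({0}, T0, g0))) \<and> (\<forall>n. Q (f n) (f (Suc n)))"
      using dependent_nat_choice[of "\<lambda>n x. P x \<and> (n = 0 \<longrightarrow> x = ({0}, T0, g0))" "\<lambda>n. Q"]
        \<open>P ({0}, T0, g0)\<close> step by auto
    thus ?thesis by metis
  qed
  then obtain f where f: "f 0 = ({0}, T0, g0)" "\<And>n. P (f n)" "\<And>n. Q (f n) (f (Suc n))" by blast
  define T where "T n = fst (f n)" for n
  define D where "D n = snd (snd (f n))" for n
  have f_eq: "f n = (T n, T (Suc n), D n)" for n
    using f(3)[of n] unfolding Q_def T_def D_def by (auto split: prod.splits)
  have Pn: "finite (T n)" "\<And>j i. \<lbrakk>j \<in> T (Suc n); i \<in> T n\<rbrakk> \<Longrightarrow> D n j i \<in> max_ideal R" for n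
    using f(2)[of n] unfolding f_eq P_def by auto
  have Qn: "spans (T (Suc (Suc n))) (D (Suc n)) (T (Suc n)) (K (T n) (T (Suc n)) (D n))" for n
    using f(3)[of n] unfolding f_eq[of n] f_eq[of "Suc n"] Q_def by simp
  have T0: "T 0 = {0}" "T (Suc 0) = T0" "D 0 = g0" using f(1) f_eq[of 0] by auto
  have "minimal_resolution R T D"
  proof (intro minimal_resolution.intro minimal_resolution_axioms.intro local_ring_axioms)
    show "T 0 = {0}" by (rule T0)
    show "finite (T k)" for k by (rule Pn)
    show "D k j i \<in> max_ideal R" if "j \<in> T (Suc k)" "i \<in> T k" for j k i using Pn(2) that .
    show "lincomb (T (Suc k)) (D (Suc k) l) (D k) i = \<zero>" if "l \<in> T (Suc (Suc k))" "i \<in> T k" for l k i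
      using Qn[of k] that unfolding spans_def K_def by blast
    show "\<exists>c\<in>T (Suc 0) \<rightarrow> carrier R. a = lincomb (T (Suc 0)) c (D 0) 0" if "a \<in> max_ideal R" for a
    proof -
      have "(\<lambda>_. a) \<in> N0" unfolding N0_def using that by simp
      thus ?thesis using 0(1) unfolding spans_def T0 by auto
    qed
    show "\<exists>e\<in>T (Suc (Suc k)) \<rightarrow> carrier R. \<forall>j\<in>T (Suc k). c j = lincomb (T (Suc (Suc k))) e (D (Suc k)) j"
      if "c \<in> T (Suc k) \<rightarrow> carrier R" "\<And>i. i \<in> T k \<Longrightarrow> lincomb (T (Suc k)) c (D k) i = \<zero>" for c k
      using Qn[of k] that unfolding spans_def K_def by blast
  qed
  thus ?thesis using that by blast
qed

end

lemma (in cring) finsum_antisymmetric: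
  assumes "finite A" and closed: "\<And>j k. \<lbrakk>j \<in> A; k \<in> A; j \<noteq> k\<rbrakk> \<Longrightarrow> f j k \<in> carrier R"
    and anti: "\<And>j k. \<lbrakk>j \<in> A; k \<in> A; j \<noteq> k\<rbrakk> \<Longrightarrow> f j k = \<ominus> f k j"
  shows "(\<Oplus>j\<in>A. \<Oplus>k\<in>A - {j}. f j k) = \<zero>"
proof -
  have "(\<Oplus>j\<in>S. \<Oplus>k\<in>S - {j}. f j k) = \<zero>" if "finite S" "S \<subseteq> A" for S
    using that
  proof (induction S rule: finite_induct)
    case empty
    show ?case by (rule finsum_empty)
  next
    case (insert a S)
    have c: "f j k \<in> carrier R" if "j \<in> insert a S" "k \<in> insert a S" "j \<noteq> k" for j k
      using that insert.prems by (intro closed) auto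
    have inner: "(\<Oplus>k\<in>insert a S - {j}. f j k) = f j a \<oplus> (\<Oplus>k\<in>S - {j}. f j k)" if "j \<in> S" for j
    proof -
      have "insert a S - {j} = insert a (S - {j})" using that insert.hyps(2) by auto
      moreover have "(\<Oplus>k\<in>insert a (S - {j}). f j k) = f j a \<oplus> (\<Oplus>k\<in>S - {j}. f j k)"
        using that insert.hyps c by (intro finsum_insert) auto
      ultimately show ?thesis by simp
    qed
    have sums: "(\<Oplus>k\<in>S - {j}. f j k) \<in> carrier R" if "j \<in> insert a S" for j
      using c that insert.hyps(2) by (intro finsum_closed) auto
    have "insert a S - {a} = S" using insert.hyps(2) by blast
    hence "(\<Oplus>j\<in>insert a S. \<Oplus>k\<in>insert a S - {j}. f j k)
        = (\<Oplus>k\<in>S. f a k) \<oplus> (\<Oplus>j\<in>S. \<Oplus>k\<in>insert a S - {j}. f j k)"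
      using insert.hyps c by (subst finsum_insert) (auto intro!: finsum_closed)
    also have "(\<Oplus>j\<in>S. \<Oplus>k\<in>insert a S - {j}. f j k) = (\<Oplus>j\<in>S. f j a \<oplus> (\<Oplus>k\<in>S - {j}. f j k))"
      using inner sums c insert.hyps(2) by (intro finsum_cong') (auto intro!: a_closed)
    also have "\<dots> = (\<Oplus>j\<in>S. f j a) \<oplus> (\<Oplus>j\<in>S. \<Oplus>k\<in>S - {j}. f j k)"
      using sums c insert.hyps(2) by (intro finsum_addf) auto
    also have "(\<Oplus>j\<in>S. \<Oplus>k\<in>S - {j}. f j k) = \<zero>"
      using insert.IH insert.prems by blast
    also have "(\<Oplus>j\<in>S. f j a) = (\<Oplus>j\<in>S. \<ominus> f a j)"
    proof (intro finsum_cong' refl)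
      show "(\<lambda>j. \<ominus> f a j) \<in> S \<rightarrow> carrier R" using c insert.hyps(2) by auto
      show "f j a = \<ominus> f a j" if "j \<in> S" for j
        using that insert.hyps(2) insert.prems by (intro anti) auto
    qed
    also have "\<dots> = \<ominus> (\<Oplus>j\<in>S. f a j)" using c insert.hyps(2) by (intro finsum_uminus) auto
    also have "(\<Oplus>k\<in>S. f a k) \<in> carrier R" using c insert.hyps(2) by (intro finsum_closed) auto
    hence "(\<Oplus>k\<in>S. f a k) \<oplus> (\<ominus> (\<Oplus>j\<in>S. f a j) \<oplus> \<zero>) = \<zero>" by (simp add: r_neg)
    finally show ?case .
  qed
  thus ?thesis using assms(1) by blast
qed

text \<open>The sign of \<open>e\<^sub>j \<and> e\<^bsub>S - {j}\<^esub>\<close> relative to \<open>e\<^sub>S\<close> in the exterior algebra.\<close>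

definition (in ring) koszul_sign :: "nat \<Rightarrow> nat set \<Rightarrow> 'a" where
  "koszul_sign j S = (if even (card {l \<in> S. l < j}) then \<one> else \<ominus> \<one>)"

context cring begin

lemma koszul_sign_closed [simp]: "koszul_sign j S \<in> carrier R"
  unfolding koszul_sign_def by simp

lemma koszul_sign_sq [simp]: "koszul_sign j S \<otimes> koszul_sign j S = \<one>"
  unfolding koszul_sign_def by (simp add: l_minus r_minus)

lemma koszul_sign_antisym_less:
  assumes "finite S" "j \<in> S" "k \<in> S" "j < k"
  shows "koszul_sign j S \<otimes> koszul_sign k (S - {j}) = \<ominus> (koszul_sign k S \<otimes> koszul_sign j (S - {k}))"
proof -
  have "{l \<in> S - {j}. l < k} = {l \<in> S. l < k} - {j}" by blast
  moreover have "j \<in> {l \<in> S. l < k}" "finite {l \<in> S. l < k}" using assms by auto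
  ultimately have "card {l \<in> S. l < k} = Suc (card {l \<in> S - {j}. l < k})"
    by (metis card_Suc_Diff1)
  moreover have "{l \<in> S - {k}. l < j} = {l \<in> S. l < j}" using assms(4) by auto
  ultimately show ?thesis unfolding koszul_sign_def by (auto simp: l_minus r_minus)
qed

lemma koszul_sign_antisym:
  assumes "finite S" "j \<in> S" "k \<in> S" "j \<noteq> k"
  shows "koszul_sign j S \<otimes> koszul_sign k (S - {j}) = \<ominus> (koszul_sign k S \<otimes> koszul_sign j (S - {k}))"
  using koszul_sign_antisym_less[OF assms(1-3)] koszul_sign_antisym_less[OF assms(1,3,2)] assms(4)
  by (cases "j < k") auto

end

section \<open>The Koszul complex inside a minimal resolution\<close>

context minimal_resolution begin

lemma D_carrier: "\<lbrakk>j \<in> T (Suc k); i \<in> T k\<rbrakk> \<Longrightarrow> D k j i \<in> carrier R"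
  using D_max_ideal mem_max_ideal_carrier by blast

definition gen :: "nat \<Rightarrow> 'a" where "gen j = D 0 j 0"

lemma gen_max_ideal: "j \<in> T (Suc 0) \<Longrightarrow> gen j \<in> max_ideal R"
  unfolding gen_def using D_max_ideal[of j 0 0] T_0 by simp

lemma gen_carrier: "j \<in> T (Suc 0) \<Longrightarrow> gen j \<in> carrier R"
  using gen_max_ideal mem_max_ideal_carrier by blast

definition koszul_boundary :: "(nat set \<Rightarrow> nat \<Rightarrow> 'a) \<Rightarrow> nat set \<Rightarrow> nat \<Rightarrow> 'a" where
  "koszul_boundary f S l = (\<Oplus>j\<in>S. koszul_sign j S \<otimes> gen j \<otimes> f (S - {j}) l)"

text \<open>\<open>f S\<close> is the image of the basis element \<open>e\<^sub>S\<close> of the Koszul complex on \<open>gen\<close> under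
  a morphism of complexes to the resolution, in degrees up to \<open>n\<close>.\<close>

definition koszul_lift :: "nat \<Rightarrow> (nat set \<Rightarrow> nat \<Rightarrow> 'a) \<Rightarrow> bool" where
  "koszul_lift n f \<longleftrightarrow> f {} = (\<lambda>_. \<one>) \<and> (\<forall>S \<subseteq> T (Suc 0). card S \<le> n \<longrightarrow> f S \<in> T (card S) \<rightarrow> carrier R \<and>
     (\<forall>k. card S = Suc k \<longrightarrow> (\<forall>l\<in>T k. lincomb (T (Suc k)) (f S) (D k) l = koszul_boundary f S l)))"

lemma koszul_liftD:
  assumes "koszul_lift n f" "S \<subseteq> T (Suc 0)" "card S \<le> n"
  shows "l \<in> T (card S) \<Longrightarrow> f S l \<in> carrier R"
    "\<lbrakk>card S = Suc k; l \<in> T k\<rbrakk> \<Longrightarrow> lincomb (T (Suc k)) (f S) (D k) l = koszul_boundary f S l"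
  using assms unfolding koszul_lift_def by auto

lemma koszul_lift_0: "koszul_lift 0 (\<lambda>_ _. \<one>)"
  unfolding koszul_lift_def by auto

lemma finite_subset_T: "S \<subseteq> T (Suc 0) \<Longrightarrow> finite S"
  using finite_T finite_subset by blast

lemma koszul_boundary_closed:
  assumes f: "koszul_lift n f" and S: "S \<subseteq> T (Suc 0)" "card S = Suc k" "k \<le> n" and l: "l \<in> T k"
  shows "koszul_boundary f S l \<in> carrier R"
proof -
  have "f (S - {j}) l \<in> carrier R" if "j \<in> S" for j
  proof -
    have "card (S - {j}) = k" using that S finite_subset_T by simp
    thus ?thesis using koszul_liftD(1)[OF f, of "S - {j}" l] S l by auto
  qed
  thus ?thesis unfolding koszul_boundary_def using gen_carrier S(1) by (intro finsum_closed) auto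
qed

text \<open>The square of the Koszul differential vanishes: removing \<open>j\<close> and \<open>i\<close> in either order gives the same term with
  opposite signs.\<close>

lemma koszul_boundary_boundary:
  assumes f: "koszul_lift (Suc k) f" and S: "S \<subseteq> T (Suc 0)" "card S = Suc (Suc k)" and l: "l \<in> T k"
  shows "lincomb (T (Suc k)) (koszul_boundary f S) (D k) l = \<zero>"
proof -
  note fS = finite_subset_T[OF S(1)]
  have S1: "S - {j} \<subseteq> T (Suc 0)" "card (S - {j}) = Suc k" if "j \<in> S" for j using that S fS by auto
  have S2: "S - {j} - {i} \<subseteq> T (Suc 0)" "card (S - {j} - {i}) = k" if "j \<in> S" "i \<in> S" "i \<noteq> j" for i j
    using that S fS by auto
  have f1: "f (S - {j}) t \<in> carrier R" if "j \<in> S" "t \<in> T (Suc k)" for j t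
    using koszul_liftD(1)[OF f S1(1)[OF that(1)]] S1(2)[OF that(1)] that(2) by simp
  have f2: "f (S - {j} - {i}) l \<in> carrier R" if "j \<in> S" "i \<in> S" "i \<noteq> j" for i j
    using koszul_liftD(1)[OF f S2(1)[OF that]] S2(2)[OF that] l by simp
  have g: "gen j \<in> carrier R" if "j \<in> S" for j using that S gen_carrier by blast
  define h where "h j i = koszul_sign j S \<otimes> gen j \<otimes> (koszul_sign i (S - {j}) \<otimes> gen i \<otimes> f (S - {j} - {i}) l)" for j i
  have "lincomb (T (Suc k)) (koszul_boundary f S) (D k) l
      = (\<Oplus>j\<in>S. lincomb (T (Suc k)) (\<lambda>t. koszul_sign j S \<otimes> gen j \<otimes> f (S - {j}) t) (D k) l)"
    unfolding koszul_boundary_def using f1 g D_carrier l fS finite_T by (intro lincomb_finsum) auto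
  also have "\<dots> = (\<Oplus>j\<in>S. \<Oplus>i\<in>S - {j}. h j i)"
  proof (intro finsum_cong' refl)
    show "(\<lambda>j. \<Oplus>i\<in>S - {j}. h j i) \<in> S \<rightarrow> carrier R"
      unfolding h_def using f2 g by (auto intro!: finsum_closed)
    fix j assume j: "j \<in> S"
    have "lincomb (T (Suc k)) (\<lambda>t. koszul_sign j S \<otimes> gen j \<otimes> f (S - {j}) t) (D k) l
        = koszul_sign j S \<otimes> gen j \<otimes> lincomb (T (Suc k)) (f (S - {j})) (D k) l"
      using j f1 g D_carrier l finite_T by (intro lincomb_smult) auto
    also have "lincomb (T (Suc k)) (f (S - {j})) (D k) l = koszul_boundary f (S - {j}) l"
      using koszul_liftD(2)[OF f S1(1)[OF j]] S1(2)[OF j] l by simp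
    also have "koszul_sign j S \<otimes> gen j \<otimes> \<dots> = (\<Oplus>i\<in>S - {j}. h j i)"
      unfolding koszul_boundary_def h_def using j f2 g fS by (intro finsum_rdistr) auto
    finally show "lincomb (T (Suc k)) (\<lambda>t. koszul_sign j S \<otimes> gen j \<otimes> f (S - {j}) t) (D k) l = (\<Oplus>i\<in>S - {j}. h j i)" .
  qed
  also have "\<dots> = \<zero>"
  proof (rule finsum_antisymmetric[OF fS])
    fix j i assume ji: "j \<in> S" "i \<in> S" "j \<noteq> i"
    show "h j i \<in> carrier R" unfolding h_def using ji f2 g by auto
    let ?e = "f (S - {j} - {i}) l"
    have "S - {i} - {j} = S - {j} - {i}" by blast
    hence fe: "f (S - {i} - {j}) l = ?e" by simp
    have c: "gen i \<in> carrier R" "gen j \<in> carrier R" "?e \<in> carrier R" using ji f2 g by auto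
    have "h j i = (koszul_sign j S \<otimes> koszul_sign i (S - {j})) \<otimes> (gen i \<otimes> gen j \<otimes> ?e)"
      unfolding h_def using c by (simp add: m_ac)
    also have "\<dots> = \<ominus> ((koszul_sign i S \<otimes> koszul_sign j (S - {i})) \<otimes> (gen i \<otimes> gen j \<otimes> ?e))"
      unfolding koszul_sign_antisym[OF fS ji] using c by (simp add: l_minus)
    also have "(koszul_sign i S \<otimes> koszul_sign j (S - {i})) \<otimes> (gen i \<otimes> gen j \<otimes> ?e) = h i j"
      unfolding h_def fe using c by (simp add: m_ac)
    finally show "h j i = \<ominus> h i j" .
  qed
  finally show ?thesis .
qed

text \<open>The image of \<open>e\<^sub>S\<close> is found from the image of its boundary, which is a cycle, by exactness of the resolution.\<close>

lemma exists_koszul_lift: "\<exists>f. koszul_lift n f"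
proof (induction n)
  case 0
  thus ?case using koszul_lift_0 by blast
next
  case (Suc n)
  then obtain f where f: "koszul_lift n f" by blast
  have "\<exists>e \<in> T (Suc n) \<rightarrow> carrier R. \<forall>l\<in>T n. lincomb (T (Suc n)) e (D n) l = koszul_boundary f S l"
    if S: "S \<subseteq> T (Suc 0)" "card S = Suc n" for S
  proof (cases n)
    case 0
    then obtain j where j: "S = {j}" using S(2) by (auto simp: card_1_singleton_iff)
    have jT: "j \<in> T (Suc 0)" using S(1) j by simp
    have f0: "f {} = (\<lambda>_. \<one>)" using f unfolding koszul_lift_def by blast
    have "{l \<in> {j}. l < j} = {}" by auto
    hence "koszul_sign j {j} = \<one>" unfolding koszul_sign_def by (simp only: card.empty even_zero if_True)
    hence "koszul_boundary f S 0 = gen j"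
      unfolding koszul_boundary_def j using gen_carrier[OF jT] f0 by simp
    thus ?thesis using exact_0[OF gen_max_ideal[OF jT]] T_0 0 by auto
  next
    case (Suc k)
    have "\<exists>e \<in> T (Suc (Suc k)) \<rightarrow> carrier R. \<forall>j \<in> T (Suc k).
        koszul_boundary f S j = lincomb (T (Suc (Suc k))) e (D (Suc k)) j"
    proof (rule exact_Suc)
      show "koszul_boundary f S \<in> T (Suc k) \<rightarrow> carrier R"
        using koszul_boundary_closed[OF f S(1), of "Suc k"] S(2) Suc by auto
      show "lincomb (T (Suc k)) (koszul_boundary f S) (D k) i = \<zero>" if "i \<in> T k" for i
        using koszul_boundary_boundary[OF _ S(1) _ that, of f] f S(2) Suc by simp
    qed
    thus ?thesis unfolding Suc by auto
  qed
  then obtain e where e: "\<And>S. \<lbrakk>S \<subseteq> T (Suc 0); card S = Suc n\<rbrakk> \<Longrightarrow> e S \<in> T (Suc n) \<rightarrow> carrier R"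
    "\<And>S l. \<lbrakk>S \<subseteq> T (Suc 0); card S = Suc n; l \<in> T n\<rbrakk> \<Longrightarrow> lincomb (T (Suc n)) (e S) (D n) l = koszul_boundary f S l"
    by metis
  define f' where "f' S = (if card S = Suc n then e S else f S)" for S
  have f'_boundary: "koszul_boundary f' S l = koszul_boundary f S l"
    if S: "S \<subseteq> T (Suc 0)" "card S = Suc k" "k \<le> n" and l: "l \<in> T k" for S k l
  proof -
    have card: "card (S - {j}) = k" if "j \<in> S" for j using that S finite_subset_T by simp
    have "f' (S - {j}) = f (S - {j})" if "j \<in> S" for j using card[OF that] S(3) unfolding f'_def by simp
    moreover have "f (S - {j}) l \<in> carrier R" if "j \<in> S" for j
      using koszul_liftD(1)[OF f, of "S - {j}" l] card[OF that] S l by auto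
    ultimately show ?thesis
      unfolding koszul_boundary_def using gen_carrier S(1) by (intro finsum_cong') auto
  qed
  have "koszul_lift (Suc n) f'"
    unfolding koszul_lift_def
  proof (intro conjI allI impI ballI)
    show "f' {} = (\<lambda>_. \<one>)" using f unfolding koszul_lift_def f'_def by simp
  next
    fix S assume S: "S \<subseteq> T (Suc 0)" "card S \<le> Suc n"
    show "f' S \<in> T (card S) \<rightarrow> carrier R"
      using e(1)[OF S(1)] koszul_liftD(1)[OF f S(1)] S(2) unfolding f'_def by auto
    fix k l assume k: "card S = Suc k" and l: "l \<in> T k"
    have "lincomb (T (Suc k)) (f' S) (D k) l = koszul_boundary f S l"
      using e(2)[OF S(1)] koszul_liftD(2)[OF f S(1) _ k l] S(2) k l unfolding f'_def by auto
    thus "lincomb (T (Suc k)) (f' S) (D k) l = koszul_boundary f' S l"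
      using f'_boundary[OF S(1) k _ l] S(2) k by simp
  qed
  thus ?case by blast
qed

text \<open>An element of the square of the maximal ideal is a combination of the generators with coefficients in the
  maximal ideal. The representation is what matters: it can be compared with another one by means of minimality.\<close>

lemma lincomb_max_ideal_sq:
  assumes "finite S" "\<And>s. s \<in> S \<Longrightarrow> a s \<in> max_ideal R" "\<And>s. s \<in> S \<Longrightarrow> b s \<in> max_ideal R"
  shows "\<exists>\<beta> \<in> T (Suc 0) \<rightarrow> max_ideal R. (\<Oplus>s\<in>S. a s \<otimes> b s) = lincomb (T (Suc 0)) \<beta> (D 0) 0"
  using assms
proof (induction S rule: finite_induct)
  case empty
  have "lincomb (T (Suc 0)) (\<lambda>_. \<zero>) (D 0) 0 = \<zero>"
    unfolding lincomb_def using D_carrier[of _ 0 0] T_0 by (intro add.finprod_one_eqI) auto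
  thus ?case using ideal_zero[OF max_ideal_ideal] by (intro bexI[of _ "\<lambda>_. \<zero>"]) auto
next
  case (insert s S)
  have D0: "j \<in> T (Suc 0) \<Longrightarrow> D 0 j 0 \<in> carrier R" for j using D_carrier[of j 0 0] T_0 by simp
  obtain \<beta> where b: "\<beta> \<in> T (Suc 0) \<rightarrow> max_ideal R" "(\<Oplus>s\<in>S. a s \<otimes> b s) = lincomb (T (Suc 0)) \<beta> (D 0) 0"
    using insert by auto
  obtain c where c: "c \<in> T (Suc 0) \<rightarrow> carrier R" "b s = lincomb (T (Suc 0)) c (D 0) 0"
    using exact_0[of "b s"] insert.prems by auto
  have as: "a s \<in> max_ideal R" "a s \<in> carrier R" using insert.prems mem_max_ideal_carrier by auto
  have bc: "\<And>j. j \<in> T (Suc 0) \<Longrightarrow> \<beta> j \<in> carrier R" using b(1) mem_max_ideal_carrier by auto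
  have "(\<Oplus>s\<in>insert s S. a s \<otimes> b s) = a s \<otimes> b s \<oplus> (\<Oplus>s\<in>S. a s \<otimes> b s)"
    using insert mem_max_ideal_carrier by (intro finsum_insert) auto
  also have "a s \<otimes> b s = lincomb (T (Suc 0)) (\<lambda>j. a s \<otimes> c j) (D 0) 0"
    unfolding c(2) using c(1) as D0 finite_T by (intro lincomb_smult[symmetric]) auto
  also have "lincomb (T (Suc 0)) (\<lambda>j. a s \<otimes> c j) (D 0) 0 \<oplus> (\<Oplus>s\<in>S. a s \<otimes> b s)
      = lincomb (T (Suc 0)) (\<lambda>j. a s \<otimes> c j \<oplus> \<beta> j) (D 0) 0"
    unfolding b(2) using c(1) as D0 bc by (intro lincomb_add[symmetric]) auto
  finally have eq: "(\<Oplus>s\<in>insert s S. a s \<otimes> b s) = lincomb (T (Suc 0)) (\<lambda>j. a s \<otimes> c j \<oplus> \<beta> j) (D 0) 0" .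
  have "a s \<otimes> c j \<oplus> \<beta> j \<in> max_ideal R" if "j \<in> T (Suc 0)" for j
    using that b(1) c(1) as by (intro ideal_add[OF max_ideal_ideal] ideal_rmult[OF max_ideal_ideal]) auto
  thus ?case using eq by (intro bexI[of _ "\<lambda>j. a s \<otimes> c j \<oplus> \<beta> j"]) auto
qed

text \<open>The indices \<open>S\<close> of the basis elements \<open>e\<^sub>S\<close> of degree \<open>i\<close> of the Koszul complex.\<close>

definition faces :: "nat \<Rightarrow> nat set set" where
  "faces i = {S. S \<subseteq> T (Suc 0) \<and> card S = i}"

lemma finite_faces: "finite (faces i)"
  by (rule finite_subset[of _ "Pow (T (Suc 0))"]) (auto simp: faces_def finite_T)

lemma faces_containing:
  assumes "j \<in> T (Suc 0)"
  shows "{S \<in> faces (Suc i). j \<in> S} = insert j ` {U \<in> faces i. j \<notin> U}"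
proof (intro equalityI subsetI)
  fix S assume "S \<in> {S \<in> faces (Suc i). j \<in> S}"
  hence S: "S \<subseteq> T (Suc 0)" "card S = Suc i" "j \<in> S" unfolding faces_def by auto
  hence "S - {j} \<in> {U \<in> faces i. j \<notin> U}" "S = insert j (S - {j})"
    using finite_subset_T unfolding faces_def by auto
  thus "S \<in> insert j ` {U \<in> faces i. j \<notin> U}" by blast
next
  fix S assume "S \<in> insert j ` {U \<in> faces i. j \<notin> U}"
  thus "S \<in> {S \<in> faces (Suc i). j \<in> S}"
    using assms finite_subset_T unfolding faces_def by auto
qed

text \<open>Serre's argument that the Koszul complex embeds into the minimal resolution modulo the maximal ideal. Let
  \<open>\<Sum> z\<^sub>S f\<^sub>S \<in> \<mm> F\<^bsub>i + 1\<^esub>\<close>. The boundary of the left side lies in \<open>\<mm>\<^sup>2 F\<^sub>i\<close> because the matrix has entries in \<open>\<mm>\<close>. Written out, the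
  boundary is \<open>\<Sum> x\<^sub>j \<alpha>\<^sub>j\<close>, where \<open>x\<^sub>j\<close> is \<open>gen j\<close> and \<open>\<alpha>\<^sub>j = \<Sum> \<plusminus> z\<^bsub>U \<union> {j}\<^esub> f\<^sub>U\<close>, the sum extending over the \<open>U\<close> that do not contain \<open>j\<close>.
  As the \<open>x\<^sub>j\<close> are minimal generators of \<open>\<mm>\<close>, all \<open>\<alpha>\<^sub>j\<close> vanish modulo \<open>\<mm>\<close>, and the claim in degree \<open>i\<close> applies to them.\<close>

lemma koszul_independent:
  assumes f: "koszul_lift n f" and "i \<le> n" "\<And>S. S \<in> faces i \<Longrightarrow> z S \<in> carrier R"
    "\<And>l. l \<in> T i \<Longrightarrow> lincomb (faces i) z f l \<in> max_ideal R" "S \<in> faces i"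
  shows "z S \<in> max_ideal R"
  using assms(2-)
proof (induction i arbitrary: z S)
  case 0
  have F: "faces 0 = {{}}" unfolding faces_def using finite_subset_T by auto
  have f0: "f {} = (\<lambda>_. \<one>)" using f unfolding koszul_lift_def by blast
  have "lincomb (faces 0) z f 0 = z {}"
    unfolding lincomb_def F using 0(2)[of "{}"] f0 F by simp
  thus ?case using 0(3)[of 0] 0(4) F T_0 by simp
next
  case (Suc i)
  let ?X = "T (Suc 0)"
  have fc: "f S l \<in> carrier R" if "S \<in> faces k" "k \<le> n" "l \<in> T k" for S k l
    using koszul_liftD(1)[OF f, of S l] that unfolding faces_def by auto
  define z' where "z' j U = (if j \<in> U then \<zero> else z (insert j U) \<otimes> koszul_sign j (insert j U))" for j U
  have insert_face: "insert j U \<in> faces (Suc i)" if "j \<in> ?X" "U \<in> faces i" "j \<notin> U" for j U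
    using that finite_subset_T unfolding faces_def by auto
  have z'c: "z' j U \<in> carrier R" if "j \<in> ?X" "U \<in> faces i" for j U
    unfolding z'_def using insert_face[OF that] Suc.prems(2) by auto
  have z'M: "z' j U \<in> max_ideal R" if j: "j \<in> ?X" and U: "U \<in> faces i" for j U
  proof (rule Suc.IH[OF _ z'c[OF j] _ U])
    show "i \<le> n" using Suc.prems(1) by simp
    fix l assume l: "l \<in> T i"
    define \<alpha> where "\<alpha> j = lincomb (faces i) (z' j) f l" for j
    have \<alpha>c: "\<alpha> j \<in> carrier R" if "j \<in> ?X" for j
      unfolding \<alpha>_def using z'c[OF that] fc[OF _ _ l] Suc.prems(1) by (intro lincomb_closed) auto
    define V where "V t = lincomb (faces (Suc i)) z f t" for t
    have V: "V t \<in> max_ideal R" if "t \<in> T (Suc i)" for t unfolding V_def by (rule Suc.prems(3)[OF that])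
    obtain \<beta> where \<beta>: "\<beta> \<in> ?X \<rightarrow> max_ideal R" "lincomb (T (Suc i)) V (D i) l = lincomb ?X \<beta> (D 0) 0"
      using lincomb_max_ideal_sq[of "T (Suc i)" V "\<lambda>t. D i t l"] V D_max_ideal[OF _ l] finite_T
      unfolding lincomb_def by auto
    \<comment> \<open>the boundary, ordered by the generators \<open>x\<^sub>j\<close> instead of by the faces \<open>S\<close>\<close>
    define H where "H S j = z S \<otimes> (koszul_sign j S \<otimes> gen j \<otimes> f (S - {j}) l)" for S j
    have Hc: "H S j \<in> carrier R" if "S \<in> faces (Suc i)" "j \<in> S" for S j
    proof -
      have "S - {j} \<in> faces i" "j \<in> ?X" using that finite_subset_T unfolding faces_def by auto
      thus ?thesis unfolding H_def using fc[OF _ _ l] gen_carrier Suc.prems(1,2) that(1) by auto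
    qed
    have "lincomb (T (Suc i)) V (D i) l
        = (\<Oplus>S\<in>faces (Suc i). lincomb (T (Suc i)) (\<lambda>t. z S \<otimes> f S t) (D i) l)"
      unfolding V_def lincomb_def[of "faces (Suc i)"]
      using Suc.prems(1,2) fc D_carrier[OF _ l] finite_T finite_faces by (intro lincomb_finsum) auto
    also have "\<dots> = (\<Oplus>S\<in>faces (Suc i). \<Oplus>j\<in>?X. if j \<in> S then H S j else \<zero>)"
    proof (intro finsum_cong' refl)
      show "(\<lambda>S. \<Oplus>j\<in>?X. if j \<in> S then H S j else \<zero>) \<in> faces (Suc i) \<rightarrow> carrier R"
        using Hc by (auto intro!: finsum_closed)
      fix S assume S: "S \<in> faces (Suc i)"
      hence S': "S \<subseteq> ?X" "card S = Suc i" unfolding faces_def by auto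
      have "lincomb (T (Suc i)) (\<lambda>t. z S \<otimes> f S t) (D i) l = z S \<otimes> lincomb (T (Suc i)) (f S) (D i) l"
        using S Suc.prems(1,2) fc D_carrier[OF _ l] finite_T by (intro lincomb_smult) auto
      also have "lincomb (T (Suc i)) (f S) (D i) l = koszul_boundary f S l"
        using koszul_liftD(2)[OF f S'(1) _ S'(2) l] S'(2) Suc.prems(1) by simp
      also have "z S \<otimes> koszul_boundary f S l = (\<Oplus>j\<in>S. H S j)"
      proof -
        have "S - {j} \<in> faces i" "j \<in> ?X" if "j \<in> S" for j
          using that S' finite_subset_T unfolding faces_def by auto
        thus ?thesis
          unfolding H_def koszul_boundary_def using S Suc.prems(1,2) fc[OF _ _ l] gen_carrier finite_subset_T[OF S'(1)]
          by (intro finsum_rdistr) auto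
      qed
      also have "\<dots> = (\<Oplus>j\<in>?X. if j \<in> S then H S j else \<zero>)"
      proof -
        have "S = {j \<in> ?X. j \<in> S}" using S'(1) by blast
        thus ?thesis using finsum_filter[of ?X "\<lambda>j. j \<in> S" "H S"] Hc[OF S] finite_T by simp
      qed
      finally show "lincomb (T (Suc i)) (\<lambda>t. z S \<otimes> f S t) (D i) l = (\<Oplus>j\<in>?X. if j \<in> S then H S j else \<zero>)" .
    qed
    also have "\<dots> = (\<Oplus>j\<in>?X. \<Oplus>S\<in>faces (Suc i). if j \<in> S then H S j else \<zero>)"
      using Hc finite_T finite_faces by (intro finsum_swap) auto
    also have "\<dots> = lincomb ?X \<alpha> (D 0) 0"
      unfolding lincomb_def
    proof (intro finsum_cong' refl)
      show "(\<lambda>j. \<alpha> j \<otimes> D 0 j 0) \<in> ?X \<rightarrow> carrier R" using \<alpha>c gen_carrier unfolding gen_def by auto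
      fix j assume j: "j \<in> ?X"
      have "(\<Oplus>S\<in>faces (Suc i). if j \<in> S then H S j else \<zero>) = (\<Oplus>S\<in>{S \<in> faces (Suc i). j \<in> S}. H S j)"
        using Hc finite_faces by (intro finsum_filter) auto
      also have "\<dots> = (\<Oplus>U\<in>{U \<in> faces i. j \<notin> U}. H (insert j U) j)"
        unfolding faces_containing[OF j]
      proof (rule finsum_reindex)
        show "(\<lambda>S. H S j) \<in> insert j ` {U \<in> faces i. j \<notin> U} \<rightarrow> carrier R"
          using Hc insert_face[OF j] by auto
        show "inj_on (insert j) {U \<in> faces i. j \<notin> U}" by (intro inj_onI) (auto simp: insert_ident)
      qed
      also have "\<dots> = (\<Oplus>U\<in>faces i. if j \<notin> U then H (insert j U) j else \<zero>)"
        using Hc insert_face[OF j] finite_faces by (intro finsum_filter[symmetric]) auto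
      also have "\<dots> = (\<Oplus>U\<in>faces i. z' j U \<otimes> f U l \<otimes> gen j)"
      proof (intro finsum_cong' refl)
        show "(\<lambda>U. z' j U \<otimes> f U l \<otimes> gen j) \<in> faces i \<rightarrow> carrier R"
          using z'c[OF j] fc[OF _ _ l] gen_carrier[OF j] Suc.prems(1) by auto
        fix U assume U: "U \<in> faces i"
        show "(if j \<notin> U then H (insert j U) j else \<zero>) = z' j U \<otimes> f U l \<otimes> gen j"
        proof (cases "j \<in> U")
          case False
          hence "insert j U - {j} = U" by auto
          moreover have "z (insert j U) \<in> carrier R" "f U l \<in> carrier R"
            using insert_face[OF j U False] Suc.prems(1,2) fc[OF U _ l] by auto
          ultimately show ?thesis unfolding H_def z'_def using False gen_carrier[OF j] by (simp add: m_ac)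
        qed (use fc[OF U _ l] gen_carrier[OF j] Suc.prems(1) in \<open>auto simp: z'_def\<close>)
      qed
      also have "\<dots> = \<alpha> j \<otimes> D 0 j 0"
        unfolding \<alpha>_def lincomb_def gen_def[symmetric]
        using z'c[OF j] fc[OF _ _ l] gen_carrier[OF j] Suc.prems(1) finite_faces
        by (intro finsum_ldistr[symmetric]) auto
      finally show "(\<Oplus>S\<in>faces (Suc i). if j \<in> S then H S j else \<zero>) = \<alpha> j \<otimes> D 0 j 0" .
    qed
    finally have eq: "lincomb ?X \<alpha> (D 0) 0 = lincomb ?X \<beta> (D 0) 0" using \<beta>(2) by simp
    have D0: "D 0 j 0 \<in> carrier R" if "j \<in> ?X" for j using gen_carrier[OF that] unfolding gen_def .
    have \<beta>c: "\<beta> j \<in> carrier R" if "j \<in> ?X" for j using \<beta>(1) that mem_max_ideal_carrier by auto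
    \<comment> \<open>by minimality, a relation among the generators has coefficients in the maximal ideal\<close>
    have "lincomb ?X (\<lambda>j. \<alpha> j \<ominus> \<beta> j) (D 0) 0 = \<zero>"
      using \<alpha>c \<beta>c D0 finite_T eq lincomb_closed[of ?X \<beta> "D 0" 0] by (subst lincomb_diff) auto
    then obtain e where e: "e \<in> T (Suc (Suc 0)) \<rightarrow> carrier R"
      "\<And>j. j \<in> ?X \<Longrightarrow> \<alpha> j \<ominus> \<beta> j = lincomb (T (Suc (Suc 0))) e (D (Suc 0)) j"
      using exact_Suc[of "\<lambda>j. \<alpha> j \<ominus> \<beta> j" 0] \<alpha>c \<beta>c T_0 by auto
    have "\<alpha> j \<ominus> \<beta> j \<in> max_ideal R"
      unfolding e(2)[OF j] using e(1) D_max_ideal[OF _ j] by (intro lincomb_mem_ideal' max_ideal_ideal) auto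
    hence "\<alpha> j \<in> max_ideal R"
      using \<beta>(1) j by (intro ideal_diff_cancel[OF max_ideal_ideal _ _ \<alpha>c[OF j], of "\<beta> j"]) auto
    thus "lincomb (faces i) (z' j) f l \<in> max_ideal R" unfolding \<alpha>_def .
  qed
  have S: "S \<subseteq> ?X" "card S = Suc i" using Suc.prems(4) unfolding faces_def by auto
  then obtain j where j: "j \<in> S" by (metis card_gt_0_iff ex_in_conv zero_less_Suc)
  let ?U = "S - {j}"
  have U: "?U \<in> faces i" "insert j ?U = S" "j \<in> ?X"
    using S j finite_subset_T unfolding faces_def by auto
  have "z S \<otimes> koszul_sign j S \<in> max_ideal R"
    using z'M[OF U(3,1)] U(2) unfolding z'_def by simp
  hence "(z S \<otimes> koszul_sign j S) \<otimes> koszul_sign j S \<in> max_ideal R"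
    by (rule ideal_rmult[OF max_ideal_ideal koszul_sign_closed])
  moreover have "(z S \<otimes> koszul_sign j S) \<otimes> koszul_sign j S = z S"
    using Suc.prems(2)[OF Suc.prems(4)] m_assoc[of "z S" "koszul_sign j S" "koszul_sign j S"] by simp
  ultimately show ?case by simp
qed

text \<open>A minimal resolution of the residue field is at least as long as the number of generators of the maximal ideal. If
  \<open>F\<^sub>i\<close> were zero, the hypothesis of independence in degree \<open>i\<close> would hold vacuously, even for unit coefficients.\<close>

theorem T_nonempty:
  assumes "i \<le> card (T (Suc 0))"
  shows "T i \<noteq> {}"
proof
  assume empty: "T i = {}"
  obtain f where f: "koszul_lift i f" using exists_koszul_lift by blast
  obtain S where "S \<subseteq> T (Suc 0)" "card S = i" using obtain_subset_with_card_n[OF assms] by blast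
  hence "S \<in> faces i" unfolding faces_def by blast
  hence "(\<lambda>_. \<one>) S \<in> max_ideal R"
    using empty by (intro koszul_independent[OF f, of i "\<lambda>_. \<one>"]) auto
  thus False using one_notin_max_ideal by simp
qed

end

section \<open>Complexes modulo a regular sequence\<close>

definition regular_sequence :: "('a, 'm) ring_scheme \<Rightarrow> 'a list \<Rightarrow> bool" where
  "regular_sequence R ys \<longleftrightarrow> set ys \<subseteq> carrier R \<and> (\<forall>i<length ys. \<forall>a\<in>carrier R.
     ys ! i \<otimes>\<^bsub>R\<^esub> a \<in> Idl\<^bsub>R\<^esub> (set (take i ys)) \<longrightarrow> a \<in> Idl\<^bsub>R\<^esub> (set (take i ys)))"

text \<open>The ideals generated by the initial segments are prime, and none of the generators is redundant: fewer generators
  would not admit a chain of primes of maximal length.\<close>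

lemma (in noetherian_local_ring) regular_system_of_parameters_regular_sequence:
  assumes ys: "regular_system_of_parameters R ys"
  shows "regular_sequence R ys"
  unfolding regular_sequence_def
proof (intro conjI allI ballI impI)
  have carr: "set ys \<subseteq> carrier R" and dim: "krull_dim R = enat (length ys)" and M: "Idl (set ys) = max_ideal R"
    using ys unfolding regular_system_of_parameters_def by auto
  show "set ys \<subseteq> carrier R" by (rule carr)
  fix i a
  assume i: "i < length ys" and a: "a \<in> carrier R" and ya: "ys ! i \<otimes> a \<in> Idl (set (take i ys))"
  have yc: "ys ! i \<in> carrier R" using carr i by auto
  have "ys ! i \<notin> Idl (set (take i ys))"
  proof
    assume y: "ys ! i \<in> Idl (set (take i ys))"
    let ?zs = "take i ys @ drop (Suc i) ys"
    have zs: "set ?zs \<subseteq> carrier R" using carr set_take_subset[of i ys] set_drop_subset[of "Suc i" ys] by auto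
    note I = genideal_ideal[OF zs] genideal_self[OF zs]
    have "Idl (set (take i ys)) \<subseteq> Idl (set ?zs)" using zs by (intro subset_Idl_subset) auto
    hence "ys ! i \<in> Idl (set ?zs)" using y by blast
    moreover have "set ys = insert (ys ! i) (set ?zs)"
      using id_take_nth_drop[OF i] by (metis Un_insert_right list.simps(15) set_append)
    ultimately have "set ys \<subseteq> Idl (set ?zs)" using I(2) by auto
    hence "max_ideal R \<subseteq> Idl (set ?zs)" unfolding M[symmetric] by (intro genideal_minimal I(1))
    moreover have "Idl (set ?zs) \<subseteq> Idl (set ys)"
      using carr set_take_subset[of i ys] set_drop_subset[of "Suc i" ys] by (intro subset_Idl_subset) auto
    ultimately have "Idl (set ?zs) = max_ideal R" using M by (intro equalityI) simp_all
    moreover have "Idl (insert \<zero> (set ?zs)) = Idl (insert \<zero> (Idl (set ?zs)))"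
      by (rule Idl_insert_Idl[OF zs zero_closed, symmetric])
    moreover have "insert \<zero> (Idl (set ?zs)) = Idl (set ?zs)" using ideal_zero[OF I(1)] by blast
    ultimately have "Idl (insert \<zero> (set ?zs)) = max_ideal R" using Idl_ideal_eq[OF I(1)] by (simp only:)
    hence zsM: "Idl ({\<zero>} \<union> set ?zs) = max_ideal R" by (simp only: insert_is_Un[symmetric])
    obtain P where P: "prime_chain R (length ys) P" using krull_dim_attained[OF dim] .
    have "{\<zero>} \<subseteq> P 0" using ideal_zero[OF primeideal.axioms(1)[OF prime_chainD(1)[OF P, of 0]]] by simp
    hence "length ys \<le> length ?zs"
      by (intro prime_chain_length_le_generators[OF zeroideal zs P _ zsM max_ideal_prime]
          prime_le_max_ideal[OF prime_chainD(1)[OF P]]) auto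
    thus False using i by simp
  qed
  thus "a \<in> Idl (set (take i ys))"
    using primeideal.I_prime[OF regular_system_of_parameters_prime[OF ys, of i] yc a ya] i by auto
qed

text \<open>In terms of derived functors: the \<open>k\<close>-th torsion group against \<open>R / (y\<^sub>1, \<dots>, y\<^sub>j)\<close> vanishes for \<open>k > j\<close>. Put
  \<open>J = (y\<^sub>1, \<dots>, y\<^sub>j)\<close> and \<open>x = y\<^bsub>j + 1\<^esub>\<close>. If the boundary of \<open>z\<close> is \<open>w + x u\<close> with \<open>w\<close> in \<open>J\<close>, then \<open>x\<close> times the boundary of \<open>u\<close>
  lies in \<open>J\<close>, so \<open>u\<close> is a cycle modulo \<open>J\<close>, hence the boundary of some \<open>e\<close> modulo \<open>J\<close>. Now \<open>z - x e\<close> is a cycle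
  modulo \<open>J\<close>, and it is congruent to \<open>z\<close> modulo \<open>x\<close>.\<close>

lemma (in cring) exact_modulo_regular_sequence:
  assumes finite_T: "\<And>k. finite (T k)"
    and D: "\<And>k j i. \<lbrakk>j \<in> T (Suc k); i \<in> T k\<rbrakk> \<Longrightarrow> D k j i \<in> carrier R"
    and complex: "\<And>k l i. \<lbrakk>l \<in> T (Suc (Suc k)); i \<in> T k\<rbrakk> \<Longrightarrow> lincomb (T (Suc k)) (D (Suc k) l) (D k) i = \<zero>"
    and exact: "\<And>k c. \<lbrakk>c \<in> T (Suc k) \<rightarrow> carrier R; \<And>i. i \<in> T k \<Longrightarrow> lincomb (T (Suc k)) c (D k) i = \<zero>\<rbrakk>
       \<Longrightarrow> \<exists>e \<in> T (Suc (Suc k)) \<rightarrow> carrier R. \<forall>j \<in> T (Suc k). c j = lincomb (T (Suc (Suc k))) e (D (Suc k)) j"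
    and ys: "regular_sequence R ys"
    and "j \<le> length ys" "j \<le> k" "z \<in> T (Suc k) \<rightarrow> carrier R"
    and "\<And>l. l \<in> T k \<Longrightarrow> lincomb (T (Suc k)) z (D k) l \<in> Idl (set (take j ys))"
  shows "\<exists>e \<in> T (Suc (Suc k)) \<rightarrow> carrier R. \<forall>l \<in> T (Suc k).
    z l \<ominus> lincomb (T (Suc (Suc k))) e (D (Suc k)) l \<in> Idl (set (take j ys))"
  using assms(6-)
proof (induction j arbitrary: k z)
  case 0
  have "Idl {} = {\<zero>}"
    using genideal_minimal[OF zeroideal, of "{}"] ideal_zero[OF genideal_ideal[of "{}"]] by auto
  hence J0: "Idl (set (take 0 ys)) = {\<zero>}" by simp
  obtain e where e: "e \<in> T (Suc (Suc k)) \<rightarrow> carrier R" "\<And>j. j \<in> T (Suc k) \<Longrightarrow> z j = lincomb (T (Suc (Suc k))) e (D (Suc k)) j"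
    using exact[OF 0(3)] 0(4) unfolding J0 by auto
  have "z l \<ominus> lincomb (T (Suc (Suc k))) e (D (Suc k)) l = \<zero>" if l: "l \<in> T (Suc k)" for l
  proof -
    have "z l \<in> carrier R" using 0(3) l by auto
    thus ?thesis using e(2)[OF l] by simp
  qed
  thus ?case using e(1) unfolding J0 by (intro bexI[of _ e]) auto
next
  case (Suc j)
  then obtain k' where k: "k = Suc k'" "j \<le> k'" by (cases k) auto
  have j: "j < length ys" using Suc.prems(1) by simp
  have ysc: "set ys \<subseteq> carrier R" using ys unfolding regular_sequence_def by blast
  define x where "x = ys ! j"
  have x: "x \<in> carrier R" unfolding x_def using ysc j by auto
  define J where "J = Idl (set (take j ys))"
  have S: "set (take j ys) \<subseteq> carrier R" using ysc set_take_subset[of j ys] by blast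
  have J: "ideal J R" unfolding J_def by (rule genideal_ideal[OF S])
  have J': "Idl (set (take (Suc j) ys)) = Idl (insert x J)"
    using Idl_insert_Idl[OF S x] j unfolding J_def x_def by (simp add: take_Suc_conv_app_nth)
  have reg: "a \<in> J" if "a \<in> carrier R" "x \<otimes> a \<in> J" for a
    using ys that j unfolding regular_sequence_def J_def x_def by blast
  note J_simps = ideal_axioms_mem[OF J]
  have zc: "z t \<in> carrier R" if "t \<in> T (Suc k)" for t using Suc.prems(3) that by auto
  have "\<exists>w u. w \<in> J \<and> u \<in> carrier R \<and> lincomb (T (Suc k)) z (D k) l = w \<oplus> u \<otimes> x" if "l \<in> T k" for l
    using Suc.prems(4)[OF that] unfolding J' Idl_insert[OF J x] by auto
  then obtain w u where wu: "\<And>l. l \<in> T k \<Longrightarrow> w l \<in> J" "\<And>l. l \<in> T k \<Longrightarrow> u l \<in> carrier R"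
    "\<And>l. l \<in> T k \<Longrightarrow> lincomb (T (Suc k)) z (D k) l = w l \<oplus> u l \<otimes> x" by metis
  have wc: "w l \<in> carrier R" if "l \<in> T k" for l using wu(1)[OF that] J_simps(1) by blast
  have "\<exists>e \<in> T (Suc (Suc k')) \<rightarrow> carrier R. \<forall>l \<in> T (Suc k').
      u l \<ominus> lincomb (T (Suc (Suc k'))) e (D (Suc k')) l \<in> Idl (set (take j ys))"
  proof (rule Suc.IH)
    show "j \<le> length ys" "j \<le> k'" "u \<in> T (Suc k') \<rightarrow> carrier R" using j k wu(2) by auto
    fix i assume i: "i \<in> T k'"
    have Dc: "D k' t i \<in> carrier R" if "t \<in> T k" for t using D that i k by simp
    have "lincomb (T k) (\<lambda>t. lincomb (T (Suc k)) z (D k) t) (D k') i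
        = (\<Oplus>s\<in>T (Suc k). lincomb (T k) (\<lambda>t. z s \<otimes> D k s t) (D k') i)"
      unfolding lincomb_def[of "T (Suc k)"] using zc D Dc finite_T by (intro lincomb_finsum) auto
    also have "\<dots> = (\<Oplus>s\<in>T (Suc k). \<zero>)"
    proof (intro finsum_cong' refl)
      fix s assume s: "s \<in> T (Suc k)"
      have "lincomb (T k) (\<lambda>t. z s \<otimes> D k s t) (D k') i = z s \<otimes> lincomb (T k) (D k s) (D k') i"
        using zc s D Dc finite_T by (intro lincomb_smult) auto
      thus "lincomb (T k) (\<lambda>t. z s \<otimes> D k s t) (D k') i = \<zero>" using complex[of s k' i] s i zc[OF s] unfolding k by simp
    qed simp
    also have "\<dots> = \<zero>" by simp
    finally have "lincomb (T k) (\<lambda>t. w t \<oplus> x \<otimes> u t) (D k') i = \<zero>"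
      using lincomb_cong[of "T k" "\<lambda>t. lincomb (T (Suc k)) z (D k) t" "\<lambda>t. w t \<oplus> x \<otimes> u t" "D k'" i "D k'"]
        wu wc x Dc by (simp add: m_comm)
    moreover have "lincomb (T k) (\<lambda>t. w t \<oplus> x \<otimes> u t) (D k') i
        = lincomb (T k) w (D k') i \<oplus> lincomb (T k) (\<lambda>t. x \<otimes> u t) (D k') i"
      using wc wu(2) x Dc by (intro lincomb_add) auto
    moreover have "lincomb (T k) (\<lambda>t. x \<otimes> u t) (D k') i = x \<otimes> lincomb (T k) u (D k') i"
      using wu(2) x Dc finite_T by (intro lincomb_smult) auto
    ultimately have sum: "x \<otimes> lincomb (T k) u (D k') i \<oplus> lincomb (T k) w (D k') i = \<zero>"
      using lincomb_closed[of "T k" w "D k'" i] lincomb_closed[of "T k" u "D k'" i] wc wu(2) x Dc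
      by (simp add: a_comm)
    have "lincomb (T k) w (D k') i \<in> J" using wu(1) Dc by (intro lincomb_mem_ideal[OF J])
    moreover have uc: "lincomb (T k) u (D k') i \<in> carrier R" using wu(2) Dc by (intro lincomb_closed)
    ultimately have "x \<otimes> lincomb (T k) u (D k') i \<in> J"
      using ideal_add_cancel[OF J, of "x \<otimes> lincomb (T k) u (D k') i" "lincomb (T k) w (D k') i"] sum x J_simps(2) by simp
    thus "lincomb (T (Suc k')) u (D k') i \<in> Idl (set (take j ys))"
      using reg[OF uc] unfolding J_def k by simp
  qed
  then obtain e where e: "e \<in> T (Suc k) \<rightarrow> carrier R"
    "\<And>l. l \<in> T k \<Longrightarrow> u l \<ominus> lincomb (T (Suc k)) e (D k) l \<in> J"
    unfolding J_def k by blast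
  have ec: "e t \<in> carrier R" if "t \<in> T (Suc k)" for t using e(1) that by auto
  have "\<exists>e' \<in> T (Suc (Suc k)) \<rightarrow> carrier R. \<forall>l \<in> T (Suc k).
      (z l \<ominus> x \<otimes> e l) \<ominus> lincomb (T (Suc (Suc k))) e' (D (Suc k)) l \<in> Idl (set (take j ys))"
  proof (rule Suc.IH)
    show "j \<le> length ys" "j \<le> k" "(\<lambda>l. z l \<ominus> x \<otimes> e l) \<in> T (Suc k) \<rightarrow> carrier R"
      using Suc.prems(1,2) zc ec x by auto
    fix l assume l: "l \<in> T k"
    have Dc: "D k t l \<in> carrier R" if "t \<in> T (Suc k)" for t using D that l by simp
    have ue: "lincomb (T (Suc k)) e (D k) l \<in> carrier R" using ec Dc by (intro lincomb_closed)
    have "lincomb (T (Suc k)) (\<lambda>l. z l \<ominus> x \<otimes> e l) (D k) l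
        = lincomb (T (Suc k)) z (D k) l \<ominus> x \<otimes> lincomb (T (Suc k)) e (D k) l"
      using zc ec x Dc finite_T by (subst lincomb_diff) (auto simp: lincomb_smult)
    also have "\<dots> = w l \<oplus> x \<otimes> (u l \<ominus> lincomb (T (Suc k)) e (D k) l)"
      unfolding wu(3)[OF l] using wc[OF l] wu(2)[OF l] x ue by algebra
    also have "\<dots> \<in> J" using J_simps(3,6) wu(1)[OF l] x e(2)[OF l] by blast
    finally show "lincomb (T (Suc k)) (\<lambda>l. z l \<ominus> x \<otimes> e l) (D k) l \<in> Idl (set (take j ys))" unfolding J_def .
  qed
  then obtain e' where e': "e' \<in> T (Suc (Suc k)) \<rightarrow> carrier R"
    "\<And>l. l \<in> T (Suc k) \<Longrightarrow> (z l \<ominus> x \<otimes> e l) \<ominus> lincomb (T (Suc (Suc k))) e' (D (Suc k)) l \<in> J"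
    unfolding J_def by blast
  note I = Idl_insert_ideal[OF J x]
  have "z l \<ominus> lincomb (T (Suc (Suc k))) e' (D (Suc k)) l \<in> Idl (set (take (Suc j) ys))" if l: "l \<in> T (Suc k)" for l
  proof -
    let ?v = "lincomb (T (Suc (Suc k))) e' (D (Suc k)) l"
    have v: "?v \<in> carrier R" using e'(1) D l by (intro lincomb_closed) auto
    have "z l \<ominus> ?v = ((z l \<ominus> x \<otimes> e l) \<ominus> ?v) \<oplus> e l \<otimes> x" using v zc[OF l] ec[OF l] x by algebra
    also have "\<dots> \<in> Idl (insert x J)"
      using ideal_add[OF I(1)] ideal_lmult[OF I(1) ec[OF l] I(3)] e'(2)[OF l] I(2) by blast
    finally show ?thesis unfolding J' .
  qed
  thus ?case using e'(1) by blast
qed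

text \<open>Modulo a regular sequence that generates the maximal ideal all boundary maps vanish, so exactness in degree
  \<open>length ys + 1\<close> leaves no room for a basis element.\<close>

lemma (in local_ring) minimal_exact_complex_bounded:
  assumes finite_T: "\<And>k. finite (T k)"
    and D: "\<And>k j i. \<lbrakk>j \<in> T (Suc k); i \<in> T k\<rbrakk> \<Longrightarrow> D k j i \<in> max_ideal R"
    and complex: "\<And>k l i. \<lbrakk>l \<in> T (Suc (Suc k)); i \<in> T k\<rbrakk> \<Longrightarrow> lincomb (T (Suc k)) (D (Suc k) l) (D k) i = \<zero>"
    and exact: "\<And>k c. \<lbrakk>c \<in> T (Suc k) \<rightarrow> carrier R; \<And>i. i \<in> T k \<Longrightarrow> lincomb (T (Suc k)) c (D k) i = \<zero>\<rbrakk>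
       \<Longrightarrow> \<exists>e \<in> T (Suc (Suc k)) \<rightarrow> carrier R. \<forall>j \<in> T (Suc k). c j = lincomb (T (Suc (Suc k))) e (D (Suc k)) j"
    and ys: "regular_sequence R ys" "Idl (set ys) = max_ideal R"
  shows "T (Suc (length ys)) = {}"
proof (rule ccontr)
  let ?d = "length ys"
  assume "T (Suc ?d) \<noteq> {}"
  then obtain t where t: "t \<in> T (Suc ?d)" by blast
  let ?z = "\<lambda>l. if l = t then \<one> else \<zero>"
  have Dc: "\<And>k j i. \<lbrakk>j \<in> T (Suc k); i \<in> T k\<rbrakk> \<Longrightarrow> D k j i \<in> carrier R" using D mem_max_ideal_carrier by blast
  have "\<exists>e \<in> T (Suc (Suc ?d)) \<rightarrow> carrier R. \<forall>l \<in> T (Suc ?d).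
      ?z l \<ominus> lincomb (T (Suc (Suc ?d))) e (D (Suc ?d)) l \<in> Idl (set (take ?d ys))"
  proof (rule exact_modulo_regular_sequence[where T = T and D = D, OF finite_T Dc complex exact ys(1)])
    show "lincomb (T (Suc ?d)) ?z (D ?d) l \<in> Idl (set (take ?d ys))" if l: "l \<in> T ?d" for l
      using lincomb_unit[OF finite_T t, of "D ?d" l] Dc D[OF t l] l ys(2) by simp
  qed auto
  then obtain e where e: "e \<in> T (Suc (Suc ?d)) \<rightarrow> carrier R"
    "\<one> \<ominus> lincomb (T (Suc (Suc ?d))) e (D (Suc ?d)) t \<in> max_ideal R" using t ys(2) by auto
  have "lincomb (T (Suc (Suc ?d))) e (D (Suc ?d)) t \<in> max_ideal R"
    using e(1) D[OF _ t] by (intro lincomb_mem_ideal'[OF max_ideal_ideal]) auto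
  hence "\<one> \<in> max_ideal R" by (rule ideal_diff_cancel[OF max_ideal_ideal e(2) _ one_closed])
  thus False using one_notin_max_ideal by blast
qed

section \<open>Free extensions\<close>

text \<open>Expansions are given by a finite subset of the basis together with coefficients on it, so that the basis itself may be
  infinite.\<close>

locale free_extension = cring B for B :: "('a, 'm) ring_scheme" (structure) +
  fixes A S :: "'a set"
  assumes subring: "subring A B" and S_carrier: "S \<subseteq> carrier B"
    and spanning: "x \<in> carrier B \<Longrightarrow> \<exists>F c. finite F \<and> F \<subseteq> S \<and> c \<in> F \<rightarrow> A \<and> x = (\<Oplus>s\<in>F. c s \<otimes> s)"
    and independent: "\<lbrakk>finite F; F \<subseteq> S; c \<in> F \<rightarrow> A; (\<Oplus>s\<in>F. c s \<otimes> s) = \<zero>; s \<in> F\<rbrakk> \<Longrightarrow> c s = \<zero>"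

lemma (in cring) subring_cring:
  assumes "subring A R" shows "cring (R\<lparr>carrier := A\<rparr>)"
  using subcringI'[OF assms] subcring_iff[OF subringE(1)[OF assms]] by blast

lemma (in cring) finsum_subring:
  assumes A: "subring A R" and f: "\<And>i. i \<in> I \<Longrightarrow> f i \<in> A"
  shows "finsum (R\<lparr>carrier := A\<rparr>) f I = finsum R f I"
proof -
  interpret A: cring "R\<lparr>carrier := A\<rparr>" by (rule subring_cring[OF A])
  have AR: "A \<subseteq> carrier R" using subringE(1)[OF A] .
  show ?thesis
  proof (cases "finite I")
    case True
    thus ?thesis using f
    proof (induction I rule: finite_induct)
      case empty
      show ?case using A.finsum_empty by simp
    next
      case (insert i I)
      have 1: "f \<in> I \<rightarrow> carrier (R\<lparr>carrier := A\<rparr>)" "f i \<in> carrier (R\<lparr>carrier := A\<rparr>)"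
        using insert.prems by auto
      have 2: "f \<in> I \<rightarrow> carrier R" "f i \<in> carrier R" using insert.prems AR by auto
      show ?case using A.finsum_insert[OF insert.hyps 1] finsum_insert[OF insert.hyps 2] insert by simp
    qed
  next
    case False
    thus ?thesis using A.finsum_infinite[of I f] finsum_infinite[of I f] by simp
  qed
qed

lemma (in cring) lincomb_subring:
  assumes A: "subring A R" and "\<And>j. j \<in> T \<Longrightarrow> c j \<in> A" "\<And>j. j \<in> T \<Longrightarrow> D j i \<in> A"
  shows "cring.lincomb (R\<lparr>carrier := A\<rparr>) T c D i = lincomb T c D i"
  unfolding lincomb_def cring.lincomb_def[OF subring_cring[OF A]]
  using finsum_subring[OF A, of T "\<lambda>j. c j \<otimes> D j i"] assms subringE(6)[OF A] by simp

lemma (in cring) lincomb_coordinates: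
  assumes T: "finite T" and F: "finite F" "F \<subseteq> carrier R"
    and c: "\<And>j. j \<in> T \<Longrightarrow> c j = (\<Oplus>s\<in>F. s \<otimes> h s j)" and h: "\<And>j s. \<lbrakk>j \<in> T; s \<in> F\<rbrakk> \<Longrightarrow> h s j \<in> carrier R"
    and D: "\<And>j. j \<in> T \<Longrightarrow> D j i \<in> carrier R"
  shows "lincomb T c D i = (\<Oplus>s\<in>F. lincomb T (h s) D i \<otimes> s)"
proof -
  have sc: "\<And>s. s \<in> F \<Longrightarrow> s \<in> carrier R" using F(2) by blast
  have lc: "lincomb T (h s) D i \<in> carrier R" if "s \<in> F" for s using h D that by (intro lincomb_closed) auto
  have "lincomb T c D i = lincomb T (\<lambda>j. \<Oplus>s\<in>F. s \<otimes> h s j) D i"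
    using c h D sc by (intro lincomb_cong) (auto intro!: finsum_closed)
  also have "\<dots> = (\<Oplus>s\<in>F. lincomb T (\<lambda>j. s \<otimes> h s j) D i)"
    using T F(1) h D sc by (intro lincomb_finsum) auto
  also have "\<dots> = (\<Oplus>s\<in>F. lincomb T (h s) D i \<otimes> s)"
  proof (intro finsum_cong' refl)
    show "(\<lambda>s. lincomb T (h s) D i \<otimes> s) \<in> F \<rightarrow> carrier R" using lc sc by auto
    fix s assume s: "s \<in> F"
    have "lincomb T (\<lambda>j. s \<otimes> h s j) D i = s \<otimes> lincomb T (h s) D i"
      using T h D sc s by (intro lincomb_smult) auto
    thus "lincomb T (\<lambda>j. s \<otimes> h s j) D i = lincomb T (h s) D i \<otimes> s" using sc[OF s] lc[OF s] by (simp add: m_comm)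
  qed
  finally show ?thesis .
qed

context free_extension begin

lemma A_carrier: "a \<in> A \<Longrightarrow> a \<in> carrier B"
  using subringE(1)[OF subring] by blast

lemma A_finsum: "(\<And>i. i \<in> I \<Longrightarrow> f i \<in> A) \<Longrightarrow> finsum B f I \<in> A"
proof -
  interpret A: cring "B\<lparr>carrier := A\<rparr>" by (rule subring_cring[OF subring])
  assume f: "\<And>i. i \<in> I \<Longrightarrow> f i \<in> A"
  hence "finsum (B\<lparr>carrier := A\<rparr>) f I \<in> carrier (B\<lparr>carrier := A\<rparr>)" by (intro A.finsum_closed) auto
  thus ?thesis using finsum_subring[OF subring, of I f] f by simp
qed

lemma independent_eq:
  assumes F: "finite F" "F \<subseteq> S" and "\<And>s. s \<in> F \<Longrightarrow> c s \<in> A" "\<And>s. s \<in> F \<Longrightarrow> d s \<in> A"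
    and eq: "(\<Oplus>s\<in>F. c s \<otimes> s) = (\<Oplus>s\<in>F. d s \<otimes> s)" and s: "s \<in> F"
  shows "c s = d s"
proof -
  have sc: "\<And>s. s \<in> F \<Longrightarrow> s \<in> carrier B" using F(2) S_carrier by blast
  have cd: "\<And>s. s \<in> F \<Longrightarrow> c s \<in> carrier B" "\<And>s. s \<in> F \<Longrightarrow> d s \<in> carrier B" using assms(3,4) A_carrier by auto
  have "lincomb F (\<lambda>s. c s \<ominus> d s) (\<lambda>s _. s) () = \<zero>"
    using F(1) cd sc eq lincomb_closed[of F d "\<lambda>s _. s" "()"]
    by (subst lincomb_diff) (auto simp: lincomb_def)
  moreover have "c s \<ominus> d s \<in> A" if "s \<in> F" for s
    unfolding a_minus_def
    by (rule subringE(7)[OF subring assms(3)[OF that] subringE(5)[OF subring assms(4)[OF that]]])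
  ultimately have "c s \<ominus> d s = \<zero>"
    unfolding lincomb_def by (intro independent[OF F _ _ s, of "\<lambda>s. c s \<ominus> d s"]) auto
  thus ?thesis using cd[OF s] by (simp add: r_right_minus_eq)
qed

lemma common_coordinates:
  assumes "finite U" "U \<subseteq> carrier B"
  obtains F c where "finite F" "F \<subseteq> S" "\<And>x s. \<lbrakk>x \<in> U; s \<in> F\<rbrakk> \<Longrightarrow> c x s \<in> A"
    "\<And>x. x \<in> U \<Longrightarrow> x = (\<Oplus>s\<in>F. c x s \<otimes> s)"
proof -
  define coords where "coords x p \<longleftrightarrow> finite (fst p) \<and> fst p \<subseteq> S \<and> snd p \<in> fst p \<rightarrow> A \<and>
      x = (\<Oplus>s\<in>fst p. snd p s \<otimes> s)" for x p
  have "\<forall>x\<in>U. \<exists>p. coords x p"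
  proof
    fix x assume "x \<in> U"
    then obtain F c where "finite F \<and> F \<subseteq> S \<and> c \<in> F \<rightarrow> A \<and> x = (\<Oplus>s\<in>F. c s \<otimes> s)"
      using spanning assms(2) by blast
    hence "coords x (F, c)" unfolding coords_def by simp
    thus "\<exists>p. coords x p" ..
  qed
  then obtain p where p: "\<forall>x\<in>U. coords x (p x)" by (rule bchoice[THEN exE])
  define F where "F x = fst (p x)" for x
  define c where "c x = snd (p x)" for x
  have Fc: "finite (F x)" "F x \<subseteq> S" "c x \<in> F x \<rightarrow> A" "x = (\<Oplus>s\<in>F x. c x s \<otimes> s)" if "x \<in> U" for x
    using bspec[OF p that, unfolded coords_def] unfolding F_def c_def by - (elim conjE, assumption)+
  let ?F = "\<Union> (F ` U)"
  let ?c = "\<lambda>x s. if s \<in> F x then c x s else \<zero>"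
  have fF: "finite ?F" using assms(1) Fc(1) by blast
  show ?thesis
  proof (rule that[of ?F ?c])
    show "finite ?F" by (rule fF)
    show "?F \<subseteq> S" using Fc(2) by blast
    show "?c x s \<in> A" if "x \<in> U" "s \<in> ?F" for x s
      using Fc(3)[OF that(1)] subringE(2)[OF subring] by auto
    fix x assume x: "x \<in> U"
    have cs: "c x s \<in> carrier B" "s \<in> carrier B" if "s \<in> F x" for s
      using Fc(2,3)[OF x] that A_carrier S_carrier by auto
    have sc: "s \<in> carrier B" if "s \<in> ?F" for s using that Fc(2) S_carrier by blast
    have "(\<Oplus>s\<in>?F. ?c x s \<otimes> s) = (\<Oplus>s\<in>?F. if s \<in> F x then c x s \<otimes> s else \<zero>)"
      using cs sc by (intro finsum_cong') auto
    also have "\<dots> = (\<Oplus>s\<in>{s \<in> ?F. s \<in> F x}. c x s \<otimes> s)"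
      using cs by (intro finsum_filter fF) auto
    also have "{s \<in> ?F. s \<in> F x} = F x" using x by blast
    also have "(\<Oplus>s\<in>F x. c x s \<otimes> s) = x" by (rule Fc(4)[OF x, symmetric])
    finally show "x = (\<Oplus>s\<in>?F. ?c x s \<otimes> s)" by (rule sym)
  qed
qed

text \<open>Flatness, in coordinates: a relation over \<open>B\<close> between vectors over \<open>A\<close> is a combination of relations over \<open>A\<close>,
  one for each element of the basis.\<close>

lemma exact_base_change:
  assumes fin: "finite T" "finite T'" and D: "\<And>j i. \<lbrakk>j \<in> T; i \<in> I\<rbrakk> \<Longrightarrow> D j i \<in> A"
    and D': "\<And>l j. \<lbrakk>l \<in> T'; j \<in> T\<rbrakk> \<Longrightarrow> D' l j \<in> A"
    and exact: "\<And>c. \<lbrakk>c \<in> T \<rightarrow> A; \<And>i. i \<in> I \<Longrightarrow> lincomb T c D i = \<zero>\<rbrakk> \<Longrightarrow> \<exists>e \<in> T' \<rightarrow> A. \<forall>j\<in>T. c j = lincomb T' e D' j"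
    and b: "b \<in> T \<rightarrow> carrier B" "\<And>i. i \<in> I \<Longrightarrow> lincomb T b D i = \<zero>"
  shows "\<exists>e \<in> T' \<rightarrow> carrier B. \<forall>j\<in>T. b j = lincomb T' e D' j"
proof -
  obtain F g where F: "finite F" "F \<subseteq> S" "\<And>x s. \<lbrakk>x \<in> b ` T; s \<in> F\<rbrakk> \<Longrightarrow> g x s \<in> A"
    "\<And>x. x \<in> b ` T \<Longrightarrow> x = (\<Oplus>s\<in>F. g x s \<otimes> s)"
    using common_coordinates[of "b ` T"] fin(1) b(1) by auto
  define c where "c s j = g (b j) s" for s j
  have cA: "c s j \<in> A" if "j \<in> T" "s \<in> F" for s j unfolding c_def using F(3) that by auto
  have cc: "c s j \<in> carrier B" if "j \<in> T" "s \<in> F" for s j using cA[OF that] A_carrier by blast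
  have sc: "s \<in> carrier B" if "s \<in> F" for s using F(2) S_carrier that by blast
  have FB: "F \<subseteq> carrier B" using F(2) S_carrier by blast
  have bj: "b j = (\<Oplus>s\<in>F. s \<otimes> c s j)" if "j \<in> T" for j
  proof -
    have "b j = (\<Oplus>s\<in>F. c s j \<otimes> s)" unfolding c_def using that by (intro F(4)) auto
    also have "\<dots> = (\<Oplus>s\<in>F. s \<otimes> c s j)" using that cc sc by (intro finsum_cong') (auto simp: m_comm)
    finally show ?thesis .
  qed
  have lA: "lincomb T (c s) D i \<in> A" if "s \<in> F" "i \<in> I" for s i
    unfolding lincomb_def using cA that D subringE(6)[OF subring] by (intro A_finsum) auto
  have rel: "lincomb T (c s) D i = \<zero>" if s: "s \<in> F" and i: "i \<in> I" for s i
  proof (rule independent[OF F(1,2) _ _ s])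
    show "(\<lambda>s. lincomb T (c s) D i) \<in> F \<rightarrow> A" using lA[OF _ i] by blast
    show "(\<Oplus>s\<in>F. lincomb T (c s) D i \<otimes> s) = \<zero>"
      using lincomb_coordinates[of T F b c D i, OF fin(1) F(1) FB bj cc] b(2)[OF i] D i A_carrier by simp
  qed
  have "\<forall>s\<in>F. \<exists>e. e \<in> T' \<rightarrow> A \<and> (\<forall>j\<in>T. c s j = lincomb T' e D' j)"
  proof
    fix s assume s: "s \<in> F"
    have "c s \<in> T \<rightarrow> A" using cA s by blast
    from exact[OF this rel[OF s]] show "\<exists>e. e \<in> T' \<rightarrow> A \<and> (\<forall>j\<in>T. c s j = lincomb T' e D' j)" by blast
  qed
  from bchoice[OF this] obtain e where e: "\<And>s. s \<in> F \<Longrightarrow> e s \<in> T' \<rightarrow> A"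
    "\<And>s j. \<lbrakk>s \<in> F; j \<in> T\<rbrakk> \<Longrightarrow> c s j = lincomb T' (e s) D' j" by blast
  have ec: "e s l \<in> carrier B" if "l \<in> T'" "s \<in> F" for s l using e(1) that A_carrier by blast
  define e' where "e' l = (\<Oplus>s\<in>F. s \<otimes> e s l)" for l
  have "b j = lincomb T' e' D' j" if j: "j \<in> T" for j
  proof -
    have "lincomb T' e' D' j = (\<Oplus>s\<in>F. lincomb T' (e s) D' j \<otimes> s)"
      using D' j A_carrier ec fin(2) F(1) FB unfolding e'_def by (intro lincomb_coordinates) auto
    also have "\<dots> = (\<Oplus>s\<in>F. s \<otimes> c s j)"
      using e(2) j cc sc by (intro finsum_cong') (auto simp: m_comm)
    finally show ?thesis using bj[OF j] by simp
  qed
  moreover have "e' \<in> T' \<rightarrow> carrier B" unfolding e'_def using ec sc by (auto intro!: finsum_closed)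
  ultimately show ?thesis by blast
qed

text \<open>Ideals of \<open>A\<close> are contracted from \<open>B\<close>: compare coordinates at a basis element which occurs in \<open>\<one>\<close> with a
  unit coefficient.\<close>

lemma noetherian_descent:
  assumes noeth: "noetherian_ring B" and M: "ideal M B" "\<one> \<notin> M"
    and units: "\<And>a. \<lbrakk>a \<in> A; a \<notin> M\<rbrakk> \<Longrightarrow> \<exists>a' \<in> A. a' \<otimes> a = \<one>"
  shows "noetherian_ring (B\<lparr>carrier := A\<rparr>)"
proof -
  interpret A: cring "B\<lparr>carrier := A\<rparr>" by (rule subring_cring[OF subring])
  interpret noetherian_cring B by (intro noetherian_cring.intro noeth is_cring)
  show ?thesis
  proof (rule A.noetherian_ringI)
    fix I assume I: "ideal I (B\<lparr>carrier := A\<rparr>)"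
    have IA: "I \<subseteq> A" using A.ideal_mem_carrier[OF I] by auto
    hence IB: "I \<subseteq> carrier B" using A_carrier by blast
    \<comment> \<open>finitely many elements of \<open>I\<close> generate the extension of \<open>I\<close> to \<open>B\<close>\<close>
    let ?S = "{Idl F | F. finite F \<and> F \<subseteq> I}"
    have "?S \<noteq> {}" by blast
    then obtain N where N: "N \<in> ?S" "\<And>K. \<lbrakk>K \<in> ?S; N \<subseteq> K\<rbrakk> \<Longrightarrow> K = N"
      by (rule exists_maximal_ideal_in) (use IB in \<open>auto intro!: genideal_ideal\<close>)
    then obtain F where F: "finite F" "F \<subseteq> I" "N = Idl F" by blast
    have FA: "F \<subseteq> A" and FB: "F \<subseteq> carrier B" using F IA IB by auto
    note AF = A.genideal_ideal[of F] A.genideal_self[of F]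
    have "I \<subseteq> Idl\<^bsub>B\<lparr>carrier := A\<rparr>\<^esub> F"
    proof
      fix a assume a: "a \<in> I"
      have aA: "a \<in> A" and ac: "a \<in> carrier B" using a IA IB by auto
      have aF: "insert a F \<subseteq> carrier B" using ac FB by auto
      have "Idl (insert a F) \<in> ?S" using F a by blast
      moreover have "N \<subseteq> Idl (insert a F)" unfolding F(3) using aF by (intro subset_Idl_subset) auto
      ultimately have "Idl (insert a F) = Idl F" using N(2) F(3) by blast
      hence "a \<in> Idl F" using genideal_self[OF aF] by blast
      then obtain b where b: "b \<in> F \<rightarrow> carrier B" "a = (\<Oplus>f\<in>F. b f \<otimes> f)" unfolding Idl_finite[OF F(1) FB] by blast
      obtain G c where G: "finite G" "G \<subseteq> S" "\<And>x s. \<lbrakk>x \<in> insert \<one> (b ` F); s \<in> G\<rbrakk> \<Longrightarrow> c x s \<in> A"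
        "\<And>x. x \<in> insert \<one> (b ` F) \<Longrightarrow> x = (\<Oplus>s\<in>G. c x s \<otimes> s)"
        using common_coordinates[of "insert \<one> (b ` F)"] F(1) b(1) by auto
      have Gc: "s \<in> carrier B" if "s \<in> G" for s using G(2) S_carrier that by blast
      have cB: "c x s \<in> carrier B" if "x \<in> insert \<one> (b ` F)" "s \<in> G" for x s using G(3)[OF that] A_carrier by blast
      obtain s where s: "s \<in> G" "c \<one> s \<notin> M"
      proof (rule ccontr)
        assume "\<not> thesis"
        hence "\<And>s. s \<in> G \<Longrightarrow> c \<one> s \<in> M" using that by blast
        hence "(\<Oplus>s\<in>G. c \<one> s \<otimes> s) \<in> M"
          using Gc ideal_rmult[OF M(1)] by (intro finsum_mem_ideal[OF M(1)]) auto
        moreover have "(\<Oplus>s\<in>G. c \<one> s \<otimes> s) = \<one>" by (rule G(4)[symmetric]) simp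
        ultimately show False using M(2) by simp
      qed
      define h where "h s = (\<Oplus>f\<in>F. c (b f) s \<otimes> f)" for s
      have hA: "h s \<in> A" if "s \<in> G" for s
        unfolding h_def using G(3) that FA subringE(6)[OF subring] by (intro A_finsum) auto
      have "(\<Oplus>s\<in>G. c \<one> s \<otimes> s) = \<one>" by (rule G(4)[symmetric]) simp
      hence "a = a \<otimes> (\<Oplus>s\<in>G. c \<one> s \<otimes> s)" using ac by simp
      also have "\<dots> = (\<Oplus>s\<in>G. a \<otimes> (c \<one> s \<otimes> s))" using G(1) ac cB Gc by (intro finsum_rdistr) auto
      also have "\<dots> = (\<Oplus>s\<in>G. a \<otimes> c \<one> s \<otimes> s)" using ac cB Gc by (intro finsum_cong') (auto simp: m_assoc)
      finally have a1: "(\<Oplus>s\<in>G. a \<otimes> c \<one> s \<otimes> s) = a" by (rule sym)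
      have "(\<Oplus>f\<in>F. b f \<otimes> f) = (\<Oplus>f\<in>F. \<Oplus>s\<in>G. c (b f) s \<otimes> s \<otimes> f)"
      proof (intro finsum_cong' refl)
        show "(\<lambda>f. \<Oplus>s\<in>G. c (b f) s \<otimes> s \<otimes> f) \<in> F \<rightarrow> carrier B"
          using cB Gc FB by (auto intro!: finsum_closed)
        fix f assume f: "f \<in> F"
        have "(\<Oplus>s\<in>G. c (b f) s \<otimes> s) = b f" using f by (intro G(4)[symmetric]) auto
        hence "b f \<otimes> f = (\<Oplus>s\<in>G. c (b f) s \<otimes> s) \<otimes> f" by (simp only:)
        also have "\<dots> = (\<Oplus>s\<in>G. c (b f) s \<otimes> s \<otimes> f)"
          using f FB cB Gc G(1) by (intro finsum_ldistr) auto
        finally show "b f \<otimes> f = (\<Oplus>s\<in>G. c (b f) s \<otimes> s \<otimes> f)" .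
      qed
      also have "\<dots> = (\<Oplus>s\<in>G. \<Oplus>f\<in>F. c (b f) s \<otimes> s \<otimes> f)"
        using cB Gc FB F(1) G(1) by (intro finsum_swap) auto
      also have "\<dots> = (\<Oplus>s\<in>G. h s \<otimes> s)"
      proof (intro finsum_cong' refl)
        show "(\<lambda>s. h s \<otimes> s) \<in> G \<rightarrow> carrier B" using hA A_carrier Gc by auto
        fix s assume s: "s \<in> G"
        have "(\<Oplus>f\<in>F. c (b f) s \<otimes> s \<otimes> f) = (\<Oplus>f\<in>F. c (b f) s \<otimes> f \<otimes> s)"
          using cB Gc FB s by (intro finsum_cong') (auto simp: m_ac)
        also have "\<dots> = h s \<otimes> s"
          unfolding h_def using cB Gc FB s F(1) by (intro finsum_ldistr[symmetric]) auto
        finally show "(\<Oplus>f\<in>F. c (b f) s \<otimes> s \<otimes> f) = h s \<otimes> s" .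
      qed
      finally have "(\<Oplus>s\<in>G. a \<otimes> c \<one> s \<otimes> s) = (\<Oplus>s\<in>G. h s \<otimes> s)"
        unfolding a1 b(2)[symmetric] .
      hence eq: "a \<otimes> c \<one> s = h s"
        using G(1-3) hA aA subringE(6)[OF subring] s(1)
        by (intro independent_eq[of G "\<lambda>s. a \<otimes> c \<one> s"]) auto
      obtain u where u: "u \<in> A" "u \<otimes> c \<one> s = \<one>" using units[of "c \<one> s"] G(3) s by blast
      have "h s = finsum (B\<lparr>carrier := A\<rparr>) (\<lambda>f. c (b f) s \<otimes> f) F"
        unfolding h_def using G(3) s(1) FA subringE(6)[OF subring]
        by (intro finsum_subring[OF subring, symmetric]) auto
      also have "\<dots> \<in> Idl\<^bsub>B\<lparr>carrier := A\<rparr>\<^esub> F"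
        using A.ideal_lmult[OF AF(1)] AF(2) FA G(3) s(1) by (intro A.finsum_mem_ideal AF(1)) auto
      finally have "u \<otimes> h s \<in> Idl\<^bsub>B\<lparr>carrier := A\<rparr>\<^esub> F" using A.ideal_lmult[OF AF(1), of u "h s"] u(1) FA by simp
      moreover have "u \<otimes> h s = (u \<otimes> c \<one> s) \<otimes> a"
        unfolding eq[symmetric] using u(1) ac cB[of \<one> s] s(1) A_carrier by (simp add: m_ac)
      ultimately show "a \<in> Idl\<^bsub>B\<lparr>carrier := A\<rparr>\<^esub> F" using u(2) ac by simp
    qed
    moreover have "Idl\<^bsub>B\<lparr>carrier := A\<rparr>\<^esub> F \<subseteq> I" by (rule A.genideal_minimal[OF I F(2)])
    ultimately show "\<exists>F\<subseteq>carrier (B\<lparr>carrier := A\<rparr>). finite F \<and> I = Idl\<^bsub>B\<lparr>carrier := A\<rparr>\<^esub> F"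
      using F(1) FA by (intro exI[of _ F]) auto
  qed
qed

end

section \<open>Polynomial functions\<close>

primrec (in ring) horner :: "'a list \<Rightarrow> 'a \<Rightarrow> 'a" where
  "horner [] x = \<zero>"
| "horner (c # cs) x = c \<oplus> x \<otimes> horner cs x"

context cring begin

lemma horner_closed [simp]: "set cs \<subseteq> carrier R \<Longrightarrow> x \<in> carrier R \<Longrightarrow> horner cs x \<in> carrier R"
  by (induction cs) auto

lemma minus_self: "x \<in> carrier R \<Longrightarrow> x \<ominus> x = \<zero>"
  by (simp add: r_right_minus_eq)

text \<open>The quotient of the division of a polynomial by \<open>T - x\<close>.\<close>

primrec horner_quotient :: "'a \<Rightarrow> 'a list \<Rightarrow> 'a list" where
  "horner_quotient x [] = []"
| "horner_quotient x (c # cs) = (if cs = [] then [] else horner cs x # horner_quotient x cs)"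

lemma horner_quotient_closed: "set cs \<subseteq> carrier R \<Longrightarrow> x \<in> carrier R \<Longrightarrow> set (horner_quotient x cs) \<subseteq> carrier R"
  by (induction cs) auto

lemma length_horner_quotient: "length (horner_quotient x cs) = length cs - 1"
  by (induction cs) (auto simp: Suc_diff_le neq_Nil_conv)

lemma horner_division:
  assumes "set cs \<subseteq> carrier R" "x \<in> carrier R" "t \<in> carrier R"
  shows "horner cs t = horner cs x \<oplus> (t \<ominus> x) \<otimes> horner (horner_quotient x cs) t"
  using assms(1)
proof (induction cs)
  case Nil
  thus ?case using assms(2,3) by simp
next
  case (Cons c cs)
  have cs: "set cs \<subseteq> carrier R" and c: "c \<in> carrier R" using Cons.prems by auto
  define h where "h = horner cs x"
  define q where "q = horner (horner_quotient x cs) t"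
  have hq: "h \<in> carrier R" "q \<in> carrier R"
    unfolding h_def q_def using cs assms horner_quotient_closed[OF cs assms(2)] by auto
  show ?case
  proof (cases "cs = []")
    case True
    thus ?thesis using c assms(2,3) by simp
  next
    case False
    have "horner cs t = h \<oplus> (t \<ominus> x) \<otimes> q" unfolding h_def q_def by (rule Cons.IH[OF cs])
    moreover have "c \<oplus> t \<otimes> (h \<oplus> (t \<ominus> x) \<otimes> q) = (c \<oplus> x \<otimes> h) \<oplus> (t \<ominus> x) \<otimes> (h \<oplus> t \<otimes> q)"
      using c hq assms(2,3) by algebra
    ultimately show ?thesis using False unfolding h_def q_def by simp
  qed
qed

lemma horner_quotient_zero:
  assumes "set cs \<subseteq> carrier R" "x \<in> carrier R" "set (horner_quotient x cs) \<subseteq> {\<zero>}"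
  shows "set (tl cs) \<subseteq> {\<zero>}"
  using assms(1,3)
proof (induction cs)
  case (Cons c cs)
  show ?case
  proof (cases cs)
    case (Cons d ds)
    hence h: "horner cs x = \<zero>" "set (horner_quotient x cs) \<subseteq> {\<zero>}" using Cons.prems by auto
    hence ds: "set ds \<subseteq> {\<zero>}" using Cons.IH Cons.prems(1) Cons by auto
    hence "horner ds x = \<zero>"
      using assms(2) by (induction ds) auto
    hence "d = \<zero>" using h(1) Cons Cons.prems(1) assms(2) by auto
    thus ?thesis using ds Cons by auto
  qed simp
qed simp

text \<open>\<open>P + (T - x) Q\<close> for polynomials \<open>P\<close> and \<open>Q\<close> of the same length, given by the list of pairs of their
  coefficients; the parameter \<open>r\<close> is the coefficient of \<open>T Q\<close> carried over from the previous degree.\<close>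

primrec add_linear_multiple :: "'a \<Rightarrow> 'a \<Rightarrow> ('a \<times> 'a) list \<Rightarrow> 'a list" where
  "add_linear_multiple x r [] = [r]"
| "add_linear_multiple x r (cq # cqs) = (fst cq \<ominus> x \<otimes> snd cq \<oplus> r) # add_linear_multiple x (snd cq) cqs"

lemma length_add_linear_multiple: "length (add_linear_multiple x r cqs) = Suc (length cqs)"
  by (induction cqs arbitrary: r) auto

lemma add_linear_multiple_closed:
  assumes "set cqs \<subseteq> carrier R \<times> carrier R" "x \<in> carrier R" "r \<in> carrier R"
  shows "set (add_linear_multiple x r cqs) \<subseteq> carrier R"
  using assms(1,3)
proof (induction cqs arbitrary: r)
  case (Cons cq cqs)
  have "fst cq \<in> carrier R" "snd cq \<in> carrier R" using Cons.prems(1) by auto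
  thus ?case using Cons.IH[of "snd cq"] Cons.prems assms(2) by simp
qed simp

lemma horner_add_linear_multiple:
  assumes "set cqs \<subseteq> carrier R \<times> carrier R" "x \<in> carrier R" "r \<in> carrier R" "t \<in> carrier R"
  shows "horner (add_linear_multiple x r cqs) t
    = horner (map fst cqs) t \<oplus> (t \<ominus> x) \<otimes> horner (map snd cqs) t \<oplus> r"
  using assms(1,3)
proof (induction cqs arbitrary: r)
  case Nil
  thus ?case using assms(2,4) by simp
next
  case (Cons cq cqs)
  obtain c q where cq: "cq = (c, q)" by (cases cq)
  have cqs: "set cqs \<subseteq> carrier R \<times> carrier R" and c: "c \<in> carrier R" "q \<in> carrier R" using Cons.prems cq by auto
  define P where "P = horner (map fst cqs) t"
  define Q where "Q = horner (map snd cqs) t"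
  have "set (map fst cqs) \<subseteq> carrier R" "set (map snd cqs) \<subseteq> carrier R" using cqs by auto
  hence PQ: "P \<in> carrier R" "Q \<in> carrier R" unfolding P_def Q_def using assms(4) horner_closed by blast+
  have "horner (add_linear_multiple x q cqs) t = P \<oplus> (t \<ominus> x) \<otimes> Q \<oplus> q"
    unfolding P_def Q_def by (rule Cons.IH[OF cqs c(2)])
  moreover have "c \<ominus> x \<otimes> q \<oplus> r \<oplus> t \<otimes> (P \<oplus> (t \<ominus> x) \<otimes> Q \<oplus> q)
      = c \<oplus> t \<otimes> P \<oplus> (t \<ominus> x) \<otimes> (q \<oplus> t \<otimes> Q) \<oplus> r"
    using c PQ Cons.prems(2) assms(2,4) by algebra
  ultimately show ?case unfolding cq P_def Q_def by simp
qed

lemma horner_eq_finsum: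
  assumes "set cs \<subseteq> carrier R" "x \<in> carrier R"
  shows "horner cs x = (\<Oplus>i\<in>{..<length cs}. cs ! i \<otimes> x [^] i)"
  using assms(1)
proof (induction cs)
  case (Cons c cs)
  have cs: "set cs \<subseteq> carrier R" and c: "c \<in> carrier R" using Cons.prems by auto
  have nth: "cs ! i \<in> carrier R" if "i < length cs" for i using cs that by auto
  have "(\<Oplus>i\<in>{..<length (c # cs)}. (c # cs) ! i \<otimes> x [^] i)
      = (\<Oplus>i\<in>insert 0 (Suc ` {..<length cs}). (c # cs) ! i \<otimes> x [^] i)"
    by (simp add: lessThan_Suc_eq_insert_0)
  also have "\<dots> = c \<oplus> (\<Oplus>i\<in>Suc ` {..<length cs}. (c # cs) ! i \<otimes> x [^] i)"
    using c nth assms(2) by (subst finsum_insert) auto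
  also have "(\<Oplus>i\<in>Suc ` {..<length cs}. (c # cs) ! i \<otimes> x [^] i) = (\<Oplus>i\<in>{..<length cs}. cs ! i \<otimes> x [^] Suc i)"
    using nth assms(2) by (subst finsum_reindex) auto
  also have "\<dots> = (\<Oplus>i\<in>{..<length cs}. x \<otimes> (cs ! i \<otimes> x [^] i))"
    using nth assms(2) by (intro finsum_cong') (auto simp: m_ac)
  also have "\<dots> = x \<otimes> horner cs x"
    unfolding Cons.IH[OF cs] using nth assms(2) by (intro finsum_rdistr[symmetric]) auto
  finally show ?case by simp
qed simp

lemma horner_diff:
  assumes "length cs = length ds" "set cs \<subseteq> carrier R" "set ds \<subseteq> carrier R" "x \<in> carrier R"
  shows "horner (map2 (\<lambda>c d. c \<ominus> d) cs ds) x = horner cs x \<ominus> horner ds x"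
  using assms(1-3)
proof (induction cs ds rule: list_induct2)
  case Nil
  show ?case by (simp add: minus_self)
next
  case (Cons c cs d ds)
  have h: "c \<in> carrier R" "d \<in> carrier R" "horner cs x \<in> carrier R" "horner ds x \<in> carrier R"
    using Cons.prems assms(4) by auto
  have "c \<ominus> d \<oplus> x \<otimes> (horner cs x \<ominus> horner ds x) = (c \<oplus> x \<otimes> horner cs x) \<ominus> (d \<oplus> x \<otimes> horner ds x)"
    using h assms(4) by algebra
  thus ?case using Cons by simp
qed

lemma horner_smult:
  assumes "set cs \<subseteq> carrier R" "x \<in> carrier R" "r \<in> carrier R"
  shows "horner (map (\<lambda>c. r \<otimes> c) cs) x = r \<otimes> horner cs x"
  using assms(1)
proof (induction cs)
  case (Cons c cs)
  have h: "c \<in> carrier R" "horner cs x \<in> carrier R" using Cons.prems assms(2) by auto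
  thus ?case using Cons assms(2,3) by (simp add: r_distr m_ac)
qed (simp add: assms)

lemma horner_simple_extension:
  assumes "set cs \<subseteq> A" "A \<subseteq> carrier R" "x \<in> carrier R"
  shows "horner cs x \<in> simple_extension A x"
  using assms(1)
proof (induction cs)
  case (Cons c cs)
  have "set cs \<subseteq> carrier R" "c \<in> carrier R" using Cons.prems assms(2) by auto
  hence "horner (c # cs) x = horner cs x \<otimes> x \<oplus> c" using assms(3) by (simp add: m_comm a_comm)
  thus ?case using simple_extension.lin[of "horner cs x" A x c] Cons by auto
qed simp

lemma horner_ring_hom:
  assumes "h \<in> ring_hom R R" "set cs \<subseteq> carrier R" "x \<in> carrier R"
  shows "h (horner cs x) = horner (map h cs) (h x)"
proof -
  interpret h: ring_hom_ring R R h by (rule ring_hom_ringI2[OF ring_axioms ring_axioms assms(1)])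
  show ?thesis using assms(2) by (induction cs) (auto simp: assms(3))
qed

end

text \<open>Dividing by \<open>T - x\<close> for one of the roots \<open>x\<close> lowers the degree and keeps the other roots.\<close>

lemma (in domain) polynomial_with_many_roots_zero:
  assumes "set cs \<subseteq> carrier R" "finite W" "W \<subseteq> carrier R" "length cs \<le> card W"
    "\<And>x. x \<in> W \<Longrightarrow> horner cs x = \<zero>"
  shows "set cs \<subseteq> {\<zero>}"
  using assms
proof (induction "length cs" arbitrary: cs W)
  case 0
  thus ?case by simp
next
  case (Suc n)
  hence "0 < card W" by linarith
  then obtain x where x: "x \<in> W" by (metis card_gt_0_iff ex_in_conv)
  have xc: "x \<in> carrier R" using x Suc.prems(3) by blast
  obtain c ds where cs: "cs = c # ds" using Suc.hyps(2) by (cases cs) auto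
  have "set (horner_quotient x cs) \<subseteq> {\<zero>}"
  proof (rule Suc.hyps(1))
    show "n = length (horner_quotient x cs)" using Suc.hyps(2) length_horner_quotient by simp
    show "set (horner_quotient x cs) \<subseteq> carrier R" by (rule horner_quotient_closed[OF Suc.prems(1) xc])
    show "length (horner_quotient x cs) \<le> card (W - {x})"
      using Suc.prems(4) x Suc.prems(2) length_horner_quotient[of x cs] by simp
    fix t assume t: "t \<in> W - {x}"
    have tc: "t \<in> carrier R" using t Suc.prems(3) by blast
    have q: "horner (horner_quotient x cs) t \<in> carrier R"
      using horner_quotient_closed[OF Suc.prems(1) xc] tc by simp
    have "(t \<ominus> x) \<otimes> horner (horner_quotient x cs) t = \<zero>"
      using horner_division[OF Suc.prems(1) xc tc] Suc.prems(5)[of t] Suc.prems(5)[OF x] t q tc xc by simp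
    moreover have "t \<ominus> x \<noteq> \<zero>" using t tc xc by (auto simp: r_right_minus_eq)
    ultimately show "horner (horner_quotient x cs) t = \<zero>" using integral[of "t \<ominus> x"] q tc xc by auto
  qed (use Suc.prems in auto)
  hence ds: "set ds \<subseteq> {\<zero>}" using horner_quotient_zero[OF Suc.prems(1) xc] cs by simp
  hence "horner ds x = \<zero>" using xc by (induction ds) auto
  hence "c = \<zero>" using Suc.prems(5)[OF x] cs Suc.prems(1) xc by auto
  thus ?case using ds cs by simp
qed

section \<open>Automorphisms of prime order\<close>

locale prime_order_automorphism = local_ring R + domain R for R (structure) +
  fixes \<sigma> :: "'a \<Rightarrow> 'a" and p :: nat
  assumes prime_p: "Factorial_Ring.prime p" and \<sigma>_hom: "\<sigma> \<in> ring_hom R R"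
    and \<sigma>_max_ideal: "a \<in> max_ideal R \<Longrightarrow> \<sigma> a \<in> max_ideal R"
    and \<sigma>_period: "b \<in> carrier R \<Longrightarrow> (\<sigma> ^^ p) b = b"
    and \<sigma>_nontrivial: "\<exists>b \<in> carrier R. \<sigma> b \<noteq> b"
begin

sublocale \<sigma>: ring_hom_ring R R \<sigma>
  by (rule ring_hom_ringI2[OF ring_axioms ring_axioms \<sigma>_hom])

definition fixed :: "'a set" where "fixed = {b \<in> carrier R. \<sigma> b = b}"

lemma fixedD: "a \<in> fixed \<Longrightarrow> a \<in> carrier R" "a \<in> fixed \<Longrightarrow> \<sigma> a = a"
  unfolding fixed_def by auto

lemma p_pos: "0 < p" using prime_gt_0_nat[OF prime_p] .

lemma pow_closed [simp]: "b \<in> carrier R \<Longrightarrow> (\<sigma> ^^ k) b \<in> carrier R"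
  by (induction k) auto

lemma pow_hom: "(\<sigma> ^^ k) \<in> ring_hom R R"
proof (induction k)
  case (Suc k)
  show ?case
    by (rule ring_hom_memI) (simp_all add: ring_hom_mult[OF Suc] ring_hom_add[OF Suc] ring_hom_one[OF Suc])
qed (auto intro: ring_hom_memI)

lemma pow_fixed: "a \<in> fixed \<Longrightarrow> (\<sigma> ^^ k) a = a"
  by (induction k) (auto simp: fixedD)

lemma pow_period: "b \<in> carrier R \<Longrightarrow> (\<sigma> ^^ (p * q)) b = b"
  by (induction q) (auto simp: funpow_add \<sigma>_period)

lemma \<sigma>_inj: "\<lbrakk>a \<in> carrier R; b \<in> carrier R; (\<sigma> ^^ k) a = (\<sigma> ^^ k) b\<rbrakk> \<Longrightarrow> a = b"
proof (induction k arbitrary: a b)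
  case (Suc k)
  have "\<sigma> ((\<sigma> ^^ k) a) = \<sigma> ((\<sigma> ^^ k) b)" using Suc.prems(3) by simp
  hence "(\<sigma> ^^ (p - 1)) (\<sigma> ((\<sigma> ^^ k) a)) = (\<sigma> ^^ (p - 1)) (\<sigma> ((\<sigma> ^^ k) b))" by simp
  moreover have "(\<sigma> ^^ (p - 1)) (\<sigma> c) = c" if "c \<in> carrier R" for c
    using \<sigma>_period[OF that] p_pos funpow_Suc_right[of "p - 1" \<sigma>] by (simp add: fun_eq_iff)
  ultimately have "(\<sigma> ^^ k) a = (\<sigma> ^^ k) b"
    using Suc.prems(1,2) pow_closed[of a k] pow_closed[of b k] by metis
  thus ?case using Suc by blast
qed simp

lemma fixed_subring: "subring fixed R"
proof (rule subringI)
  show "fixed \<subseteq> carrier R" unfolding fixed_def by blast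
qed (auto simp: fixed_def)

text \<open>As \<open>p\<close> is prime, \<open>k\<close> is invertible modulo \<open>p\<close>.\<close>

lemma \<sigma>_is_power:
  assumes "0 < k" "k < p"
  obtains j where "\<And>b. b \<in> carrier R \<Longrightarrow> (\<sigma> ^^ (k * j)) b = \<sigma> b"
proof -
  have "\<not> p dvd k" using assms by (auto dest: dvd_imp_le)
  hence "coprime p k" using prime_imp_coprime_nat[OF prime_p] by blast
  hence "gcd k p = 1" by (simp add: coprime_iff_gcd_eq_1 gcd.commute)
  then obtain j q where "k * j = p * q + 1" using bezout_nat[of k p] assms(1) by auto
  hence "(\<sigma> ^^ (k * j)) b = \<sigma> b" if "b \<in> carrier R" for b
    using pow_period[OF \<sigma>.hom_closed[OF that], of q] funpow_Suc_right[of "p * q" \<sigma>] by (simp add: fun_eq_iff)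
  thus ?thesis using that by blast
qed

definition \<delta> :: "'a \<Rightarrow> 'a" where "\<delta> b = \<sigma> b \<ominus> b"

lemma \<delta>_closed [simp]: "b \<in> carrier R \<Longrightarrow> \<delta> b \<in> carrier R"
  unfolding \<delta>_def by simp

lemma \<delta>_augmentation: "augmentation R \<sigma> = \<delta>"
  unfolding augmentation_def \<delta>_def by (rule refl)

lemma \<delta>_fixed: "a \<in> fixed \<Longrightarrow> \<delta> a = \<zero>"
  unfolding \<delta>_def fixed_def by simp

lemma \<delta>_add: "\<lbrakk>a \<in> carrier R; b \<in> carrier R\<rbrakk> \<Longrightarrow> \<delta> (a \<oplus> b) = \<delta> a \<oplus> \<delta> b"
proof -
  assume ab: "a \<in> carrier R" "b \<in> carrier R"
  have "\<sigma> a \<in> carrier R" "\<sigma> b \<in> carrier R" using ab by auto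
  thus ?thesis unfolding \<delta>_def \<sigma>.hom_add[OF ab] using ab by algebra
qed

lemma \<delta>_mult: "\<lbrakk>a \<in> carrier R; b \<in> carrier R\<rbrakk> \<Longrightarrow> \<delta> (a \<otimes> b) = \<sigma> a \<otimes> \<delta> b \<oplus> \<delta> a \<otimes> b"
proof -
  assume ab: "a \<in> carrier R" "b \<in> carrier R"
  have "\<sigma> a \<in> carrier R" "\<sigma> b \<in> carrier R" using ab by auto
  thus ?thesis unfolding \<delta>_def \<sigma>.hom_mult[OF ab] using ab by algebra
qed

abbreviation I\<^sub>G :: "'a set" where "I\<^sub>G \<equiv> augmentation_ideal R \<sigma>"

lemma I\<^sub>G_eq: "I\<^sub>G = Idl (\<delta> ` carrier R)"
  unfolding augmentation_ideal_def \<delta>_augmentation by (rule refl)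

lemma I\<^sub>G_ideal: "ideal I\<^sub>G R"
  unfolding I\<^sub>G_eq by (rule genideal_ideal) auto

lemma \<delta>_in_I\<^sub>G: "b \<in> carrier R \<Longrightarrow> \<delta> b \<in> I\<^sub>G"
  unfolding I\<^sub>G_eq by (rule subsetD[OF genideal_self]) auto

lemma I\<^sub>G_minimal: "\<lbrakk>ideal J R; \<And>b. b \<in> carrier R \<Longrightarrow> \<delta> b \<in> J\<rbrakk> \<Longrightarrow> I\<^sub>G \<subseteq> J"
  unfolding I\<^sub>G_eq by (rule genideal_minimal) auto

lemma I\<^sub>G_nonzero: "I\<^sub>G \<noteq> {\<zero>}"
proof -
  obtain b where b: "b \<in> carrier R" "\<sigma> b \<noteq> b" using \<sigma>_nontrivial by blast
  hence "\<delta> b \<noteq> \<zero>" unfolding \<delta>_def by (simp add: r_right_minus_eq)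
  thus ?thesis using \<delta>_in_I\<^sub>G[OF b(1)] by auto
qed

lemma Idl_singleton: "t \<in> carrier R \<Longrightarrow> Idl {t} = {c \<otimes> t | c. c \<in> carrier R}"
  using cgenideal_eq_genideal[of t] unfolding cgenideal_def by simp

definition max_multiples :: "'a \<Rightarrow> 'a set" where
  "max_multiples t = {m \<otimes> t | m. m \<in> max_ideal R}"

lemma max_multiples_ideal:
  assumes "t \<in> carrier R"
  shows "ideal (max_multiples t) R"
proof (rule cring_idealI)
  note M = ideal_axioms_mem[OF max_ideal_ideal]
  show "max_multiples t \<subseteq> carrier R" unfolding max_multiples_def using assms M(1) by auto
  have "\<zero> = \<zero> \<otimes> t" using assms by simp
  thus "\<zero> \<in> max_multiples t" unfolding max_multiples_def using M(2) by blast
next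
  note M = ideal_axioms_mem[OF max_ideal_ideal]
  fix a b assume "a \<in> max_multiples t" "b \<in> max_multiples t"
  then obtain m n where h: "m \<in> max_ideal R" "n \<in> max_ideal R" "a = m \<otimes> t" "b = n \<otimes> t"
    unfolding max_multiples_def by blast
  hence "a \<oplus> b = (m \<oplus> n) \<otimes> t" using assms M(1) by (simp add: l_distr)
  thus "a \<oplus> b \<in> max_multiples t" unfolding max_multiples_def using M(3)[OF h(1,2)] by blast
next
  note M = ideal_axioms_mem[OF max_ideal_ideal]
  fix r a assume r: "r \<in> carrier R" and "a \<in> max_multiples t"
  then obtain m where h: "m \<in> max_ideal R" "a = m \<otimes> t" unfolding max_multiples_def by blast
  hence "r \<otimes> a = (r \<otimes> m) \<otimes> t" using assms M(1) r by (simp add: m_assoc)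
  thus "r \<otimes> a \<in> max_multiples t" unfolding max_multiples_def using M(6)[OF r h(1)] by blast
qed

lemma not_self_max_multiple:
  assumes t: "t \<in> carrier R" "t \<noteq> \<zero>"
  shows "t \<notin> max_multiples t"
proof
  assume "t \<in> max_multiples t"
  then obtain m where m: "m \<in> max_ideal R" "t = m \<otimes> t" unfolding max_multiples_def by blast
  have mc: "m \<in> carrier R" using m(1) mem_max_ideal_carrier by blast
  have "(\<one> \<ominus> m) \<otimes> t = t \<ominus> m \<otimes> t" using mc t(1) by algebra
  also have "\<dots> = t \<ominus> t" using m(2) by simp
  also have "\<dots> = \<zero>" using t(1) by simp
  finally have "\<one> \<ominus> m = \<zero>" using integral[of "\<one> \<ominus> m" t] t mc by auto
  thus False using one_minus_max_ideal_notin[OF m(1)] ideal_zero[OF max_ideal_ideal] by simp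
qed

text \<open>If \<open>I\<^sub>G = (t)\<close> and all \<open>\<delta> b\<close> were in \<open>\<mm> t\<close>, then so would be \<open>t\<close>; hence some \<open>\<delta> b\<close> is a unit times \<open>t\<close>.\<close>

lemma principal_augmentation_generator:
  assumes "principalideal I\<^sub>G R"
  obtains y where "y \<in> carrier R" "I\<^sub>G = Idl {\<delta> y}" "\<delta> y \<noteq> \<zero>"
proof -
  obtain t where t: "t \<in> carrier R" "I\<^sub>G = Idl {t}" using principalideal.generate[OF assms] by blast
  have "t \<noteq> \<zero>" using t I\<^sub>G_nonzero genideal_zero by auto
  hence nt: "t \<notin> max_multiples t" using not_self_max_multiple t(1) by blast
  have tI: "t \<in> I\<^sub>G" using t genideal_self' by simp
  have "\<exists>y \<in> carrier R. \<delta> y \<notin> max_multiples t"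
  proof (rule ccontr)
    assume "\<not> ?thesis"
    hence "I\<^sub>G \<subseteq> max_multiples t" using I\<^sub>G_minimal[OF max_multiples_ideal[OF t(1)]] by blast
    thus False using tI nt by blast
  qed
  then obtain y where y: "y \<in> carrier R" "\<delta> y \<notin> max_multiples t" by blast
  have "\<delta> y \<in> Idl {t}" using \<delta>_in_I\<^sub>G[OF y(1)] t(2) by simp
  then obtain e where e: "e \<in> carrier R" "\<delta> y = e \<otimes> t" unfolding Idl_singleton[OF t(1)] by blast
  have "e \<notin> max_ideal R" using y(2) e(2) unfolding max_multiples_def by blast
  hence eU: "e \<in> Units R" using Units_iff_notin_max_ideal[OF e(1)] by blast
  have D: "ideal (Idl {\<delta> y}) R" "\<delta> y \<in> Idl {\<delta> y}"
    using genideal_ideal[of "{\<delta> y}"] genideal_self'[of "\<delta> y"] y(1) by auto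
  have "inv e \<otimes> \<delta> y = t" unfolding e(2) using eU t(1) e(1) by (simp flip: m_assoc)
  hence "t \<in> Idl {\<delta> y}" using ideal_lmult[OF D(1) _ D(2), of "inv e"] eU by simp
  hence "I\<^sub>G \<subseteq> Idl {\<delta> y}" unfolding t(2) by (intro genideal_minimal D(1)) simp
  moreover have "Idl {\<delta> y} \<subseteq> I\<^sub>G" using \<delta>_in_I\<^sub>G[OF y(1)] by (intro genideal_minimal I\<^sub>G_ideal) simp
  ultimately have "I\<^sub>G = Idl {\<delta> y}" by blast
  moreover from this have "\<delta> y \<noteq> \<zero>" using I\<^sub>G_nonzero genideal_zero by auto
  ultimately show ?thesis using that y(1) by blast
qed

text \<open>The difference telescopes into the elements \<open>\<delta> (\<sigma>\<^sup>i y)\<close>.\<close>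

lemma pow_diff_in_I\<^sub>G:
  assumes y: "y \<in> carrier R"
  shows "(\<sigma> ^^ k) y \<ominus> y \<in> I\<^sub>G"
proof (induction k)
  case 0
  thus ?case using y ideal_zero[OF I\<^sub>G_ideal] by (simp add: minus_self)
next
  case (Suc k)
  define z where "z = (\<sigma> ^^ k) y"
  have z: "z \<in> carrier R" "\<sigma> z \<in> carrier R" unfolding z_def using y by auto
  have "\<sigma> z \<ominus> y = \<delta> z \<oplus> (z \<ominus> y)" unfolding \<delta>_def using z y by algebra
  thus ?case using ideal_add[OF I\<^sub>G_ideal \<delta>_in_I\<^sub>G[OF z(1)]] Suc unfolding z_def by simp
qed

text \<open>
  The ideal \<open>\<mm> t\<close> with \<open>t = \<delta> y\<close> is stable under \<open>\<sigma>\<close>. If \<open>\<sigma>\<^sup>k\<close> fixed \<open>y\<close> modulo \<open>\<mm> t\<close>, then so would \<open>\<sigma>\<close>, being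
  a power of \<open>\<sigma>\<^sup>k\<close>, and \<open>t\<close> would be a multiple of \<open>t\<close> by an element of \<open>\<mm>\<close>.
\<close>

lemma power_differences_generate:
  assumes y: "y \<in> carrier R" "I\<^sub>G = Idl {\<delta> y}" "\<delta> y \<noteq> \<zero>" and k: "0 < k" "k < p"
  shows "(\<sigma> ^^ k) y \<ominus> y \<noteq> \<zero>" "b \<in> I\<^sub>G \<Longrightarrow> \<exists>q \<in> carrier R. b = q \<otimes> ((\<sigma> ^^ k) y \<ominus> y)"
proof -
  define t where "t = \<delta> y"
  have t: "t \<in> carrier R" "t \<noteq> \<zero>" "I\<^sub>G = Idl {t}" unfolding t_def using y by auto
  note N = max_multiples_ideal[OF t(1)]
  have \<sigma>N: "\<sigma> a \<in> max_multiples t" if a: "a \<in> max_multiples t" for a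
  proof -
    obtain m where m: "m \<in> max_ideal R" "a = m \<otimes> t" using a unfolding max_multiples_def by blast
    have "\<sigma> t = \<delta> (\<sigma> y)" unfolding t_def \<delta>_def using y(1) by (simp add: a_minus_def)
    hence "\<sigma> t \<in> Idl {t}" using \<delta>_in_I\<^sub>G[of "\<sigma> y"] y(1) t(3) by simp
    then obtain v where v: "v \<in> carrier R" "\<sigma> t = v \<otimes> t" unfolding Idl_singleton[OF t(1)] by blast
    have mc: "m \<in> carrier R" using m(1) mem_max_ideal_carrier by blast
    have "\<sigma> a = (\<sigma> m \<otimes> v) \<otimes> t" unfolding m(2) using mc t(1) v by (simp add: m_assoc)
    moreover have "\<sigma> m \<otimes> v \<in> max_ideal R" using ideal_rmult[OF max_ideal_ideal v(1) \<sigma>_max_ideal[OF m(1)]] .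
    ultimately show ?thesis unfolding max_multiples_def by blast
  qed
  hence powN: "(\<sigma> ^^ i) a \<in> max_multiples t" if "a \<in> max_multiples t" for a i
    using that by (induction i) auto
  define w where "w = (\<sigma> ^^ k) y \<ominus> y"
  have wc: "w \<in> carrier R" unfolding w_def using y(1) by simp
  have wN: "w \<notin> max_multiples t"
  proof
    assume w: "w \<in> max_multiples t"
    have iter: "(\<sigma> ^^ (k * j)) y \<ominus> y \<in> max_multiples t" for j
    proof (induction j)
      case 0
      thus ?case using y(1) ideal_zero[OF N] by (simp add: minus_self)
    next
      case (Suc j)
      define z where "z = (\<sigma> ^^ (k * j)) y"
      interpret K: ring_hom_ring R R "\<sigma> ^^ k" by (rule ring_hom_ringI2[OF ring_axioms ring_axioms pow_hom])
      have zc: "z \<in> carrier R" unfolding z_def using y(1) by simp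
      have "(\<sigma> ^^ k) (z \<ominus> y) = (\<sigma> ^^ k) z \<ominus> (\<sigma> ^^ k) y" using zc y(1) by (simp add: a_minus_def)
      moreover have "(\<sigma> ^^ k) (z \<ominus> y) \<in> max_multiples t" using Suc powN unfolding z_def by blast
      ultimately have "((\<sigma> ^^ k) z \<ominus> (\<sigma> ^^ k) y) \<oplus> w \<in> max_multiples t" using ideal_add[OF N _ w] by simp
      moreover have "((\<sigma> ^^ k) z \<ominus> (\<sigma> ^^ k) y) \<oplus> w = (\<sigma> ^^ k) z \<ominus> y"
      proof -
        have "(\<sigma> ^^ k) z \<in> carrier R" "(\<sigma> ^^ k) y \<in> carrier R" using zc y(1) by auto
        thus ?thesis unfolding w_def using y(1) by algebra
      qed
      moreover have "(\<sigma> ^^ k) z = (\<sigma> ^^ (k * Suc j)) y" unfolding z_def by (simp add: funpow_add)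
      ultimately show ?case by simp
    qed
    obtain j where "\<And>b. b \<in> carrier R \<Longrightarrow> (\<sigma> ^^ (k * j)) b = \<sigma> b" using \<sigma>_is_power[OF k] by blast
    hence "t \<in> max_multiples t" using iter[of j] y(1) unfolding t_def \<delta>_def by simp
    thus False using not_self_max_multiple[OF t(1,2)] by blast
  qed
  thus "(\<sigma> ^^ k) y \<ominus> y \<noteq> \<zero>" using ideal_zero[OF N] unfolding w_def by metis
  have "w \<in> Idl {t}" using pow_diff_in_I\<^sub>G[OF y(1), of k] t(3) unfolding w_def by simp
  then obtain u where u: "u \<in> carrier R" "w = u \<otimes> t" unfolding Idl_singleton[OF t(1)] by blast
  have "u \<notin> max_ideal R" using wN u(2) unfolding max_multiples_def by blast
  hence uU: "u \<in> Units R" using Units_iff_notin_max_ideal[OF u(1)] by blast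
  assume "b \<in> I\<^sub>G"
  then obtain c where c: "c \<in> carrier R" "b = c \<otimes> t" unfolding t(3) Idl_singleton[OF t(1)] by blast
  have "inv u \<otimes> w = t" unfolding u(2) using uU t(1) u(1) by (simp flip: m_assoc)
  hence "b = (c \<otimes> inv u) \<otimes> w" unfolding c(2) using c(1) uU wc by (simp add: m_assoc)
  thus "\<exists>q \<in> carrier R. b = q \<otimes> ((\<sigma> ^^ k) y \<ominus> y)"
    using c(1) uU unfolding w_def by (intro bexI[of _ "c \<otimes> inv u"]) auto
qed

text \<open>
  Aitken's recursion. If \<open>P\<close> interpolates the values \<open>\<sigma>\<^sup>j f\<close> at the nodes \<open>\<sigma>\<^sup>j y\<close> for \<open>j < n\<close>, then so does
  \<open>P\<^sup>\<sigma>\<close> for \<open>1 \<le> j \<le> n\<close>, and \<open>P + (T - y) (P\<^sup>\<sigma> - P) / (\<sigma>\<^sup>n y - y)\<close> for \<open>0 \<le> j \<le> n\<close>. The division is possible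
  in \<open>R\<close> because the coefficients of \<open>P\<^sup>\<sigma> - P\<close> lie in the augmentation ideal.
\<close>

lemma interpolation:
  assumes y: "y \<in> carrier R" "I\<^sub>G = Idl {\<delta> y}" "\<delta> y \<noteq> \<zero>" and f: "f \<in> carrier R" and n: "n < p"
  shows "\<exists>cs. length cs = Suc n \<and> set cs \<subseteq> carrier R \<and> (\<forall>j\<le>n. horner cs ((\<sigma> ^^ j) y) = (\<sigma> ^^ j) f)"
  using n
proof (induction n)
  case 0
  thus ?case using y(1) f by (intro exI[of _ "[f]"]) simp
next
  case (Suc n)
  then obtain cs where cs: "length cs = Suc n" "set cs \<subseteq> carrier R"
    "\<And>j. j \<le> n \<Longrightarrow> horner cs ((\<sigma> ^^ j) y) = (\<sigma> ^^ j) f" by auto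
  define w where "w = (\<sigma> ^^ Suc n) y \<ominus> y"
  have w: "w \<in> carrier R" "w \<noteq> \<zero>" "\<And>b. b \<in> I\<^sub>G \<Longrightarrow> \<exists>q \<in> carrier R. b = q \<otimes> w"
    unfolding w_def using y(1) power_differences_generate[OF y, of "Suc n"] Suc.prems by auto
  have "\<forall>c\<in>carrier R. \<exists>q. q \<in> carrier R \<and> \<delta> c = w \<otimes> q"
    using w(1,3) \<delta>_in_I\<^sub>G m_comm by metis
  then obtain q where q: "\<And>c. c \<in> carrier R \<Longrightarrow> q c \<in> carrier R" "\<And>c. c \<in> carrier R \<Longrightarrow> \<delta> c = w \<otimes> q c"
    by metis
  define cqs where "cqs = map (\<lambda>c. (c, q c)) cs"
  define ds where "ds = add_linear_multiple y \<zero> cqs"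
  have cqs: "set cqs \<subseteq> carrier R \<times> carrier R" "map fst cqs = cs" "map snd cqs = map q cs"
    unfolding cqs_def using cs(2) q(1) by (auto simp: comp_def)
  have qcs: "set (map q cs) \<subseteq> carrier R" using cs(2) q(1) by auto
  have ds: "length ds = Suc (Suc n)" "set ds \<subseteq> carrier R"
    unfolding ds_def using length_add_linear_multiple[of y \<zero> cqs] add_linear_multiple_closed[OF cqs(1) y(1)] cs(1)
    by (auto simp: cqs_def)
  have eval_ds: "horner ds t = horner cs t \<oplus> (t \<ominus> y) \<otimes> horner (map q cs) t" if t: "t \<in> carrier R" for t
    using horner_add_linear_multiple[OF cqs(1) y(1) zero_closed t] cqs(2,3) cs(2) qcs t y(1) unfolding ds_def by simp
  have wq: "w \<otimes> horner (map q cs) t = horner (map \<sigma> cs) t \<ominus> horner cs t" if t: "t \<in> carrier R" for t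
  proof -
    have "w \<otimes> horner (map q cs) t = horner (map \<delta> cs) t"
    proof -
      have "map \<delta> cs = map (\<lambda>c. w \<otimes> c) (map q cs)" using q(2) cs(2) by auto
      thus ?thesis using horner_smult[OF qcs t w(1)] by (simp only:)
    qed
    also have "map \<delta> cs = map2 (\<lambda>c d. c \<ominus> d) (map \<sigma> cs) cs"
      unfolding \<delta>_def by (induction cs) auto
    also have "horner \<dots> t = horner (map \<sigma> cs) t \<ominus> horner cs t"
      using cs(2) t by (intro horner_diff) auto
    finally show ?thesis .
  qed
  have \<sigma>cs: "horner (map \<sigma> cs) ((\<sigma> ^^ Suc j) y) = (\<sigma> ^^ Suc j) f" if "j \<le> n" for j
    using horner_ring_hom[OF \<sigma>_hom cs(2), of "(\<sigma> ^^ j) y"] cs(3)[OF that] y(1) by simp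
  have "horner ds ((\<sigma> ^^ j) y) = (\<sigma> ^^ j) f" if j: "j \<le> Suc n" for j
  proof (cases j)
    case 0
    have "horner ds y = horner cs y \<oplus> \<zero> \<otimes> horner (map q cs) y"
      using eval_ds[OF y(1)] y(1) by (simp add: minus_self)
    thus ?thesis using cs(3)[of 0] f qcs y(1) 0 by simp
  next
    case (Suc i)
    define t where "t = (\<sigma> ^^ Suc i) y"
    define u where "u = (\<sigma> ^^ Suc i) f"
    define Q where "Q = horner (map q cs) t"
    have c: "t \<in> carrier R" "u \<in> carrier R" "Q \<in> carrier R" "horner cs t \<in> carrier R"
      unfolding t_def u_def Q_def using y(1) f qcs cs(2) by auto
    have Q: "w \<otimes> Q = u \<ominus> horner cs t"
      using wq[OF c(1)] \<sigma>cs[of i] j Suc unfolding Q_def t_def u_def by simp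
    show ?thesis
    proof (cases "i = n")
      case True
      hence "t \<ominus> y = w" unfolding t_def w_def by simp
      hence "horner ds t = horner cs t \<oplus> (u \<ominus> horner cs t)" using eval_ds[OF c(1)] Q unfolding Q_def by simp
      also have "\<dots> = u" using c by algebra
      finally show ?thesis unfolding t_def u_def Suc .
    next
      case False
      hence "horner cs t = u" using cs(3)[of "Suc i"] j Suc unfolding t_def u_def by simp
      hence "w \<otimes> Q = \<zero>" using Q c(2) by simp
      hence "Q = \<zero>" using integral[OF _ w(1) c(3)] w(2) by blast
      hence "horner ds t = u" using eval_ds[OF c(1)] \<open>horner cs t = u\<close> c y(1) unfolding Q_def by simp
      thus ?thesis unfolding t_def u_def Suc .
    qed
  qed
  thus ?case using ds by blast
qed

lemma nodes_inj:
  assumes y: "y \<in> carrier R" "\<And>k. \<lbrakk>0 < k; k < p\<rbrakk> \<Longrightarrow> (\<sigma> ^^ k) y \<noteq> y"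
  shows "inj_on (\<lambda>j. (\<sigma> ^^ j) y) {..<p}"
proof -
  have "False" if ij: "i < j" "j < p" "(\<sigma> ^^ i) y = (\<sigma> ^^ j) y" for i j
  proof -
    have "(\<sigma> ^^ j) y = (\<sigma> ^^ i) ((\<sigma> ^^ (j - i)) y)"
      using ij(1) funpow_add[of i "j - i" \<sigma>] by (simp add: fun_eq_iff)
    hence "(\<sigma> ^^ (j - i)) y = y" using \<sigma>_inj[of y "(\<sigma> ^^ (j - i)) y" i] ij(3) y(1) by simp
    moreover have "0 < j - i" "j - i < p" using ij by auto
    ultimately show False using y(2) by blast
  qed
  thus ?thesis by (intro inj_onI) (metis lessThan_iff nat_neq_iff)
qed

lemma vanishing_at_nodes:
  assumes y: "y \<in> carrier R" "inj_on (\<lambda>j. (\<sigma> ^^ j) y) {..<p}"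
    and cs: "set cs \<subseteq> carrier R" "length cs \<le> p" "\<And>j. j < p \<Longrightarrow> horner cs ((\<sigma> ^^ j) y) = \<zero>"
  shows "set cs \<subseteq> {\<zero>}"
proof (rule polynomial_with_many_roots_zero[OF cs(1)])
  show "length cs \<le> card ((\<lambda>j. (\<sigma> ^^ j) y) ` {..<p})" using card_image[OF y(2)] cs(2) by simp
qed (use y(1) cs(3) in auto)

text \<open>At \<open>n = p\<close> the nodes are permuted by \<open>\<sigma>\<close>, so the interpolating polynomial is invariant; its coefficients
  therefore lie in the fixed ring, and evaluating it at \<open>y\<close> gives back \<open>f\<close>.\<close>

lemma power_basis:
  assumes "principalideal I\<^sub>G R"
  obtains y where "y \<in> carrier R"
    "\<And>f. f \<in> carrier R \<Longrightarrow> \<exists>cs. length cs = p \<and> set cs \<subseteq> fixed \<and> f = horner cs y"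
    "\<And>cs. \<lbrakk>length cs \<le> p; set cs \<subseteq> fixed; horner cs y = \<zero>\<rbrakk> \<Longrightarrow> set cs \<subseteq> {\<zero>}"
proof -
  obtain y where y: "y \<in> carrier R" "I\<^sub>G = Idl {\<delta> y}" "\<delta> y \<noteq> \<zero>"
    using principal_augmentation_generator[OF assms] by blast
  have "(\<sigma> ^^ k) y \<noteq> y" if "0 < k" "k < p" for k
    using power_differences_generate(1)[OF y that] y(1) by (auto simp: r_right_minus_eq)
  hence inj: "inj_on (\<lambda>j. (\<sigma> ^^ j) y) {..<p}" by (rule nodes_inj[OF y(1)])
  have span: "\<exists>cs. length cs = p \<and> set cs \<subseteq> fixed \<and> f = horner cs y" if f: "f \<in> carrier R" for f
  proof -
    obtain cs where cs: "length cs = p" "set cs \<subseteq> carrier R"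
      "\<And>j. j < p \<Longrightarrow> horner cs ((\<sigma> ^^ j) y) = (\<sigma> ^^ j) f"
      using interpolation[OF y f, of "p - 1"] p_pos by auto
    let ?ds = "map2 (\<lambda>c d. c \<ominus> d) (map \<sigma> cs) cs"
    have \<sigma>cs: "set (map \<sigma> cs) \<subseteq> carrier R" using cs(2) by auto
    have "set ?ds \<subseteq> {\<zero>}"
    proof (rule vanishing_at_nodes[OF y(1) inj])
      show "set ?ds \<subseteq> carrier R" using cs(2) by (auto simp: set_zip subset_eq intro!: minus_closed)
      show "length ?ds \<le> p" using cs(1) by simp
      fix j assume j: "j < p"
      have "horner (map \<sigma> cs) ((\<sigma> ^^ j) y) = (\<sigma> ^^ j) f"
      proof (cases j)
        case 0
        \<comment> \<open>\<open>\<sigma>\<close> leads from the last node back to the first one\<close>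
        obtain m where m: "p = Suc m" using p_pos by (cases p) auto
        have "horner (map \<sigma> cs) (\<sigma> ((\<sigma> ^^ m) y)) = \<sigma> ((\<sigma> ^^ m) f)"
          using horner_ring_hom[OF \<sigma>_hom cs(2), of "(\<sigma> ^^ m) y"] cs(3)[of m] m y(1) by simp
        thus ?thesis using \<sigma>_period[OF y(1)] \<sigma>_period[OF f] m 0 by simp
      next
        case (Suc i)
        thus ?thesis using horner_ring_hom[OF \<sigma>_hom cs(2), of "(\<sigma> ^^ i) y"] cs(3)[of i] j y(1) by simp
      qed
      thus "horner ?ds ((\<sigma> ^^ j) y) = \<zero>"
        using horner_diff[OF _ \<sigma>cs cs(2), of "(\<sigma> ^^ j) y"] cs(3)[OF j] y(1) f by simp
    qed
    hence "\<sigma> c = c" if c: "c \<in> set cs" for c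
    proof -
      obtain i where i: "i < length cs" "c = cs ! i" using c by (auto simp: in_set_conv_nth)
      hence "?ds ! i = \<sigma> c \<ominus> c" by simp
      moreover have "?ds ! i \<in> set ?ds" using i(1) by (intro nth_mem) simp
      ultimately have "\<sigma> c \<ominus> c = \<zero>" using \<open>set ?ds \<subseteq> {\<zero>}\<close> by auto
      thus ?thesis using c cs(2) by (auto simp: r_right_minus_eq subset_eq)
    qed
    hence "set cs \<subseteq> fixed" using cs(2) unfolding fixed_def by auto
    thus ?thesis using cs(1) cs(3)[of 0] p_pos by auto
  qed
  have indep: "set cs \<subseteq> {\<zero>}" if "length cs \<le> p" "set cs \<subseteq> fixed" "horner cs y = \<zero>" for cs
  proof (rule vanishing_at_nodes[OF y(1) inj _ that(1)])
    show csc: "set cs \<subseteq> carrier R" using that(2) fixedD(1) by blast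
    fix j
    have "map (\<sigma> ^^ j) cs = cs" using that(2) pow_fixed by (intro map_idI) auto
    hence "horner cs ((\<sigma> ^^ j) y) = (\<sigma> ^^ j) (horner cs y)" using horner_ring_hom[OF pow_hom csc y(1), of j] by simp
    also have "\<dots> = \<zero>" unfolding that(3) by (induction j) auto
    finally show "horner cs ((\<sigma> ^^ j) y) = \<zero>" .
  qed
  show ?thesis by (rule that[OF y(1) span indep])
qed

theorem principal_imp_monogenous:
  assumes "principalideal I\<^sub>G R"
  shows "monogenous R fixed"
proof -
  obtain y where y: "y \<in> carrier R" "\<And>f. f \<in> carrier R \<Longrightarrow> \<exists>cs. length cs = p \<and> set cs \<subseteq> fixed \<and> f = horner cs y"
    using power_basis[OF assms] by metis
  have A: "fixed \<subseteq> carrier R" unfolding fixed_def by blast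
  have "carrier R \<subseteq> simple_extension fixed y"
    using y(2) horner_simple_extension[OF _ A y(1)] by blast
  thus ?thesis unfolding monogenous_def using simple_extension_in_carrier[OF A y(1)] y(1) by blast
qed

text \<open>The elements \<open>b\<close> with \<open>\<delta> b \<in> (\<delta> y)\<close> are closed under the construction of \<open>A[y]\<close>, by the twisted product rule.\<close>

theorem monogenous_imp_principal:
  assumes "monogenous R fixed"
  shows "principalideal I\<^sub>G R"
proof -
  obtain y where y: "y \<in> carrier R" "carrier R = simple_extension fixed y" using assms unfolding monogenous_def by blast
  have D: "ideal (Idl {\<delta> y}) R" "\<delta> y \<in> Idl {\<delta> y}"
    using genideal_ideal[of "{\<delta> y}"] genideal_self'[of "\<delta> y"] y(1) by auto
  have "b \<in> carrier R \<and> \<delta> b \<in> Idl {\<delta> y}" if "b \<in> simple_extension fixed y" for b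
    using that
  proof (induction b rule: simple_extension.induct)
    case zero
    show ?case using \<delta>_fixed[of \<zero>] subringE(2)[OF fixed_subring] ideal_zero[OF D(1)] by simp
  next
    case (lin b a)
    have a: "a \<in> carrier R" "\<delta> a = \<zero>" using lin(2) fixedD(1) \<delta>_fixed by auto
    have "\<delta> (b \<otimes> y \<oplus> a) = \<sigma> b \<otimes> \<delta> y \<oplus> \<delta> b \<otimes> y"
      using lin.IH a y(1) by (simp add: \<delta>_add \<delta>_mult)
    moreover have "\<sigma> b \<otimes> \<delta> y \<in> Idl {\<delta> y}" "\<delta> b \<otimes> y \<in> Idl {\<delta> y}"
      using ideal_lmult[OF D(1) _ D(2)] ideal_rmult[OF D(1) y(1)] lin.IH by auto
    ultimately show ?case using ideal_add[OF D(1)] lin.IH a(1) y(1) by simp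
  qed
  hence "I\<^sub>G \<subseteq> Idl {\<delta> y}" using y(2) by (intro I\<^sub>G_minimal D(1)) blast
  moreover have "Idl {\<delta> y} \<subseteq> I\<^sub>G" using \<delta>_in_I\<^sub>G[OF y(1)] by (intro genideal_minimal I\<^sub>G_ideal) simp
  ultimately have "I\<^sub>G = Idl {\<delta> y}" by blast
  thus ?thesis by (intro principalidealI I\<^sub>G_ideal bexI[of _ "\<delta> y"]) (use y(1) in auto)
qed

end

section \<open>Free modules over subrings\<close>

lemma finsum_mult_module: "finsum (mult_module R) f S = finsum R f S"
  by (simp add: finsum_def finprod_def mult_module_def)

lemma mult_module_simps:
  "carrier (mult_module R) = carrier R" "a \<odot>\<^bsub>mult_module R\<^esub> b = a \<otimes>\<^bsub>R\<^esub> b"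
  by (simp_all add: mult_module_def)

context cring begin

lemma finite_module_basisI:
  assumes A: "subring A R" and S: "finite S" "S \<subseteq> carrier R"
    and span: "\<And>x. x \<in> carrier R \<Longrightarrow> \<exists>c \<in> S \<rightarrow> A. x = (\<Oplus>s\<in>S. c s \<otimes> s)"
    and indep: "\<And>c. \<lbrakk>c \<in> S \<rightarrow> A; (\<Oplus>s\<in>S. c s \<otimes> s) = \<zero>\<rbrakk> \<Longrightarrow> \<forall>s\<in>S. c s = \<zero>"
  shows "module_basis (R\<lparr>carrier := A\<rparr>) (mult_module R) S"
proof -
  have AR: "a \<in> carrier R" if "a \<in> A" for a using subringE(1)[OF A] that by blast
  have supp: "(\<Oplus>s\<in>{s \<in> S. c s \<noteq> \<zero>}. c s \<otimes> s) = (\<Oplus>s\<in>S. c s \<otimes> s)" if c: "c \<in> S \<rightarrow> A" for c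
  proof -
    have cc: "c s \<in> carrier R" "s \<in> carrier R" if "s \<in> S" for s using c that AR S(2) by auto
    have "(\<Oplus>s\<in>S. c s \<otimes> s) = (\<Oplus>s\<in>S. if c s \<noteq> \<zero> then c s \<otimes> s else \<zero>)"
      using cc by (intro finsum_cong') auto
    also have "\<dots> = (\<Oplus>s\<in>{s \<in> S. c s \<noteq> \<zero>}. c s \<otimes> s)"
      using cc S(1) by (intro finsum_filter) auto
    finally show ?thesis by simp
  qed
  have "\<exists>!c. c \<in> S \<rightarrow>\<^sub>E A \<and> finite {s \<in> S. c s \<noteq> \<zero>} \<and> x = (\<Oplus>s\<in>{s \<in> S. c s \<noteq> \<zero>}. c s \<otimes> s)"
    if x: "x \<in> carrier R" for x
  proof (rule ex_ex1I)
    obtain c where c: "c \<in> S \<rightarrow> A" "x = (\<Oplus>s\<in>S. c s \<otimes> s)" using span[OF x] by blast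
    have r: "restrict c S \<in> S \<rightarrow>\<^sub>E A" using c(1) by auto
    have "(\<Oplus>s\<in>S. restrict c S s \<otimes> s) = (\<Oplus>s\<in>S. c s \<otimes> s)"
      using c(1) AR S(2) by (intro finsum_cong') auto
    moreover have "restrict c S \<in> S \<rightarrow> A" using r by auto
    ultimately show "\<exists>c. c \<in> S \<rightarrow>\<^sub>E A \<and> finite {s \<in> S. c s \<noteq> \<zero>} \<and> x = (\<Oplus>s\<in>{s \<in> S. c s \<noteq> \<zero>}. c s \<otimes> s)"
      using r S(1) c(2) supp[of "restrict c S"] by (intro exI[of _ "restrict c S"]) simp
  next
    fix c d
    assume c: "c \<in> S \<rightarrow>\<^sub>E A \<and> finite {s \<in> S. c s \<noteq> \<zero>} \<and> x = (\<Oplus>s\<in>{s \<in> S. c s \<noteq> \<zero>}. c s \<otimes> s)"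
      and d: "d \<in> S \<rightarrow>\<^sub>E A \<and> finite {s \<in> S. d s \<noteq> \<zero>} \<and> x = (\<Oplus>s\<in>{s \<in> S. d s \<noteq> \<zero>}. d s \<otimes> s)"
    have cd: "c \<in> S \<rightarrow> A" "d \<in> S \<rightarrow> A" using c d by auto
    have cdc: "c s \<in> carrier R" "d s \<in> carrier R" "s \<in> carrier R" if "s \<in> S" for s using cd that AR S(2) by auto
    have "(\<Oplus>s\<in>S. c s \<otimes> s) = x" "(\<Oplus>s\<in>S. d s \<otimes> s) = x"
      using c d supp[OF cd(1)] supp[OF cd(2)] by auto
    hence "lincomb S (\<lambda>s. c s \<ominus> d s) (\<lambda>s _. s) () = x \<ominus> x"
      using cdc S(1) by (subst lincomb_diff) (auto simp: lincomb_def)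
    hence "(\<Oplus>s\<in>S. (c s \<ominus> d s) \<otimes> s) = \<zero>" using x by (simp add: lincomb_def minus_self)
    moreover have "(\<lambda>s. c s \<ominus> d s) \<in> S \<rightarrow> A"
      using cd unfolding a_minus_def by (auto intro!: subringE(7)[OF A] subringE(5)[OF A])
    ultimately have "\<forall>s\<in>S. c s \<ominus> d s = \<zero>" by (intro indep)
    hence "c s \<ominus> d s = \<zero>" if "s \<in> S" for s using that by blast
    hence "c s = d s" if "s \<in> S" for s using cdc[OF that] that r_right_minus_eq[of "c s" "d s"] by blast
    thus "c = d" using c d by (intro PiE_ext[of c S "\<lambda>_. A" d]) auto
  qed
  thus ?thesis
    unfolding module_basis_def finsum_mult_module mult_module_simps using S(2) by simp
qed

lemma free_module_free_extension:
  assumes A: "subring A R" and free: "free_module (R\<lparr>carrier := A\<rparr>) (mult_module R)"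
  obtains S where "free_extension R A S"
proof -
  have AR: "a \<in> carrier R" if "a \<in> A" for a using subringE(1)[OF A] that by blast
  obtain S where S: "S \<subseteq> carrier R" "\<And>x. x \<in> carrier R \<Longrightarrow>
      \<exists>!c. c \<in> S \<rightarrow>\<^sub>E A \<and> finite {s \<in> S. c s \<noteq> \<zero>} \<and> x = (\<Oplus>s\<in>{s \<in> S. c s \<noteq> \<zero>}. c s \<otimes> s)"
    using free unfolding free_module_def module_basis_def finsum_mult_module mult_module_simps by auto
  have "free_extension R A S"
  proof (intro free_extension.intro free_extension_axioms.intro is_cring A S(1))
    fix x assume x: "x \<in> carrier R"
    obtain c where c: "c \<in> S \<rightarrow>\<^sub>E A" "finite {s \<in> S. c s \<noteq> \<zero>}" "x = (\<Oplus>s\<in>{s \<in> S. c s \<noteq> \<zero>}. c s \<otimes> s)"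
      using ex1_implies_ex[OF S(2)[OF x]] by blast
    show "\<exists>F c. finite F \<and> F \<subseteq> S \<and> c \<in> F \<rightarrow> A \<and> x = (\<Oplus>s\<in>F. c s \<otimes> s)"
      using c by (intro exI[of _ "{s \<in> S. c s \<noteq> \<zero>}"] exI[of _ c]) auto
  next
    fix F c s
    assume F: "finite F" "F \<subseteq> S" and c: "c \<in> F \<rightarrow> A" "(\<Oplus>s\<in>F. c s \<otimes> s) = \<zero>" and s: "s \<in> F"
    have cc: "c s \<in> carrier R" "s \<in> carrier R" if "s \<in> F" for s using c(1) F(2) S(1) that AR by auto
    define c' where "c' = (\<lambda>s\<in>S. if s \<in> F then c s else \<zero>)"
    have supp: "{s \<in> S. c' s \<noteq> \<zero>} = {s \<in> F. c s \<noteq> \<zero>}" unfolding c'_def using F(2) by auto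
    have "(\<Oplus>s\<in>{s \<in> S. c' s \<noteq> \<zero>}. c' s \<otimes> s) = (\<Oplus>s\<in>{s \<in> F. c s \<noteq> \<zero>}. c s \<otimes> s)"
      unfolding supp using cc F(2) by (intro finsum_cong') (auto simp: c'_def)
    also have "\<dots> = (\<Oplus>s\<in>F. if c s \<noteq> \<zero> then c s \<otimes> s else \<zero>)"
      using cc F(1) by (intro finsum_filter[symmetric]) auto
    also have "\<dots> = (\<Oplus>s\<in>F. c s \<otimes> s)" using cc by (intro finsum_cong') auto
    finally have "(\<Oplus>s\<in>{s \<in> S. c' s \<noteq> \<zero>}. c' s \<otimes> s) = \<zero>" using c(2) by simp
    moreover have "c' \<in> S \<rightarrow>\<^sub>E A" unfolding c'_def using c(1) subringE(2)[OF A] by auto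
    moreover have "finite {s \<in> S. c' s \<noteq> \<zero>}" unfolding supp using F(1) by simp
    ultimately have 1: "c' \<in> S \<rightarrow>\<^sub>E A \<and> finite {s \<in> S. c' s \<noteq> \<zero>} \<and> \<zero> = (\<Oplus>s\<in>{s \<in> S. c' s \<noteq> \<zero>}. c' s \<otimes> s)"
      by simp
    define z where "z = (\<lambda>s\<in>S. \<zero>)"
    have "{s \<in> S. z s \<noteq> \<zero>} = {}" unfolding z_def by auto
    hence 2: "z \<in> S \<rightarrow>\<^sub>E A \<and> finite {s \<in> S. z s \<noteq> \<zero>} \<and> \<zero> = (\<Oplus>s\<in>{s \<in> S. z s \<noteq> \<zero>}. z s \<otimes> s)"
      unfolding z_def using subringE(2)[OF A] by (auto simp: finsum_empty)
    define Q where "Q c \<longleftrightarrow> c \<in> S \<rightarrow>\<^sub>E A \<and> finite {s \<in> S. c s \<noteq> \<zero>} \<and> \<zero> = (\<Oplus>s\<in>{s \<in> S. c s \<noteq> \<zero>}. c s \<otimes> s)" for c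
    have "\<exists>!c. Q c" unfolding Q_def by (rule S(2)[OF zero_closed])
    moreover have "Q c'" "Q z" unfolding Q_def by (rule 1, rule 2)
    ultimately have "c' = z" by blast
    hence "c' s = z s" by simp
    thus "c s = \<zero>" using s F(2) unfolding c'_def z_def by (auto simp: subset_eq)
  qed
  thus ?thesis using that by blast
qed

section \<open>Prime avoidance\<close>

lemma prime_avoidance_separate:
  assumes I: "ideal I R" "\<not> I \<subseteq> P" and P: "primeideal P R"
    and F: "finite F" "\<And>Q. Q \<in> F \<Longrightarrow> ideal Q R" "\<And>Q. Q \<in> F \<Longrightarrow> \<not> Q \<subseteq> P"
  shows "\<exists>y \<in> I - P. \<forall>Q\<in>F. y \<in> Q"
  using F
proof (induction F rule: finite_induct)
  case empty
  thus ?case using I(2) by blast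
next
  case (insert Q F)
  then obtain y where y: "y \<in> I" "y \<notin> P" "\<And>Q. Q \<in> F \<Longrightarrow> y \<in> Q" by auto
  obtain e where e: "e \<in> Q" "e \<notin> P" using insert.prems(2)[of Q] by auto
  have Qi: "ideal Q R" using insert.prems(1) by simp
  have c: "y \<in> carrier R" "e \<in> carrier R"
    using ideal_mem_carrier[OF I(1) y(1)] ideal_mem_carrier[OF Qi e(1)] by auto
  have "e \<otimes> y \<notin> P" using primeideal.I_prime[OF P c(2,1)] y(2) e(2) by blast
  moreover have "e \<otimes> y \<in> I" by (rule ideal_lmult[OF I(1) c(2) y(1)])
  moreover have "e \<otimes> y \<in> Q" by (rule ideal_rmult[OF Qi c(1) e(1)])
  moreover have "e \<otimes> y \<in> Q'" if "Q' \<in> F" for Q'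
    using ideal_lmult[OF _ c(2) y(3)[OF that]] insert.prems(1)[of Q'] that by simp
  ultimately show ?case by blast
qed

lemma prime_avoidance:
  assumes I: "ideal I R" and F: "finite F" "\<And>P. P \<in> F \<Longrightarrow> primeideal P R" "I \<subseteq> \<Union>F"
  shows "\<exists>P\<in>F. I \<subseteq> P"
proof (rule ccontr)
  assume "\<not> ?thesis"
  hence no: "\<And>P. P \<in> F \<Longrightarrow> \<not> I \<subseteq> P" by blast
  have "\<exists>x\<in>I. x \<notin> \<Union>G" if "finite G" "G \<subseteq> F" for G
    using that
  proof (induction "card G" arbitrary: G rule: less_induct)
    case less
    show ?case
    proof (cases "G = {}")
      case True
      thus ?thesis using ideal_zero[OF I] by blast
    next
      case False
      then obtain P where PG: "P \<in> G" by blast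
      let ?G = "G - {P}"
      have card: "card ?G < card G" using PG less.prems(1) by (intro card_Diff1_less)
      have P: "primeideal P R" "\<not> I \<subseteq> P" using F(2) no PG less.prems(2) by auto
      have G': "finite ?G" "?G \<subseteq> F" using less.prems by auto
      obtain x where x: "x \<in> I" "x \<notin> \<Union>?G" using less.hyps[OF card G'] by blast
      show ?thesis
      proof (cases "\<exists>Q\<in>?G. Q \<subseteq> P")
        case True
        then obtain Q where Q: "Q \<in> G" "Q \<noteq> P" "Q \<subseteq> P" by blast
        let ?H = "G - {Q}"
        have "card ?H < card G" using Q less.prems(1) by (intro card_Diff1_less)
        moreover have "finite ?H" "?H \<subseteq> F" using less.prems by auto
        ultimately obtain z where z: "z \<in> I" "z \<notin> \<Union>?H" using less.hyps by blast
        have "\<Union>G = \<Union>?H" using Q PG by blast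
        thus ?thesis using z by (intro bexI[of _ z]) auto
      next
        case nsub: False
        show ?thesis
        proof (cases "x \<in> P")
          case False
          thus ?thesis using x by blast
        next
          case True
          have Qi: "ideal Q R" if "Q \<in> ?G" for Q using F(2) that G'(2) primeideal.axioms(1) by blast
          obtain y where y: "y \<in> I - P" "\<forall>Q\<in>?G. y \<in> Q"
            using prime_avoidance_separate[OF I P(2,1) G'(1) Qi] nsub by blast
          have c: "x \<in> carrier R" "y \<in> carrier R" using x(1) y(1) ideal_mem_carrier[OF I] by auto
          have "x \<oplus> y \<notin> P"
            using ideal_add_cancel[OF primeideal.axioms(1)[OF P(1)], of y x] True y(1) c by (auto simp: a_comm)
          moreover have "x \<oplus> y \<notin> Q" if "Q \<in> ?G" for Q
            using ideal_add_cancel[OF Qi[OF that], of x y] y(2) x(2) c that by blast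
          ultimately have "x \<oplus> y \<notin> \<Union>G" by blast
          moreover have "x \<oplus> y \<in> I" using ideal_add[OF I x(1)] y(1) by blast
          ultimately show ?thesis by blast
        qed
      qed
    qed
  qed
  thus False using F(1,3) by blast
qed

end

section \<open>The fixed ring\<close>

context prime_order_automorphism begin

abbreviation A :: "('a, 'b) ring_scheme" where "A \<equiv> R\<lparr>carrier := fixed\<rparr>"

lemma fixed_ring_cring: "cring A" by (rule subring_cring[OF fixed_subring])

lemma fixed_inverse:
  assumes "a \<in> fixed" "a \<notin> max_ideal R"
  shows "inv a \<in> fixed" "inv a \<otimes> a = \<one>"
proof -
  have a: "a \<in> carrier R" "\<sigma> a = a" using assms(1) fixedD by auto
  have u: "a \<in> Units R" using Units_iff_notin_max_ideal[OF a(1)] assms(2) by blast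
  have i: "inv a \<in> carrier R" "inv a \<otimes> a = \<one>" using u by auto
  have "\<sigma> (inv a) \<otimes> a = \<sigma> (inv a \<otimes> a)" unfolding \<sigma>.hom_mult[OF i(1) a(1)] a(2) by (rule refl)
  also have "\<dots> = inv a \<otimes> a" unfolding i(2) by simp
  finally have "\<sigma> (inv a) \<otimes> a = inv a \<otimes> a" .
  moreover have "a \<noteq> \<zero>" using assms(2) ideal_zero[OF max_ideal_ideal] by blast
  ultimately have "\<sigma> (inv a) = inv a" using m_rcancel[of a "\<sigma> (inv a)" "inv a"] a(1) i(1) by simp
  thus "inv a \<in> fixed" "inv a \<otimes> a = \<one>" using i unfolding fixed_def by auto
qed

lemma fixed_ring_local: "local_ring A" "max_ideal A = fixed \<inter> max_ideal R"
proof -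
  interpret A: cring A by (rule fixed_ring_cring)
  note M = ideal_axioms_mem[OF max_ideal_ideal] and F = subringE[OF fixed_subring]
  have I: "ideal (fixed \<inter> max_ideal R) A"
    by (rule A.cring_idealI) (use M F fixedD in auto)
  have "\<one>\<^bsub>A\<^esub> \<notin> fixed \<inter> max_ideal R" using one_notin_max_ideal by simp
  moreover have "a \<in> Units A" if a: "a \<in> carrier A" "a \<notin> fixed \<inter> max_ideal R" for a
  proof -
    have "a \<in> fixed" "a \<notin> max_ideal R" using a by auto
    from fixed_inverse[OF this] have i: "inv a \<in> fixed" "inv a \<otimes> a = \<one>" .
    hence "a \<otimes> inv a = \<one>" using \<open>a \<in> fixed\<close> fixedD(1) by (simp add: m_comm)
    thus ?thesis unfolding Units_def using i \<open>a \<in> fixed\<close> by auto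
  qed
  ultimately show "local_ring A" "max_ideal A = fixed \<inter> max_ideal R"
    using A.local_ring_by_units[OF I] by blast+
qed

lemma fixed_ring_free:
  assumes "principalideal I\<^sub>G R"
  shows "free_module A (mult_module R)"
proof -
  obtain y where y: "y \<in> carrier R"
    "\<And>f. f \<in> carrier R \<Longrightarrow> \<exists>cs. length cs = p \<and> set cs \<subseteq> fixed \<and> f = horner cs y"
    "\<And>cs. \<lbrakk>length cs \<le> p; set cs \<subseteq> fixed; horner cs y = \<zero>\<rbrakk> \<Longrightarrow> set cs \<subseteq> {\<zero>}"
    by (rule power_basis[OF assms]) (rule that)
  note F = subringE[OF fixed_subring]
  let ?e = "\<lambda>i. y [^] i"
  have ev: "horner (map c [0..<p]) y = (\<Oplus>i\<in>{..<p}. c i \<otimes> ?e i)" if "\<And>i. i < p \<Longrightarrow> c i \<in> fixed" for c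
  proof -
    have "set (map c [0..<p]) \<subseteq> carrier R" using that fixedD(1) by auto
    hence "horner (map c [0..<p]) y = (\<Oplus>i\<in>{..<p}. map c [0..<p] ! i \<otimes> ?e i)"
      using horner_eq_finsum[of "map c [0..<p]" y] y(1) by simp
    also have "\<dots> = (\<Oplus>i\<in>{..<p}. c i \<otimes> ?e i)" using that fixedD(1) y(1) by (intro finsum_cong') auto
    finally show ?thesis .
  qed
  have indep: "c i = \<zero>" if "\<And>i. i < p \<Longrightarrow> c i \<in> fixed" "(\<Oplus>i\<in>{..<p}. c i \<otimes> ?e i) = \<zero>" "i < p" for c i
    using y(3)[of "map c [0..<p]"] ev[of c] that by (auto simp: image_subset_iff)
  have inj: "inj_on ?e {..<p}"
  proof (rule inj_onI)
    fix i j assume ij: "i \<in> {..<p}" "j \<in> {..<p}" "?e i = ?e j"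
    show "i = j"
    proof (rule ccontr)
      assume ne: "i \<noteq> j"
      define c where "c k = (if k = i then \<one> else if k = j then \<ominus> \<one> else \<zero>)" for k
      have cF: "c k \<in> fixed" for k unfolding c_def using F by auto
      have cc: "c k \<otimes> ?e k \<in> carrier R" for k using cF fixedD(1) y(1) by auto
      have "{..<p} = insert i (insert j ({..<p} - {i, j}))" using ij by auto
      hence "(\<Oplus>k\<in>{..<p}. c k \<otimes> ?e k) = (\<Oplus>k\<in>insert i (insert j ({..<p} - {i, j})). c k \<otimes> ?e k)" by simp
      also have "\<dots> = c i \<otimes> ?e i \<oplus> (c j \<otimes> ?e j \<oplus> (\<Oplus>k\<in>{..<p} - {i, j}. c k \<otimes> ?e k))"
        using ne cc by (simp add: finsum_insert Pi_iff)
      also have "(\<Oplus>k\<in>{..<p} - {i, j}. c k \<otimes> ?e k) = \<zero>"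
        unfolding c_def using y(1) by (intro add.finprod_one_eqI) auto
      also have "c i \<otimes> ?e i \<oplus> (c j \<otimes> ?e j \<oplus> \<zero>) = \<zero>"
        unfolding c_def ij(3) using ne y(1) by (simp add: l_minus r_neg)
      finally have "c i = \<zero>" using indep[of c i] cF ij(1) by blast
      thus False unfolding c_def by simp
    qed
  qed
  define S where "S = ?e ` {..<p}"
  have S: "finite S" "S \<subseteq> carrier R" unfolding S_def using y(1) by auto
  have sumS: "(\<Oplus>s\<in>S. c s \<otimes> s) = (\<Oplus>i\<in>{..<p}. c (?e i) \<otimes> ?e i)" if "c \<in> S \<rightarrow> fixed" for c
    unfolding S_def
  proof (rule finsum_reindex[OF _ inj])
    show "(\<lambda>s. c s \<otimes> s) \<in> ?e ` {..<p} \<rightarrow> carrier R" using that S(2) fixedD(1) unfolding S_def by auto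
  qed
  have "module_basis A (mult_module R) S"
  proof (rule finite_module_basisI[OF fixed_subring S])
    fix f assume "f \<in> carrier R"
    then obtain cs where cs: "length cs = p" "set cs \<subseteq> fixed" "f = horner cs y" using y(2) by blast
    define c where "c s = cs ! (the_inv_into {..<p} ?e s)" for s
    have ce: "c (?e i) = cs ! i" if "i < p" for i unfolding c_def using the_inv_into_f_f[OF inj] that by simp
    have csF: "cs ! i \<in> fixed" if "i < p" for i using cs that by auto
    have cF: "c \<in> S \<rightarrow> fixed" unfolding S_def using ce csF by auto
    have "set cs \<subseteq> carrier R" using cs(2) fixedD(1) by blast
    hence "f = (\<Oplus>i\<in>{..<p}. cs ! i \<otimes> ?e i)" using horner_eq_finsum[of cs y] cs y(1) by simp
    also have "\<dots> = (\<Oplus>i\<in>{..<p}. c (?e i) \<otimes> ?e i)"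
      using ce csF fixedD(1) y(1) by (intro finsum_cong') auto
    also have "\<dots> = (\<Oplus>s\<in>S. c s \<otimes> s)" by (rule sumS[OF cF, symmetric])
    finally show "\<exists>c\<in>S \<rightarrow> fixed. f = (\<Oplus>s\<in>S. c s \<otimes> s)" using cF by blast
  next
    fix c assume c: "c \<in> S \<rightarrow> fixed" "(\<Oplus>s\<in>S. c s \<otimes> s) = \<zero>"
    have "c (?e i) = \<zero>" if "i < p" for i
      using indep[of "\<lambda>i. c (?e i)" i] c sumS[OF c(1)] that unfolding S_def by auto
    thus "\<forall>s\<in>S. c s = \<zero>" unfolding S_def by auto
  qed
  thus ?thesis
    unfolding free_module_def using module_mult_module[OF is_cring fixed_subring] by blast
qed

section \<open>The dimension of the fixed ring\<close>

text \<open>The product of the first \<open>k\<close> conjugates of \<open>b\<close>; for \<open>k = p\<close> this is the norm to the fixed ring.\<close>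

primrec norm :: "nat \<Rightarrow> 'a \<Rightarrow> 'a" where
  "norm 0 b = \<one>"
| "norm (Suc k) b = norm k b \<otimes> (\<sigma> ^^ k) b"

lemma norm_closed [simp]: "b \<in> carrier R \<Longrightarrow> norm k b \<in> carrier R"
  by (induction k) auto

text \<open>For a product of conjugates, \<open>\<sigma>\<close> removes the first factor \<open>b\<close> and appends \<open>\<sigma>\<^sup>k b\<close>; both sides carry the factor \<open>b\<close> in
  place of a division.\<close>

lemma \<sigma>_norm: "b \<in> carrier R \<Longrightarrow> \<sigma> (norm k b) \<otimes> b = norm k b \<otimes> (\<sigma> ^^ k) b"
proof (induction k)
  case (Suc k)
  define n where "n = norm k b"
  define s where "s = (\<sigma> ^^ k) b"
  have c: "n \<in> carrier R" "s \<in> carrier R" "\<sigma> n \<in> carrier R" "\<sigma> s \<in> carrier R" unfolding n_def s_def using Suc.prems by auto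
  have IH: "\<sigma> n \<otimes> b = n \<otimes> s" using Suc unfolding n_def s_def by simp
  have "\<sigma> (n \<otimes> s) \<otimes> b = (\<sigma> n \<otimes> b) \<otimes> \<sigma> s" using c Suc.prems by (simp add: m_ac)
  also have "\<dots> = (n \<otimes> s) \<otimes> \<sigma> s" by (simp only: IH)
  finally show ?case unfolding n_def s_def by simp
qed simp

lemma norm_fixed:
  assumes "b \<in> carrier R"
  shows "norm p b \<in> fixed"
proof (cases "b = \<zero>")
  case True
  obtain m where "p = Suc m" using p_pos by (cases p) auto
  moreover have "(\<sigma> ^^ k) \<zero> = \<zero>" for k by (induction k) auto
  ultimately have "norm p b = \<zero>" using True by simp
  thus ?thesis using subringE(2)[OF fixed_subring] by simp
next
  case False
  have "\<sigma> (norm p b) \<otimes> b = norm p b \<otimes> b" using \<sigma>_norm[OF assms, of p] \<sigma>_period[OF assms] by simp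
  hence "\<sigma> (norm p b) = norm p b" using m_rcancel[OF False assms] assms by simp
  thus ?thesis unfolding fixed_def using assms by simp
qed

lemma norm_mem_ideal:
  assumes "ideal Q R" "b \<in> Q" "0 < k"
  shows "norm k b \<in> Q"
  using assms(3)
proof (induction k)
  case (Suc k)
  have b: "b \<in> carrier R" using ideal_mem_carrier[OF assms(1,2)] .
  show ?case
  proof (cases "k = 0")
    case True
    thus ?thesis using assms(2) b by simp
  next
    case False
    thus ?thesis using Suc ideal_rmult[OF assms(1), of "(\<sigma> ^^ k) b" "norm k b"] b by simp
  qed
qed simp

lemma norm_mem_prime:
  assumes "primeideal P R" "b \<in> carrier R" "norm k b \<in> P"
  shows "\<exists>i<k. (\<sigma> ^^ i) b \<in> P"
  using assms(3)
proof (induction k)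
  case 0
  thus ?case using prime_one_notin[OF assms(1)] by simp
next
  case (Suc k)
  hence "norm k b \<in> P \<or> (\<sigma> ^^ k) b \<in> P"
    using primeideal.I_prime[OF assms(1), of "norm k b" "(\<sigma> ^^ k) b"] assms(2) by simp
  thus ?case using Suc.IH less_Suc_eq by blast
qed

lemma prime_preimage:
  assumes P: "primeideal P R"
  shows "primeideal {b \<in> carrier R. (\<sigma> ^^ i) b \<in> P} R" (is "primeideal ?Q R")
proof (rule primeidealI)
  interpret P: primeideal P R by fact
  interpret i: ring_hom_ring R R "\<sigma> ^^ i" by (rule ring_hom_ringI2[OF ring_axioms ring_axioms pow_hom])
  show "ideal ?Q R"
    by (rule cring_idealI) (auto simp: ideal_zero[OF P.is_ideal] ideal_add[OF P.is_ideal] ideal_lmult[OF P.is_ideal])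
  show "carrier R \<noteq> ?Q" using prime_one_notin[OF P] by (metis (mono_tags) i.hom_one mem_Collect_eq one_closed)
  show "a \<in> ?Q \<or> b \<in> ?Q" if "a \<in> carrier R" "b \<in> carrier R" "a \<otimes> b \<in> ?Q" for a b
    using P.I_prime[of "(\<sigma> ^^ i) a" "(\<sigma> ^^ i) b"] that by auto
qed (rule cring_axioms)

text \<open>If \<open>P \<subseteq> Q\<close> have the same contraction, then the norm of an element of \<open>Q\<close> lies in \<open>P\<close>, so \<open>Q\<close> is covered by
  the conjugates of \<open>P\<close> and hence contained in one of them.\<close>

lemma contraction_strict:
  assumes P: "primeideal P R" and Q: "primeideal Q R" and PQ: "P \<subset> Q"
  shows "P \<inter> fixed \<subset> Q \<inter> fixed"
proof -
  note Qi = primeideal.axioms(1)[OF Q]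
  have "P \<inter> fixed \<noteq> Q \<inter> fixed"
  proof
    assume eq: "P \<inter> fixed = Q \<inter> fixed"
    let ?P = "\<lambda>i. {b \<in> carrier R. (\<sigma> ^^ i) b \<in> P}"
    have "Q \<subseteq> \<Union>(?P ` {..<p})"
    proof
      fix b assume b: "b \<in> Q"
      hence bc: "b \<in> carrier R" using ideal_mem_carrier[OF Qi] by blast
      have "norm p b \<in> Q \<inter> fixed" using norm_mem_ideal[OF Qi b p_pos] norm_fixed[OF bc] by blast
      hence "norm p b \<in> P" using eq by blast
      thus "b \<in> \<Union>(?P ` {..<p})" using norm_mem_prime[OF P bc] bc by auto
    qed
    then obtain i where "Q \<subseteq> ?P i" using prime_avoidance[OF Qi, of "?P ` {..<p}"] prime_preimage[OF P] by auto
    hence i: "(\<sigma> ^^ i) b \<in> P" if "b \<in> Q" for b using that by blast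
    \<comment> \<open>\<open>\<sigma>\<^sup>i Q \<subseteq> P \<subseteq> Q\<close> can be iterated, and the \<open>p\<close>-th power of \<open>\<sigma>\<^sup>i\<close> is the identity\<close>
    have "(\<sigma> ^^ (i * j)) b \<in> P" if "b \<in> Q" "0 < j" for b j
      using that(2)
    proof (induction j)
      case (Suc j)
      have "(\<sigma> ^^ (i * j)) b \<in> Q"
        using Suc.IH PQ that(1) by (cases "j = 0") auto
      hence "(\<sigma> ^^ i) ((\<sigma> ^^ (i * j)) b) \<in> P" by (rule i)
      thus ?case by (simp add: funpow_add)
    qed simp
    from this[OF _ p_pos] have "(\<sigma> ^^ (p * i)) b \<in> P" if "b \<in> Q" for b
      using that by (simp add: mult.commute)
    hence "b \<in> P" if "b \<in> Q" for b
      using pow_period[OF ideal_mem_carrier[OF Qi that], of i] that by metis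
    thus False using PQ by blast
  qed
  thus ?thesis using PQ by blast
qed

lemma contraction_prime:
  assumes P: "primeideal P R"
  shows "primeideal (P \<inter> fixed) A"
proof -
  interpret A: cring A by (rule fixed_ring_cring)
  interpret P: primeideal P R by fact
  note F = subringE[OF fixed_subring]
  show ?thesis
  proof (rule primeidealI)
    show "ideal (P \<inter> fixed) A"
      by (rule A.cring_idealI) (use F fixedD ideal_axioms_mem[OF P.is_ideal] in auto)
    show "carrier A \<noteq> P \<inter> fixed" using prime_one_notin[OF P] F(3) by auto
    show "a \<in> P \<inter> fixed \<or> b \<in> P \<inter> fixed" if "a \<in> carrier A" "b \<in> carrier A" "a \<otimes>\<^bsub>A\<^esub> b \<in> P \<inter> fixed" for a b
      using P.I_prime[of a b] that fixedD(1) by auto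
  qed (rule fixed_ring_cring)
qed

lemma contraction_prime_chain:
  "prime_chain R n P \<Longrightarrow> prime_chain A n (\<lambda>i. P i \<inter> fixed)"
  unfolding prime_chain_def using contraction_prime contraction_strict by simp

end

section \<open>Regularity of the fixed ring\<close>

context prime_order_automorphism begin

text \<open>The resolution is taken over the fixed ring and is exact over \<open>R\<close> by freeness. The number of generators of the
  maximal ideal of the fixed ring is bounded from above by the length of the resolution, hence by the dimension of \<open>R\<close>,
  and from below by the length of a contracted chain of primes.\<close>

theorem fixed_ring_regular:
  assumes reg: "regular_local_ring R" and free: "free_module A (mult_module R)"
  shows "regular_local_ring A"
proof -
  obtain S where "free_extension R fixed S" using free_module_free_extension[OF fixed_subring free] .
  then interpret E: free_extension R fixed S .
  have noeth: "noetherian_ring R" using reg unfolding regular_local_ring_def by blast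
  interpret R: noetherian_local_ring R
    by (intro noetherian_local_ring.intro noetherian_cring.intro noeth cring_axioms local_ring_axioms)
  have noethA: "noetherian_ring A"
    using fixed_inverse by (intro E.noetherian_descent[OF noeth max_ideal_ideal one_notin_max_ideal]) blast
  interpret A: noetherian_local_ring A
    by (intro noetherian_local_ring.intro noetherian_cring.intro noethA fixed_ring_cring fixed_ring_local(1))
  obtain ys where ys: "regular_system_of_parameters R ys" using reg unfolding regular_local_ring_def by blast
  have dim: "krull_dim R = enat (length ys)" and M: "Idl (set ys) = max_ideal R"
    using ys unfolding regular_system_of_parameters_def by auto
  obtain T D where "minimal_resolution A T D" by (rule A.exists_minimal_resolution)
  then interpret F: minimal_resolution A T D .
  have D: "D k j i \<in> fixed" "D k j i \<in> max_ideal R" if "j \<in> T (Suc k)" "i \<in> T k" for k j i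
    using F.D_max_ideal[OF that] fixed_ring_local(2) by auto
  have lc: "A.lincomb (T (Suc k)) c (D k) i = lincomb (T (Suc k)) c (D k) i"
    if "\<And>j. j \<in> T (Suc k) \<Longrightarrow> c j \<in> fixed" "i \<in> T k" for k c i
    using that D(1) by (intro lincomb_subring[OF fixed_subring]) auto
  have "T (Suc (length ys)) = {}"
  proof (rule minimal_exact_complex_bounded[where D = D])
    show "finite (T k)" for k by (rule F.finite_T)
    show "D k j i \<in> max_ideal R" if "j \<in> T (Suc k)" "i \<in> T k" for k j i by (rule D(2)[OF that])
    show "lincomb (T (Suc k)) (D (Suc k) l) (D k) i = \<zero>" if "l \<in> T (Suc (Suc k))" "i \<in> T k" for k l i
      using F.complex[OF that] lc[of k "D (Suc k) l" i] D(1)[OF that(1)] that(2) by simp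
    show "\<exists>e\<in>T (Suc (Suc k)) \<rightarrow> carrier R. \<forall>j\<in>T (Suc k). c j = lincomb (T (Suc (Suc k))) e (D (Suc k)) j"
      if c: "c \<in> T (Suc k) \<rightarrow> carrier R" "\<And>i. i \<in> T k \<Longrightarrow> lincomb (T (Suc k)) c (D k) i = \<zero>" for k c
    proof (rule E.exact_base_change[OF F.finite_T F.finite_T _ _ _ c])
      fix a assume a: "a \<in> T (Suc k) \<rightarrow> fixed" and rel: "\<And>i. i \<in> T k \<Longrightarrow> lincomb (T (Suc k)) a (D k) i = \<zero>"
      have "a \<in> T (Suc k) \<rightarrow> carrier A" using a by simp
      moreover have "A.lincomb (T (Suc k)) a (D k) i = \<zero>\<^bsub>A\<^esub>" if "i \<in> T k" for i
        using lc[of k a i] a rel[OF that] that by auto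
      ultimately obtain e where e: "e \<in> T (Suc (Suc k)) \<rightarrow> carrier A"
        "\<And>j. j \<in> T (Suc k) \<Longrightarrow> a j = A.lincomb (T (Suc (Suc k))) e (D (Suc k)) j"
        using F.exact_Suc[of a k] by blast
      have "a j = lincomb (T (Suc (Suc k))) e (D (Suc k)) j" if "j \<in> T (Suc k)" for j
        using e(2)[OF that] lc[of "Suc k" e j] e(1) that by auto
      thus "\<exists>e\<in>T (Suc (Suc k)) \<rightarrow> fixed. \<forall>j\<in>T (Suc k). a j = lincomb (T (Suc (Suc k))) e (D (Suc k)) j"
        using e(1) by auto
    qed (use D(1) in auto)
    show "regular_sequence R ys" by (rule R.regular_system_of_parameters_regular_sequence[OF ys])
  qed (rule M)
  hence card: "card (T (Suc 0)) \<le> length ys" using F.T_nonempty[of "Suc (length ys)"] by linarith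
  define xs where "xs = map F.gen (sorted_list_of_set (T (Suc 0)))"
  have xs: "set xs = F.gen ` T (Suc 0)" "length xs = card (T (Suc 0))"
    unfolding xs_def using F.finite_T by simp_all
  have xsA: "set xs \<subseteq> carrier A" unfolding xs(1) using F.gen_carrier by blast
  have xsM: "Idl\<^bsub>A\<^esub> (set xs) = max_ideal A"
  proof
    show "Idl\<^bsub>A\<^esub> (set xs) \<subseteq> max_ideal A"
      unfolding xs(1) using F.gen_max_ideal by (intro A.genideal_minimal A.max_ideal_ideal) blast
    show "max_ideal A \<subseteq> Idl\<^bsub>A\<^esub> (set xs)"
    proof
      fix a assume "a \<in> max_ideal A"
      then obtain c where c: "c \<in> T (Suc 0) \<rightarrow> carrier A" "a = A.lincomb (T (Suc 0)) c (D 0) 0"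
        using F.exact_0 by blast
      have "D 0 j 0 \<in> Idl\<^bsub>A\<^esub> (set xs)" if "j \<in> T (Suc 0)" for j
        using A.genideal_self[OF xsA] that unfolding xs(1) F.gen_def by blast
      thus "a \<in> Idl\<^bsub>A\<^esub> (set xs)"
        unfolding c(2) using c(1) by (intro A.lincomb_mem_ideal' A.genideal_ideal xsA) auto
    qed
  qed
  have upper: "n \<le> length xs" if P: "prime_chain A n P" for n P
  proof (rule A.prime_chain_length_le_generators[OF A.zeroideal xsA P _ _ A.max_ideal_prime])
    show "{\<zero>\<^bsub>A\<^esub>} \<subseteq> P 0" using A.ideal_zero[OF primeideal.axioms(1)[OF prime_chainD(1)[OF P, of 0]]] by simp
    have "Idl\<^bsub>A\<^esub> (set xs \<union> {\<zero>\<^bsub>A\<^esub>}) = Idl\<^bsub>A\<^esub> (set xs)"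
    proof
      note I = A.genideal_ideal[OF xsA] A.genideal_self[OF xsA]
      show "Idl\<^bsub>A\<^esub> (set xs \<union> {\<zero>\<^bsub>A\<^esub>}) \<subseteq> Idl\<^bsub>A\<^esub> (set xs)"
        using I A.ideal_zero[OF I(1)] by (intro A.genideal_minimal) auto
      have "set xs \<union> {\<zero>\<^bsub>A\<^esub>} \<subseteq> carrier A" using xsA A.zero_closed by blast
      thus "Idl\<^bsub>A\<^esub> (set xs) \<subseteq> Idl\<^bsub>A\<^esub> (set xs \<union> {\<zero>\<^bsub>A\<^esub>})" by (intro A.subset_Idl_subset) auto
    qed
    thus "Idl\<^bsub>A\<^esub> ({\<zero>\<^bsub>A\<^esub>} \<union> set xs) = max_ideal A" using xsM by (simp only: Un_commute)
    show "P n \<subseteq> max_ideal A" by (rule A.prime_le_max_ideal[OF prime_chainD(1)[OF P]]) simp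
  qed
  obtain P where "prime_chain R (length ys) P" by (rule krull_dim_attained[OF dim])
  hence chain: "prime_chain A (length ys) (\<lambda>i. P i \<inter> fixed)" by (rule contraction_prime_chain)
  have len: "length xs = length ys" using upper[OF chain] card xs(2) by simp
  have "krull_dim A \<le> enat (length xs)"
    unfolding krull_dim_eq_Sup using upper by (intro Sup_least) auto
  hence "krull_dim A = enat (length xs)"
    using prime_chain_le_krull_dim[OF chain] unfolding len by (rule antisym)
  hence "regular_system_of_parameters A xs"
    unfolding regular_system_of_parameters_def using xsA xsM by simp
  thus ?thesis unfolding regular_local_ring_def using fixed_ring_local(1) noethA by blast
qed

section \<open>Pseudo-reflections\<close>

text \<open>By the product rule, \<open>\<delta>\<close> maps \<open>\<mm>\<close> into \<open>(\<delta> y\<^sub>1) + \<mm> I\<^sub>G\<close> if the other generators are invariant. The values on \<open>\<mm>\<close> are all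
  values of \<open>\<delta>\<close>, because each element of the ring is the sum of an invariant and an element of \<open>\<mm>\<close>. Now Nakayama applies.\<close>

lemma pseudo_reflection_imp_principal:
  assumes noeth: "noetherian_ring R" and res: "\<And>b. b \<in> carrier R \<Longrightarrow> \<exists>a \<in> fixed. b \<ominus> a \<in> max_ideal R"
    and ys: "set ys \<subseteq> carrier R" "Idl (set ys) = max_ideal R" "set (tl ys) \<subseteq> fixed"
  shows "principalideal I\<^sub>G R"
proof -
  interpret R: noetherian_local_ring R
    by (intro noetherian_local_ring.intro noetherian_cring.intro noeth cring_axioms local_ring_axioms)
  obtain t where t: "t \<in> I\<^sub>G" "\<And>y. y \<in> set ys \<Longrightarrow> \<delta> y \<in> Idl {t}"
  proof (cases ys)
    case Nil
    thus ?thesis using that[of \<zero>] ideal_zero[OF I\<^sub>G_ideal] by simp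
  next
    case (Cons y zs)
    have y: "y \<in> carrier R" using ys(1) Cons by simp
    have D: "ideal (Idl {\<delta> y}) R" "\<delta> y \<in> Idl {\<delta> y}"
      using genideal_ideal[of "{\<delta> y}"] genideal_self'[of "\<delta> y"] y by auto
    show ?thesis
    proof (rule that[OF \<delta>_in_I\<^sub>G[OF y]])
      fix z assume "z \<in> set ys"
      hence "z = y \<or> z \<in> fixed" using Cons ys(3) by auto
      thus "\<delta> z \<in> Idl {\<delta> y}" using D \<delta>_fixed ideal_zero[OF D(1)] by auto
    qed
  qed
  have tc: "t \<in> carrier R" using ideal_mem_carrier[OF I\<^sub>G_ideal t(1)] .
  have Jt: "ideal (Idl {t}) R" using tc by (intro genideal_ideal) simp
  have "I\<^sub>G \<subseteq> Idl {t}"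
  proof (rule R.local_nakayama[OF I\<^sub>G_ideal Jt])
    let ?S = "Idl {t} \<union> {p \<otimes> f | p f. p \<in> max_ideal R \<and> f \<in> I\<^sub>G}"
    let ?N = "Idl ?S"
    have S: "?S \<subseteq> carrier R"
      using ideal_mem_carrier[OF Jt] ideal_mem_carrier[OF I\<^sub>G_ideal] mem_max_ideal_carrier by auto
    have N: "ideal ?N R" and SN: "?S \<subseteq> ?N" using genideal_ideal[OF S] genideal_self[OF S] by auto
    let ?K = "{m \<in> max_ideal R. \<delta> m \<in> ?N}"
    note M = ideal_axioms_mem[OF max_ideal_ideal]
    have K: "ideal ?K R"
    proof (rule cring_idealI)
      show "?K \<subseteq> carrier R" using M(1) by blast
      have "\<delta> \<zero> = \<zero>" using \<delta>_fixed subringE(2)[OF fixed_subring] by blast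
      thus "\<zero> \<in> ?K" using M(2) ideal_zero[OF N] by simp
      show "a \<oplus> b \<in> ?K" if "a \<in> ?K" "b \<in> ?K" for a b
        using that M(3) ideal_add[OF N] \<delta>_add M(1) by simp
      show "r \<otimes> m \<in> ?K" if r: "r \<in> carrier R" and m: "m \<in> ?K" for r m
      proof -
        have mM: "m \<in> max_ideal R" "\<delta> m \<in> ?N" "m \<in> carrier R" using m M(1) by auto
        have "m \<otimes> \<delta> r \<in> ?N" using SN mM(1) \<delta>_in_I\<^sub>G[OF r] by blast
        moreover have "\<sigma> r \<otimes> \<delta> m \<in> ?N" using ideal_lmult[OF N _ mM(2), of "\<sigma> r"] r by simp
        moreover have "\<delta> (r \<otimes> m) = \<sigma> r \<otimes> \<delta> m \<oplus> m \<otimes> \<delta> r"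
          using \<delta>_mult[OF r mM(3)] r mM(3) by (simp add: m_comm)
        ultimately show ?thesis using ideal_add[OF N] M(6)[OF r mM(1)] by simp
      qed
    qed
    have "set ys \<subseteq> ?K" using t(2) SN genideal_self[OF ys(1)] ys(2) by auto
    hence MK: "max_ideal R \<subseteq> ?K" unfolding ys(2)[symmetric] by (intro genideal_minimal) (simp_all add: K ys(2))
    have "I\<^sub>G \<subseteq> ?N"
    proof (rule I\<^sub>G_minimal[OF N])
      fix b assume b: "b \<in> carrier R"
      then obtain a where a: "a \<in> fixed" "b \<ominus> a \<in> max_ideal R" using res by blast
      have ac: "a \<in> carrier R" using a(1) fixedD by blast
      have "b = (b \<ominus> a) \<oplus> a" using b ac by algebra
      hence "\<delta> b = \<delta> (b \<ominus> a)" using \<delta>_add[of "b \<ominus> a" a] \<delta>_fixed[OF a(1)] b ac by simp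
      thus "\<delta> b \<in> ?N" using a(2) MK by auto
    qed
    thus "a \<in> ?N" if "a \<in> I\<^sub>G" for a using that by blast
  qed
  moreover have "Idl {t} \<subseteq> I\<^sub>G" using t(1) by (intro genideal_minimal I\<^sub>G_ideal) simp
  ultimately have "I\<^sub>G = Idl {t}" by blast
  thus ?thesis by (intro principalidealI I\<^sub>G_ideal bexI[of _ t] tc)
qed

text \<open>Subtracting an invariant moves the generator of the fixed ring extension into \<open>\<mm>\<close>. Then every polynomial in \<open>y\<close> is
  congruent modulo \<open>y\<close> to its constant term, an invariant, which lies in \<open>\<mm>\<close> along with the polynomial.\<close>

lemma principal_imp_max_ideal_generators:
  assumes princ: "principalideal I\<^sub>G R" and res: "\<And>b. b \<in> carrier R \<Longrightarrow> \<exists>a \<in> fixed. b \<ominus> a \<in> max_ideal R"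
  obtains y where "y \<in> max_ideal R" "Idl (insert y (fixed \<inter> max_ideal R)) = max_ideal R"
proof -
  obtain x where x: "x \<in> carrier R" "\<And>f. f \<in> carrier R \<Longrightarrow> \<exists>cs. length cs = p \<and> set cs \<subseteq> fixed \<and> f = horner cs x"
    using power_basis[OF princ] by metis
  obtain a where a: "a \<in> fixed" "x \<ominus> a \<in> max_ideal R" using res[OF x(1)] by blast
  have ac: "a \<in> carrier R" using a(1) fixedD by blast
  define y where "y = x \<ominus> a"
  have yM: "y \<in> max_ideal R" "y \<in> carrier R" unfolding y_def using a(2) mem_max_ideal_carrier by auto
  have xy: "x = y \<oplus> a" unfolding y_def using x(1) ac by algebra
  note F = subringE[OF fixed_subring]
  let ?X = "insert y (fixed \<inter> max_ideal R)"
  have X: "?X \<subseteq> carrier R" using yM(2) mem_max_ideal_carrier by blast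
  have Y: "ideal (Idl {y}) R" "y \<in> Idl {y}" using genideal_ideal[of "{y}"] genideal_self'[of y] yM(2) by auto
  have hor: "\<exists>c \<in> fixed. horner cs x \<ominus> c \<in> Idl {y}" if "set cs \<subseteq> fixed" for cs
    using that
  proof (induction cs)
    case Nil
    show ?case using F(2) ideal_zero[OF Y(1)] by (intro bexI[of _ \<zero>]) (auto simp: minus_self)
  next
    case (Cons d cs)
    then obtain c where c: "c \<in> fixed" "horner cs x \<ominus> c \<in> Idl {y}" by auto
    have "set cs \<subseteq> carrier R" using Cons.prems fixedD(1) by auto
    hence hc: "horner cs x \<in> carrier R" using x(1) by simp
    have cc: "c \<in> carrier R" "d \<in> carrier R" using c(1) Cons.prems fixedD(1) by auto
    have "horner (d # cs) x \<ominus> (d \<oplus> a \<otimes> c) = x \<otimes> (horner cs x \<ominus> c) \<oplus> c \<otimes> (x \<ominus> a)"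
      unfolding horner.simps using hc cc ac x(1) by algebra
    moreover have "x \<otimes> (horner cs x \<ominus> c) \<in> Idl {y}" by (rule ideal_lmult[OF Y(1) x(1) c(2)])
    moreover have "c \<otimes> (x \<ominus> a) \<in> Idl {y}" using ideal_lmult[OF Y(1) cc(1) Y(2)] unfolding y_def .
    moreover have "d \<oplus> a \<otimes> c \<in> fixed" using F(6,7) a(1) c(1) Cons.prems by simp
    ultimately show ?case using ideal_add[OF Y(1)] by (intro bexI[of _ "d \<oplus> a \<otimes> c"]) auto
  qed
  have "Idl {y} \<subseteq> Idl ?X" using X by (intro subset_Idl_subset) auto
  have "max_ideal R \<subseteq> Idl ?X"
  proof
    fix b assume b: "b \<in> max_ideal R"
    have bc: "b \<in> carrier R" using b mem_max_ideal_carrier by blast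
    obtain cs where cs: "set cs \<subseteq> fixed" "b = horner cs x" using x(2)[OF bc] by blast
    obtain c where c: "c \<in> fixed" "b \<ominus> c \<in> Idl {y}" using hor[OF cs(1)] unfolding cs(2) by blast
    have cc: "c \<in> carrier R" using c(1) fixedD by blast
    have "Idl {y} \<subseteq> max_ideal R" using yM(1) by (intro genideal_minimal max_ideal_ideal) simp
    hence "b \<ominus> c \<in> max_ideal R" using c(2) by blast
    hence "b \<ominus> (b \<ominus> c) \<in> max_ideal R" using ideal_diff[OF max_ideal_ideal b] by blast
    moreover have "b \<ominus> (b \<ominus> c) = c" using bc cc by algebra
    ultimately have "c \<in> Idl ?X" using c(1) genideal_self[OF X] by auto
    thus "b \<in> Idl ?X"
      using ideal_diff_cancel[OF genideal_ideal[OF X] _ _ bc, of c] c(2) \<open>Idl {y} \<subseteq> Idl ?X\<close> by blast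
  qed
  moreover have "Idl ?X \<subseteq> max_ideal R" using yM(1) by (intro genideal_minimal max_ideal_ideal) auto
  ultimately show ?thesis using that yM(1) by blast
qed

text \<open>The exchange lemma produces parameters among \<open>y\<close> and the invariants. The element \<open>y\<close> may occur several times; it is moved
  to the front once, and its other occurrences are replaced by zero.\<close>

lemma principal_imp_pseudo_reflection:
  assumes reg: "regular_local_ring R" and princ: "principalideal I\<^sub>G R"
    and res: "\<And>b. b \<in> carrier R \<Longrightarrow> \<exists>a \<in> fixed. b \<ominus> a \<in> max_ideal R"
  obtains zs where "regular_system_of_parameters R zs" "set (tl zs) \<subseteq> fixed"
proof -
  have noeth: "noetherian_ring R" using reg unfolding regular_local_ring_def by blast
  interpret R: noetherian_local_ring R
    by (intro noetherian_local_ring.intro noetherian_cring.intro noeth cring_axioms local_ring_axioms)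
  obtain ys where ys: "set ys \<subseteq> carrier R" "enat (length ys) = krull_dim R" "Idl (set ys) = max_ideal R"
    using reg unfolding regular_local_ring_def regular_system_of_parameters_def by blast
  obtain y where y: "y \<in> max_ideal R" "Idl (insert y (fixed \<inter> max_ideal R)) = max_ideal R"
    using principal_imp_max_ideal_generators[OF princ res] by blast
  let ?X = "insert y (fixed \<inter> max_ideal R)"
  have X: "?X \<subseteq> max_ideal R" "?X \<subseteq> carrier R" using y(1) mem_max_ideal_carrier by auto
  obtain zs where zs: "length zs = length ys" "set zs \<subseteq> ?X" "Idl (set zs) = max_ideal R"
    using R.exchange_generators[OF X(2) y(2), of "[]" ys] ys(1,3) by auto
  show ?thesis
  proof (cases "y \<in> set zs")
    case False
    hence "set zs \<subseteq> fixed" using zs(2) by blast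
    hence "set (tl zs) \<subseteq> fixed" by (cases zs) auto
    moreover have "regular_system_of_parameters R zs"
      unfolding regular_system_of_parameters_def using zs X(2) ys(2) by auto
    ultimately show ?thesis using that by blast
  next
    case True
    define ws where "ws = y # map (\<lambda>z. if z = y then \<zero> else z) (remove1 y zs)"
    have "set (remove1 y zs) \<subseteq> set zs" by (rule set_remove1_subset)
    hence rem: "set (remove1 y zs) \<subseteq> ?X" using zs(2) by blast
    have zF: "\<zero> \<in> fixed \<inter> max_ideal R" using subringE(2)[OF fixed_subring] ideal_zero[OF max_ideal_ideal] by blast
    have tl: "set (tl ws) \<subseteq> fixed" unfolding ws_def using rem zF by auto
    have wsM: "set ws \<subseteq> max_ideal R" unfolding ws_def using rem zF y(1) by auto
    hence wsc: "set ws \<subseteq> carrier R" using mem_max_ideal_carrier by blast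
    have len: "length ws = length zs"
      unfolding ws_def using True length_remove1[of y zs] length_pos_if_in_set[OF True] by simp
    have "z \<in> set ws" if z: "z \<in> set zs" for z
    proof (cases "z = y")
      case False
      hence "z \<in> set (remove1 y zs)" using z by simp
      thus ?thesis unfolding ws_def using False by force
    qed (simp add: ws_def)
    hence "Idl (set zs) \<subseteq> Idl (set ws)" using wsc by (intro subset_Idl_subset) auto
    moreover have "Idl (set ws) \<subseteq> max_ideal R" by (rule genideal_minimal[OF max_ideal_ideal wsM])
    ultimately have "Idl (set ws) = max_ideal R" using zs(3) by blast
    hence "regular_system_of_parameters R ws"
      unfolding regular_system_of_parameters_def using wsc len zs(1) ys(2) by simp
    thus ?thesis using that tl by blast
  qed
qed

text \<open>The class of \<open>b\<close> is the image of a class of the fixed ring. That image is a union of classes of \<open>R\<close>, so it is the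
  class of any representative \<open>a\<close>.\<close>

lemma residue_map_surjective:
  assumes "residue_map R \<in> ring_iso (residue_field A) (residue_field R)" and b: "b \<in> carrier R"
  shows "\<exists>a \<in> fixed. b \<ominus> a \<in> max_ideal R"
proof -
  let ?M = "max_ideal R"
  interpret M: ideal ?M R by (rule max_ideal_ideal)
  have "?M +> b \<in> carrier (residue_field R)"
    unfolding residue_field_def FactRing_def A_RCOSETS_def' using b by auto
  moreover have "bij_betw (residue_map R) (carrier (residue_field A)) (carrier (residue_field R))"
    using assms(1) unfolding ring_iso_def by simp
  ultimately have "?M +> b \<in> residue_map R ` carrier (residue_field A)" by (simp add: bij_betw_def)
  then obtain U where U: "?M +> b = residue_map R U" "U \<in> carrier (residue_field A)" by (rule imageE)
  obtain a where a: "a \<in> fixed" "U = max_ideal A +>\<^bsub>A\<^esub> a"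
    using U(2) unfolding residue_field_def FactRing_def A_RCOSETS_def' by auto
  interpret A: cring A by (rule fixed_ring_cring)
  have ac: "a \<in> carrier R" using a(1) fixedD by blast
  have "\<zero> \<in> max_ideal A" unfolding fixed_ring_local(2) using subringE(2)[OF fixed_subring] ideal_zero[OF max_ideal_ideal] by blast
  hence "a \<in> U" unfolding a(2) a_r_coset_def' using ac by force
  hence "?M +> a \<subseteq> ?M +> b" unfolding U(1) residue_map_def by (rule UN_upper)
  moreover have "a \<in> ?M +> a" using ideal_zero[OF max_ideal_ideal] ac unfolding a_r_coset_def' by force
  ultimately obtain m where m: "m \<in> ?M" "a = m \<oplus> b" unfolding a_r_coset_def' by blast
  have mc: "m \<in> carrier R" using m(1) mem_max_ideal_carrier by blast
  have "b \<ominus> a = \<ominus> m" unfolding m(2) using mc b by algebra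
  hence "b \<ominus> a \<in> ?M" using ideal_uminus[OF max_ideal_ideal m(1)] by (simp only:)
  thus ?thesis using a(1) by (rule bexI)
qed

end

section \<open>Cyclic groups of prime order\<close>

lemma BijGroup_simps:
  "carrier (BijGroup S) = Bij S" "\<one>\<^bsub>BijGroup S\<^esub> = (\<lambda>x\<in>S. x)"
  "\<lbrakk>f \<in> Bij S; g \<in> Bij S\<rbrakk> \<Longrightarrow> f \<otimes>\<^bsub>BijGroup S\<^esub> g = compose S f g"
  by (simp_all add: BijGroup_def)

lemma BijGroup_pow:
  assumes "\<sigma> \<in> Bij S" "x \<in> S"
  shows "(\<sigma> [^]\<^bsub>BijGroup S\<^esub> (n :: nat)) x = (\<sigma> ^^ n) x"
proof -
  interpret G: group "BijGroup S" by (rule group_BijGroup)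
  have c: "\<sigma> \<in> carrier (BijGroup S)" using assms(1) by (simp add: BijGroup_simps)
  show ?thesis
    using assms(2)
  proof (induction n arbitrary: x)
    case 0
    have "(\<sigma> [^]\<^bsub>BijGroup S\<^esub> (0 :: nat)) x = (\<lambda>x\<in>S. x) x" by (simp only: G.nat_pow_0 BijGroup_simps)
    thus ?case using 0 by simp
  next
    case (Suc n)
    let ?g = "\<sigma> [^]\<^bsub>BijGroup S\<^esub> n"
    have g: "?g \<in> Bij S" using G.nat_pow_closed[OF c, of n] by (simp only: BijGroup_simps)
    have "(\<sigma> [^]\<^bsub>BijGroup S\<^esub> Suc n) x = (?g \<otimes>\<^bsub>BijGroup S\<^esub> \<sigma>) x" by (simp only: G.nat_pow_Suc)
    also have "\<dots> = compose S ?g \<sigma> x" by (simp only: BijGroup_simps(3)[OF g assms(1)])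
    also have "\<dots> = ?g (\<sigma> x)" using Suc.prems by (simp add: compose_def)
    also have "\<dots> = (\<sigma> ^^ n) (\<sigma> x)" using Bij_imp_funcset[OF assms(1)] Suc.prems by (intro Suc.IH) blast
    also have "\<dots> = (\<sigma> ^^ Suc n) x" by (simp only: funpow_Suc_right comp_apply)
    finally show ?case .
  qed
qed

lemma generate_fixes:
  assumes "\<sigma> \<in> Bij S" "x \<in> S" "\<sigma> x = x" "g \<in> generate (BijGroup S) {\<sigma>}"
  shows "g x = x"
  using assms(4)
proof (induction g rule: generate.induct)
  case one
  show ?case using assms(2) by (simp add: BijGroup_simps)
next
  case (incl h)
  thus ?case using assms(3) by simp
next
  case (inv h)
  have "inj_on \<sigma> S" using assms(1) unfolding Bij_def bij_betw_def by blast
  hence "inv_into S \<sigma> x = x" using assms(2,3) by (metis inv_into_f_f)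
  thus ?case using inv inv_BijGroup[OF assms(1)] assms(2) by simp
next
  case (eng h k)
  interpret G: group "BijGroup S" by (rule group_BijGroup)
  have "{\<sigma>} \<subseteq> carrier (BijGroup S)" using assms(1) by (simp add: BijGroup_simps)
  hence "h \<in> carrier (BijGroup S)" "k \<in> carrier (BijGroup S)"
    by (rule G.generate_in_carrier[OF _ eng(1)], rule G.generate_in_carrier[OF _ eng(2)])
  hence "h \<otimes>\<^bsub>BijGroup S\<^esub> k = compose S h k" by (intro BijGroup_simps(3)) (simp_all only: BijGroup_simps)
  thus ?case using eng(3,4) assms(2) by (simp add: compose_def)
qed

text \<open>The order of \<open>\<sigma>\<close> divides that of the group, and what the generator fixes is fixed by the group.\<close>

lemma cyclic_prime_group_automorphism:
  fixes B :: "('a, 'm) ring_scheme"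
  assumes "local_ring B" and "domain B" and p: "Factorial_Ring.prime p"
    and G: "subgroup G (BijGroup (carrier B))" "G \<subseteq> local_auto B" "card G = p"
    and \<sigma>: "\<sigma> \<in> G" "generate (BijGroup (carrier B)) {\<sigma>} = G"
  shows "prime_order_automorphism B \<sigma> p" "invariants B G = prime_order_automorphism.fixed B \<sigma>"
proof -
  let ?S = "carrier B"
  interpret BG: group "BijGroup ?S" by (rule group_BijGroup)
  have \<sigma>B: "\<sigma> \<in> Bij ?S" using subgroup.mem_carrier[OF G(1) \<sigma>(1)] by (simp only: BijGroup_simps)
  have \<sigma>auto: "\<sigma> \<in> local_auto B" using G(2) \<sigma>(1) by blast
  have p1: "1 < p" using prime_gt_1_nat[OF p] .
  have fin: "finite G" using G(3) p1 card.infinite by fastforce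
  have invariant_iff: "b \<in> invariants B G \<longleftrightarrow> b \<in> ?S \<and> \<sigma> b = b" for b
    unfolding invariants_def using generate_fixes[OF \<sigma>B, of b] \<sigma> by auto
  have period: "(\<sigma> ^^ p) b = b" if b: "b \<in> ?S" for b
  proof -
    interpret H: group "(BijGroup ?S)\<lparr>carrier := G\<rparr>" by (rule subgroup.subgroup_is_group[OF G(1) group_BijGroup])
    have "\<sigma> [^]\<^bsub>(BijGroup ?S)\<lparr>carrier := G\<rparr>\<^esub> order ((BijGroup ?S)\<lparr>carrier := G\<rparr>) = \<one>\<^bsub>(BijGroup ?S)\<lparr>carrier := G\<rparr>\<^esub>"
      using \<sigma>(1) by (intro H.pow_order_eq_1) simp
    hence "\<sigma> [^]\<^bsub>BijGroup ?S\<^esub> p = \<one>\<^bsub>BijGroup ?S\<^esub>"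
      using G(3) by (simp add: order_def nat_pow_def)
    hence "(\<sigma> [^]\<^bsub>BijGroup ?S\<^esub> p) b = (\<lambda>x\<in>?S. x) b" by (simp only: BijGroup_simps)
    thus ?thesis unfolding BijGroup_pow[OF \<sigma>B b] using b by simp
  qed
  have nontrivial: "\<exists>b \<in> ?S. \<sigma> b \<noteq> b"
  proof (rule ccontr)
    assume "\<not> ?thesis"
    hence id: "\<And>b. b \<in> ?S \<Longrightarrow> \<sigma> b = b" by blast
    have "g = (\<lambda>x\<in>?S. x)" if g: "g \<in> G" for g
    proof (rule extensionalityI[of _ ?S])
      show "g \<in> extensional ?S" using subgroup.mem_carrier[OF G(1) g] by (simp add: BijGroup_simps Bij_imp_extensional)
      show "g x = (\<lambda>x\<in>?S. x) x" if "x \<in> ?S" for x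
        using generate_fixes[OF \<sigma>B that id[OF that], of g] g \<sigma>(2) that by simp
    qed simp
    hence "G \<subseteq> {\<lambda>x\<in>?S. x}" by blast
    hence "card G \<le> 1" using card_mono[of "{\<lambda>x\<in>?S. x}" G] by simp
    thus False using G(3) p1 by simp
  qed
  show aut: "prime_order_automorphism B \<sigma> p"
  proof (intro prime_order_automorphism.intro prime_order_automorphism_axioms.intro assms(1,2) p nontrivial)
    show "\<sigma> \<in> ring_hom B B" using \<sigma>auto unfolding local_auto_def ring_iso_def by blast
    show "\<sigma> a \<in> max_ideal B" if "a \<in> max_ideal B" for a using \<sigma>auto that unfolding local_auto_def by blast
  qed (rule period)
  show "invariants B G = prime_order_automorphism.fixed B \<sigma>"
    using invariant_iff prime_order_automorphism.fixed_def[OF aut] by blast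
qed

section \<open>Principal augmentation ideals\<close>

theorem theorem2:
  fixes B :: "('a, 'm) ring_scheme"
    and G :: "('a \<Rightarrow> 'a) set" and \<sigma> :: "'a \<Rightarrow> 'a" and p :: nat
  assumes "local_ring B" and "normal_domain B"
    and "Factorial_Ring.prime p"
    and "subgroup G (BijGroup (carrier B))" and "G \<subseteq> local_auto B" and "card G = p"
    and "\<sigma> \<in> G" and "generate (BijGroup (carrier B)) {\<sigma>} = G"
  shows "let A = invariant_ring B G;
             a = principalideal (augmentation_ideal B \<sigma>) B;
             b = monogenous B (carrier A);
             c = free_module A (mult_module B);
             d = regular_local_ring A;
             e = pseudo_reflection B G
         in (a \<longleftrightarrow> b) \<and> (b \<longrightarrow> c) \<and>
            (regular_local_ring B \<longrightarrow>
               (c \<longrightarrow> d) \<and>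
               (residue_map B \<in> ring_iso (residue_field A) (residue_field B) \<longrightarrow> (a \<longleftrightarrow> e)))"
proof -
  have "domain B" using assms(2) unfolding normal_domain_def by blast
  note aut = cyclic_prime_group_automorphism[OF assms(1) this assms(3-)]
  interpret prime_order_automorphism B \<sigma> p by (rule aut(1))
  note inv = aut(2)
  have ab: "principalideal I\<^sub>G B \<longleftrightarrow> monogenous B fixed"
    using principal_imp_monogenous monogenous_imp_principal by blast
  have ae: "principalideal I\<^sub>G B \<longleftrightarrow> pseudo_reflection B G"
    if reg: "regular_local_ring B" and res: "residue_map B \<in> ring_iso (residue_field A) (residue_field B)"
  proof
    assume "principalideal I\<^sub>G B"
    then obtain zs where "regular_system_of_parameters B zs" "set (tl zs) \<subseteq> fixed"
      using principal_imp_pseudo_reflection[OF reg _ residue_map_surjective[OF res]] by blast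
    thus "pseudo_reflection B G" unfolding pseudo_reflection_def inv by blast
  next
    assume "pseudo_reflection B G"
    then obtain ys where ys: "set ys \<subseteq> carrier B" "Idl\<^bsub>B\<^esub> (set ys) = max_ideal B" "set (tl ys) \<subseteq> fixed"
      unfolding pseudo_reflection_def inv regular_system_of_parameters_def by blast
    have "noetherian_ring B" using reg unfolding regular_local_ring_def by blast
    from pseudo_reflection_imp_principal[OF this residue_map_surjective[OF res] ys]
    show "principalideal I\<^sub>G B" .
  qed
  show ?thesis
    unfolding Let_def inv using ab ae fixed_ring_free fixed_ring_regular by simp
qed

end
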